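(* Consider a sequence, indexed by $N$, of completely randomized non-uniform designs (with $\overline n,\underline c,\overline c$ fixed), a grouping of $\mathcal Q_{\mathrm U}$, and the composite estimator $\hat V_{\hat\gamma}=F^\top\hat V_{\hat Y}F$ where $\hat V_{\hat Y}$ is diagonal with $\hat V_{\hat Y}(q,q)=\mu_{\langle g\rangle_q}(Y_q-\hat Y_{\langle g\rangle_q})^2$ for $q\in\mathcal Q_{\mathrm U}$ and $\hat V_{\hat Y}(q,q)=N_q^{-1}\hat S(q,q)$ for $q\in\mathcal Q_{\mathrm R}\cup\mathcal Q_{\mathrm L}$. Assume $S(q,q)>0$ for all $q$, Conditions 3, 5 and 6, and that $\max_g\mu_{\langle g\rangle}$, $\Delta$ and $\zeta$ are bounded by constants. Write $F_{\mathrm U},F_{\mathrm R},F_{\mathrm L}$ for the submatrices of rows of $F$ indexed by $\mathcal Q_{\mathrm U},\mathcal Q_{\mathrm R},\mathcal Q_{\mathrm L}$. Then (i) $\mathbb E\{\hat V_{\hat\gamma}\}\succeq V_{\hat\gamma}$; (ii) $\|\hat V_{\hat\gamma}-\mathbb E\hat V_{\hat\gamma}\|_\infty^2=O_{\mathbb P}\big(\|F_{\mathrm U}\|_\infty^4|\mathcal Q_{\mathrm U}|H^2+\|F_{\mathrm R}\|_\infty^4|\mathcal Q_{\mathrm R}|H^2+\|F_{\mathrm L}\|_\infty^4|\mathcal Q_{\mathrm L}|^4N_{\mathrm L}^{-3}H^2\big)$; (iii) $\|\hat V_{\hat\gamma}-\mathbb E\hat V_{\hat\gamma}\|_{\mathrm{op}}^2=O_{\mathbb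 P}\big(\|F_{\mathrm U}\|_\infty^4|\mathcal Q_{\mathrm U}|H^4+\|F_{\mathrm R}\|_\infty^4|\mathcal Q_{\mathrm R}|H^4+\|F_{\mathrm L}\|_\infty^4|\mathcal Q_{\mathrm L}|^4N_{\mathrm L}^{-3}H^4\big)$ (with the convention $0\cdot\infty=0$ when some of these sets are empty).
   Context: Randomization model: $N$ units, $Q$ treatment levels, group sizes $N_1,\dots,N_Q\ge1$ with $\sum_qN_q=N$; unit $i$ has fixed real potential outcomes $Y_i(q)$. Under complete randomization $Z$ is uniform over all vectors in $[Q]^N$ with exactly $N_q$ coordinates equal to $q$; $Y_i=Y_i(Z_i)$. $\overline Y(q)=N^{-1}\sum_iY_i(q)$, $S(q,q')=(N-1)^{-1}\sum_i(Y_i(q)-\overline Y(q))(Y_i(q')-\overline Y(q'))$, $S=(S(q,q'))$, $S^\star(q,q')=S(q,q')/\sqrt{S(q,q)S(q',q')}$, $V_{\hat Y}=\mathrm{diag}(N_q^{-1}S(q,q))-N^{-1}S$, $V_{\hat\gamma}=F^\top V_{\hat Y}F$ for fixed $F\in\mathbb R^{Q\times H}$; $\hat Y_q=N_q^{-1}\sum_{i:Z_i=q}Y_i$, $\hat S(q,q)=(N_q-1)^{-1}\sum_{i:Z_i=q}(Y_i-\hat Y_q)^2$ (for $N_q\ge2$). For $q$ with $N_q=1$, $Y_q$ denotes the observed outcome of the unit assigned to $q$. $\|A\|_\infty$ = max absolute entry, $\|A\|_{\mathrm{op}}$ = spectral norm. Non-uniform design: $[Q]=\mathcal Q_{\mathrm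 S}\cup\mathcal Q_{\mathrm L}$ disjoint, with $N_q=c_qN_0$, $\underline c\le c_q\le\overline c$ for $q\in\mathcal Q_{\mathrm L}$ ($N_0$ a positive integer), $N_q\le\overline n$ for $q\in\mathcal Q_{\mathrm S}$; $\mathcal Q_{\mathrm U}=\{q:N_q=1\}$, $\mathcal Q_{\mathrm R}=\{q\in\mathcal Q_{\mathrm S}:N_q\ge2\}$; $N_{\mathrm L}=\sum_{q\in\mathcal Q_{\mathrm L}}N_q$. Grouping: a fixed partition $\mathcal Q_{\mathrm U}=\bigcup_{g=1}^G\langle g\rangle$ into disjoint groups of size $\ge2$; $\langle g\rangle_q$ is the group containing $q$; $\hat Y_{\langle g\rangle}=|\langle g\rangle|^{-1}\sum_{q\in\langle g\rangle}Y_q$, $\overline Y_{\langle g\rangle}=|\langle g\rangle|^{-1}\sum_{q\in\langle g\rangle}\overline Y(q)$, $\mu_{\langle g\rangle}=(1-2N^{-1})^{-1}(1-|\langle g\rangle|^{-1})^{-2}$; $\varrho_{\langle g\rangle}$ is the largest eigenvalue of $(S^\star(q,q'))_{q,q'\in\langle g\rangle}$. Condition 3: $\max_qN^{-1}\sum_i\{Y_i(q)-\overline Y(q)\}^4\le\Delta^4$. Condition 5: $N-\varrho_{\langle g\rangle}-(|\langle g\rangle|-1)\ge0$ for all groups. Condition 6: $\max_g\max_{q\in\langle g\rangle}|\overline Y(q)-\overline Y_{\langle g\rangle}|\le\zeta$. *)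

theory Defs
  imports "HOL-Analysis.Analysis"
begin

text \<open>Units are 0..<N, treatment levels 0..<Q. An assignment is a function
  z : {..<N} -> {..<Q} (extensional) with exactly Nq q units assigned to level q.
  Z is uniform over this finite set.\<close>

definition assignments :: "nat \<Rightarrow> nat \<Rightarrow> (nat \<Rightarrow> nat) \<Rightarrow> (nat \<Rightarrow> nat) set" where
  "assignments N Q Nq = {z \<in> {..<N} \<rightarrow>\<^sub>E {..<Q}. \<forall>q<Q. card {i. i < N \<and> z i = q} = Nq q}"

definition E_unif :: "'a set \<Rightarrow> ('a \<Rightarrow> real) \<Rightarrow> real" where
  "E_unif \<Omega> f = (\<Sum>z\<in>\<Omega>. f z) / real (card \<Omega>)"

definition P_unif :: "'a set \<Rightarrow> ('a \<Rightarrow> bool) \<Rightarrow> real" where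
  "P_unif \<Omega> P = real (card {z\<in>\<Omega>. P z}) / real (card \<Omega>)"

text \<open>Y i q is the potential outcome of unit i under level q.\<close>

definition Ybar :: "nat \<Rightarrow> (nat \<Rightarrow> nat \<Rightarrow> real) \<Rightarrow> nat \<Rightarrow> real" where
  "Ybar N Y q = (\<Sum>i<N. Y i q) / real N"

definition Scov :: "nat \<Rightarrow> (nat \<Rightarrow> nat \<Rightarrow> real) \<Rightarrow> nat \<Rightarrow> nat \<Rightarrow> real" where
  "Scov N Y q q' = (\<Sum>i<N. (Y i q - Ybar N Y q) * (Y i q' - Ybar N Y q')) / (real N - 1)"

definition Scor :: "nat \<Rightarrow> (nat \<Rightarrow> nat \<Rightarrow> real) \<Rightarrow> nat \<Rightarrow> nat \<Rightarrow> real" where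
  "Scor N Y q q' = Scov N Y q q' / sqrt (Scov N Y q q * Scov N Y q' q')"

definition VY :: "nat \<Rightarrow> (nat \<Rightarrow> nat) \<Rightarrow> (nat \<Rightarrow> nat \<Rightarrow> real) \<Rightarrow> nat \<Rightarrow> nat \<Rightarrow> real" where
  "VY N Nq Y q q' = (if q = q' then Scov N Y q q / real (Nq q) else 0) - Scov N Y q q' / real N"

definition Vgamma :: "nat \<Rightarrow> nat \<Rightarrow> (nat \<Rightarrow> nat) \<Rightarrow> (nat \<Rightarrow> nat \<Rightarrow> real) \<Rightarrow> (nat \<Rightarrow> nat \<Rightarrow> real)
    \<Rightarrow> nat \<Rightarrow> nat \<Rightarrow> real" where
  "Vgamma N Q Nq Y F h h' = (\<Sum>q<Q. \<Sum>q'<Q. F q h * VY N Nq Y q q' * F q' h')"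

definition QU :: "nat \<Rightarrow> (nat \<Rightarrow> nat) \<Rightarrow> nat set" where
  "QU Q Nq = {q. q < Q \<and> Nq q = 1}"

definition QR :: "nat \<Rightarrow> (nat \<Rightarrow> nat) \<Rightarrow> nat set \<Rightarrow> nat set" where
  "QR Q Nq QL = {q. q < Q \<and> q \<notin> QL \<and> Nq q \<ge> 2}"

definition NL :: "(nat \<Rightarrow> nat) \<Rightarrow> nat set \<Rightarrow> nat" where
  "NL Nq QL = (\<Sum>q\<in>QL. Nq q)"

definition Yhat :: "nat \<Rightarrow> (nat \<Rightarrow> nat) \<Rightarrow> (nat \<Rightarrow> nat \<Rightarrow> real) \<Rightarrow> (nat \<Rightarrow> nat) \<Rightarrow> nat \<Rightarrow> real" where
  "Yhat N Nq Y z q = (\<Sum>i\<in>{i. i < N \<and> z i = q}. Y i q) / real (Nq q)"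

definition Shat :: "nat \<Rightarrow> (nat \<Rightarrow> nat) \<Rightarrow> (nat \<Rightarrow> nat \<Rightarrow> real) \<Rightarrow> (nat \<Rightarrow> nat) \<Rightarrow> nat \<Rightarrow> real" where
  "Shat N Nq Y z q = (\<Sum>i\<in>{i. i < N \<and> z i = q}. (Y i q - Yhat N Nq Y z q)^2) / (real (Nq q) - 1)"

definition grp :: "nat set set \<Rightarrow> nat \<Rightarrow> nat set" where
  "grp G q = (THE g. g \<in> G \<and> q \<in> g)"

definition Yhat_grp :: "nat \<Rightarrow> (nat \<Rightarrow> nat) \<Rightarrow> (nat \<Rightarrow> nat \<Rightarrow> real) \<Rightarrow> (nat \<Rightarrow> nat) \<Rightarrow> nat set \<Rightarrow> real" where
  "Yhat_grp N Nq Y z g = (\<Sum>q\<in>g. Yhat N Nq Y z q) / real (card g)"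

definition Ybar_grp :: "nat \<Rightarrow> (nat \<Rightarrow> nat \<Rightarrow> real) \<Rightarrow> nat set \<Rightarrow> real" where
  "Ybar_grp N Y g = (\<Sum>q\<in>g. Ybar N Y q) / real (card g)"

definition mu :: "nat \<Rightarrow> nat set \<Rightarrow> real" where
  "mu N g = inverse (1 - 2 / real N) * inverse ((1 - 1 / real (card g))^2)"

definition rho :: "nat \<Rightarrow> (nat \<Rightarrow> nat \<Rightarrow> real) \<Rightarrow> nat set \<Rightarrow> real" where
  "rho N Y g = Max {l. \<exists>x :: nat \<Rightarrow> real. (\<exists>q\<in>g. x q \<noteq> 0) \<and>
       (\<forall>q\<in>g. (\<Sum>q'\<in>g. Scor N Y q q' * x q') = l * x q)}"

text \<open>Diagonal of the variance estimator \<open>V_Yhat\<close>; for N_q = 1 the observed outcome Y_q equals Yhat.\<close>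

definition VYhat :: "nat \<Rightarrow> (nat \<Rightarrow> nat) \<Rightarrow> (nat \<Rightarrow> nat \<Rightarrow> real) \<Rightarrow> nat set set \<Rightarrow> (nat \<Rightarrow> nat) \<Rightarrow> nat \<Rightarrow> real" where
  "VYhat N Nq Y G z q =
     (if Nq q = 1 then mu N (grp G q) * (Yhat N Nq Y z q - Yhat_grp N Nq Y z (grp G q))^2
      else Shat N Nq Y z q / real (Nq q))"

definition Vgammahat :: "nat \<Rightarrow> nat \<Rightarrow> (nat \<Rightarrow> nat) \<Rightarrow> (nat \<Rightarrow> nat \<Rightarrow> real) \<Rightarrow> nat set set
    \<Rightarrow> (nat \<Rightarrow> nat \<Rightarrow> real) \<Rightarrow> (nat \<Rightarrow> nat) \<Rightarrow> nat \<Rightarrow> nat \<Rightarrow> real" where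
  "Vgammahat N Q Nq Y G F z h h' = (\<Sum>q<Q. F q h * VYhat N Nq Y G z q * F q h')"

definition maxnorm :: "nat \<Rightarrow> (nat \<Rightarrow> nat \<Rightarrow> real) \<Rightarrow> real" where
  "maxnorm H A = Max (insert 0 {\<bar>A h h'\<bar> | h h'. h < H \<and> h' < H})"

definition opnorm :: "nat \<Rightarrow> (nat \<Rightarrow> nat \<Rightarrow> real) \<Rightarrow> real" where
  "opnorm H A = Sup {sqrt (\<Sum>h<H. (\<Sum>h'<H. A h h' * x h')^2) | x. (\<Sum>h<H. (x h)^2) \<le> 1}"

definition rowmax :: "nat set \<Rightarrow> nat \<Rightarrow> (nat \<Rightarrow> nat \<Rightarrow> real) \<Rightarrow> real" where
  "rowmax Qs H F = Max (insert 0 {\<bar>F q h\<bar> | q h. q \<in> Qs \<and> h < H})"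

definition bigO_P :: "(nat \<Rightarrow> 'a set) \<Rightarrow> (nat \<Rightarrow> 'a \<Rightarrow> real) \<Rightarrow> (nat \<Rightarrow> real) \<Rightarrow> bool" where
  "bigO_P \<Omega> X a \<longleftrightarrow> (\<forall>\<epsilon>>0. \<exists>M>0. \<exists>k0. \<forall>k\<ge>k0. P_unif (\<Omega> k) (\<lambda>z. \<bar>X k z\<bar> > M * a k) < \<epsilon>)"

end

theory Submission
  imports Defs "HOL-Combinatorics.Transposition"
begin

text \<open>
  Conservativeness is checked level by level. For a level with at least two units the sample
  variance is unbiased, and \<open>- S / N\<close> is negative semidefinite. For an unreplicated level \<open>q\<close> in a
  group of size \<open>m\<close>, the covariance formula for complete randomization reduces the claim to
  \<open>2 \<Sum> S(p, p') \<le> N \<Sum> S(p, p)\<close>, both sums over the group without \<open>q\<close>. The left double sum is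
  at most \<open>\<rho> \<Sum> S(p, p)\<close> by the Rayleigh quotient and at most \<open>(m - 1) \<Sum> S(p, p)\<close> by
  Cauchy-Schwarz, so Condition 5 suffices.

  Both rates follow by Markov's inequality from a bound on the expected squared Frobenius norm,
  that is, from variance bounds for single entries. These come from a Poincare inequality: the
  variance of a function of the random assignment is at most \<open>1 / N\<close> times the sum, over all ordered
  pairs of units, of the expected squared change under swapping the two units. A swap affects
  only the two levels involved, so the changes are controlled by fourth moments and no
  joint fourth-order assignment probabilities are needed.
\<close>

section \<open>Uniform expectations and matrix norms\<close>

text \<open>What shapes the rates is locality. A swap gives at most two nonzero terms in a sum over
  levels, so squaring the sum costs a factor 2 and not the number of levels. A fixed level is met by
  at most \<open>2 * N * Nq q\<close> of the ordered pairs of units, and the \<open>N\<close>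
  cancels the \<open>1 / N\<close> of the Poincare inequality. Variances therefore add up over
  levels as if the levels were independent, and each level set enters through the first power of its
  size. A level with \<open>n\<close> units contributes order \<open>n^-3\<close>; on
  \<open>QL\<close> all sizes are comparable to \<open>NL / card QL\<close>, so the sum is of order
  \<open>card QL^4 / NL^3\<close>. The obstacle is the unreplicated part: a swap moves a group mean
  and hence every deviation in that group. Writing the change as a difference of squares and moving
  the centring to the other factor restores locality. Products of changes and deviations are split
  into fourth powers, which Jensen's inequality reduces to sums linear in the assignment indicators.
  The Frobenius norm dominates both matrix norms and has \<open>H^2\<close> entries.\<close>

lemma E_unif_add: "E_unif \<Omega> (\<lambda>z. f z + g z) = E_unif \<Omega> f + E_unif \<Omega> g"
  by (simp add: E_unif_def sum.distrib add_divide_distrib)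

lemma E_unif_diff: "E_unif \<Omega> (\<lambda>z. f z - g z) = E_unif \<Omega> f - E_unif \<Omega> g"
  by (simp add: E_unif_def sum_subtractf diff_divide_distrib)

lemma E_unif_cmult: "E_unif \<Omega> (\<lambda>z. c * f z) = c * E_unif \<Omega> f"
  by (simp add: E_unif_def sum_distrib_left[symmetric])

lemma E_unif_cmult_right: "E_unif \<Omega> (\<lambda>z. f z * c) = E_unif \<Omega> f * c"
  using E_unif_cmult[of \<Omega> c f] by (simp add: mult.commute)

lemma E_unif_divide: "E_unif \<Omega> (\<lambda>z. f z / c) = E_unif \<Omega> f / c"
  using E_unif_cmult_right[of \<Omega> f "inverse c"] by (simp add: divide_inverse)

lemma E_unif_sum: "E_unif \<Omega> (\<lambda>z. \<Sum>i\<in>I. f i z) = (\<Sum>i\<in>I. E_unif \<Omega> (f i))"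
  unfolding E_unif_def sum_divide_distrib[symmetric] by (subst sum.swap) simp

lemma E_unif_mono:
  assumes "\<And>z. z \<in> \<Omega> \<Longrightarrow> f z \<le> g z"
  shows "E_unif \<Omega> f \<le> E_unif \<Omega> g"
  unfolding E_unif_def by (intro divide_right_mono sum_mono assms) auto

lemma E_unif_cong:
  assumes "\<And>z. z \<in> \<Omega> \<Longrightarrow> f z = g z"
  shows "E_unif \<Omega> f = E_unif \<Omega> g"
  unfolding E_unif_def using assms by simp

lemma E_unif_const:
  assumes "finite \<Omega>" "\<Omega> \<noteq> {}"
  shows "E_unif \<Omega> (\<lambda>_. c) = c"
  unfolding E_unif_def using assms by simp

text \<open>Markov's inequality. Since \<open>C\<close> does not depend on \<open>k\<close>, one
  \<open>M\<close> serves all indices and the tail bound holds for every \<open>k\<close>, not only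
  eventually.\<close>

lemma bigO_P_of_E_unif_le:
  fixes \<Omega> :: "nat \<Rightarrow> 'a set"
  assumes fin: "\<And>k. finite (\<Omega> k)"
    and X: "\<And>k z. z \<in> \<Omega> k \<Longrightarrow> 0 \<le> X k z"
    and a: "\<And>k. 0 \<le> a k"
    and le: "\<And>k. E_unif (\<Omega> k) (X k) \<le> C * a k"
  shows "bigO_P \<Omega> X a"
  unfolding bigO_P_def
proof (intro allI impI)
  fix \<epsilon> :: real assume e: "\<epsilon> > 0"
  \<comment> \<open>The choice gives \<open>\<epsilon> * M = \<bar>C\<bar> + \<epsilon>\<close>,
    which strictly exceeds \<open>C\<close>; the summand 1 keeps \<open>M\<close> positive when
    \<open>C = 0\<close>.\<close>
  define M where "M = \<bar>C\<bar> / \<epsilon> + 1"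
  have M: "M > 0" unfolding M_def using e by (simp add: add_nonneg_pos)
  have "P_unif (\<Omega> k) (\<lambda>z. \<bar>X k z\<bar> > M * a k) < \<epsilon>" for k
  proof (cases "\<Omega> k = {}")
    case True
    then show ?thesis using e by (simp add: P_unif_def)
  next
    case False
    have c: "real (card (\<Omega> k)) > 0" using False fin by (simp add: card_gt_0_iff)
    define B where "B = {z \<in> \<Omega> k. \<bar>X k z\<bar> > M * a k}"
    have sle: "(\<Sum>z\<in>\<Omega> k. X k z) \<le> C * a k * real (card (\<Omega> k))"
      using le[of k] c by (simp add: E_unif_def field_simps)
    \<comment> \<open>A vanishing rate cannot be divided out. There the expectation bound forces
      \<open>X k\<close> to be zero on all of \<open>\<Omega> k\<close>, so the event is
      empty.\<close>
    show ?thesis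
    proof (cases "a k = 0")
      case True
      then have "(\<Sum>z\<in>\<Omega> k. X k z) \<le> 0" using sle by simp
      then have "\<forall>z\<in>\<Omega> k. X k z = 0"
        using sum_nonneg_eq_0_iff[of "\<Omega> k" "X k"] sum_nonneg[of "\<Omega> k" "X k"] fin[of k] X[of _ k] by (metis order_antisym_conv)
      then have "B = {}" unfolding B_def using True by auto
      then show ?thesis using e unfolding P_unif_def B_def[symmetric] by simp
    next
      case False
      then have ak: "a k > 0" using a[of k] by simp
      have "real (card B) * (M * a k) = (\<Sum>z\<in>B. M * a k)" by simp
      also have "\<dots> \<le> (\<Sum>z\<in>B. X k z)"
        by (intro sum_mono) (use X in \<open>force simp: B_def\<close>)
      also have "\<dots> \<le> (\<Sum>z\<in>\<Omega> k. X k z)"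
        by (intro sum_mono2 fin) (auto simp: B_def X)
      also note sle
      finally have "(real (card B) * M) * a k \<le> (C * real (card (\<Omega> k))) * a k" by (simp add: mult_ac)
      then have "real (card B) * M \<le> C * real (card (\<Omega> k))" using ak by simp
      also have "\<dots> < (\<epsilon> * M) * real (card (\<Omega> k))"
      proof (intro mult_strict_right_mono c)
        have "\<epsilon> * M = \<bar>C\<bar> + \<epsilon>" unfolding M_def using e by (simp add: field_simps)
        then show "C < \<epsilon> * M" using e by linarith
      qed
      finally have "real (card B) < \<epsilon> * real (card (\<Omega> k))" using M by (simp add: mult_ac)
      then show ?thesis using c unfolding B_def P_unif_def by (simp add: field_simps)
    qed
  qed
  then show "\<exists>M>0. \<exists>k0. \<forall>k\<ge>k0. P_unif (\<Omega> k) (\<lambda>z. \<bar>X k z\<bar> > M * a k) < \<epsilon>"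
    using M by blast
qed

lemma maxnorm_sq_le: "(maxnorm H A)^2 \<le> (\<Sum>h<H. \<Sum>h'<H. (A h h')^2)"
proof -
  define B where "B = {\<bar>A h h'\<bar> | h h'. h < H \<and> h' < H}"
  have "B = (\<lambda>(h,h'). \<bar>A h h'\<bar>) ` ({..<H} \<times> {..<H})" unfolding B_def by auto
  then have fin: "finite B" by simp
  have "maxnorm H A \<in> insert 0 B" unfolding maxnorm_def B_def[symmetric] using fin
    by (intro Max_in) auto
  then consider "maxnorm H A = 0" | h h' where "h < H" "h' < H" "maxnorm H A = \<bar>A h h'\<bar>"
    unfolding B_def by auto
  then show ?thesis
  proof cases
    case 1 then show ?thesis by (simp add: sum_nonneg)
  next
    case 2
    have "(A h h')^2 \<le> (\<Sum>h'<H. (A h h')^2)"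
      using 2 by (intro member_le_sum) auto
    also have "\<dots> \<le> (\<Sum>h<H. \<Sum>h'<H. (A h h')^2)"
      using 2 by (intro member_le_sum[of h _ "\<lambda>h. \<Sum>h'<H. (A h h')^2"]) (auto simp: sum_nonneg)
    finally show ?thesis using 2 by simp
  qed
qed

text \<open>Cauchy-Schwarz in every row bounds the image of a vector of norm at most 1 by the
  Frobenius norm.\<close>

lemma opnorm_sq_le: "(opnorm H A)^2 \<le> (\<Sum>h<H. \<Sum>h'<H. (A h h')^2)"
proof -
  define K where "K = (\<Sum>h<H. \<Sum>h'<H. (A h h')^2)"
  have K0: "K \<ge> 0" unfolding K_def by (simp add: sum_nonneg)
  define B where "B = {sqrt (\<Sum>h<H. (\<Sum>h'<H. A h h' * x h')^2) | x. (\<Sum>h<H. (x h)^2) \<le> (1::real)}"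
  have ub: "b \<le> sqrt K" if "b \<in> B" for b
  proof -
    from that obtain x where x: "(\<Sum>h<H. (x h)^2) \<le> (1::real)"
      and b: "b = sqrt (\<Sum>h<H. (\<Sum>h'<H. A h h' * x h')^2)" unfolding B_def by auto
    have "(\<Sum>h<H. (\<Sum>h'<H. A h h' * x h')^2) \<le> (\<Sum>h<H. (\<Sum>h'<H. (A h h')^2) * (\<Sum>h'<H. (x h')^2))"
      by (intro sum_mono Cauchy_Schwarz_ineq_sum)
    also have "\<dots> \<le> (\<Sum>h<H. (\<Sum>h'<H. (A h h')^2) * 1)"
      by (intro sum_mono mult_left_mono x sum_nonneg) auto
    also have "\<dots> = K" by (simp add: K_def)
    finally show ?thesis unfolding b by simp
  qed
  \<comment> \<open>The zero vector makes the set nonempty, as \<open>cSup_least\<close> requires,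
    and makes the supremum nonnegative, as squaring requires.\<close>
  have zero: "0 \<in> B" unfolding B_def by (rule CollectI, rule exI[of _ "\<lambda>_. 0"]) simp
  have op: "opnorm H A = Sup B" unfolding opnorm_def B_def ..
  have "Sup B \<le> sqrt K" using zero by (intro cSup_least ub) auto
  moreover have "0 \<le> Sup B" using zero ub by (intro cSup_upper bdd_aboveI[of _ "sqrt K"]) auto
  ultimately have "(Sup B)^2 \<le> (sqrt K)^2" by (intro power_mono)
  then show ?thesis using K0 op K_def by simp
qed

section \<open>A Poincare inequality for random transpositions\<close>

text \<open>The bare name \<open>transpose\<close> would denote the matrix transpose.\<close>

abbreviation tau :: "'i \<Rightarrow> 'i \<Rightarrow> 'i \<Rightarrow> 'i" where "tau \<equiv> Transposition.transpose"

lemma comp_transpose_twice: "z \<circ> tau i j \<circ> tau i j = z"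
  by (auto simp: fun_eq_iff)

text \<open>Composition with a transposition is an involution of \<open>\<Omega>\<close>. The
  predicate is pulled back on the source side so that a condition on coordinate \<open>j\<close>
  turns into one on coordinate \<open>i\<close>.\<close>

lemma bij_betw_comp_transpose:
  assumes closed: "\<And>z. z \<in> \<Omega> \<Longrightarrow> z \<circ> tau i j \<in> \<Omega>"
  shows "bij_betw (\<lambda>z. z \<circ> tau i j) {z \<in> \<Omega>. P (z \<circ> tau i j)} {z \<in> \<Omega>. P z}"
  by (rule bij_betw_byWitness[where f' = "\<lambda>z. z \<circ> tau i j"])
    (auto simp: comp_transpose_twice closed)

text \<open>Bias-variance decomposition. Used on each conditional set with \<open>c\<close> the
  overall mean, it splits the variance into a within and a between part.\<close>

lemma sum_sq_dev_decomp:
  fixes f :: "'a \<Rightarrow> real"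
  assumes fin: "finite \<Omega>"
  shows "(\<Sum>z\<in>\<Omega>. (f z - c)^2) = (\<Sum>z\<in>\<Omega>. (f z - E_unif \<Omega> f)^2) + real (card \<Omega>) * (E_unif \<Omega> f - c)^2"
proof (cases "\<Omega> = {}")
  case False
  define m where "m = E_unif \<Omega> f"
  have c: "real (card \<Omega>) \<noteq> 0" using False fin by simp
  have s: "(\<Sum>z\<in>\<Omega>. f z) = real (card \<Omega>) * m" unfolding m_def E_unif_def using c by simp
  have "(\<Sum>z\<in>\<Omega>. (f z - c)^2) = (\<Sum>z\<in>\<Omega>. (f z - m)^2 + (2 * (m - c)) * (f z) + ((m - c)^2 - 2 * (m - c) * m))"
    by (intro sum.cong refl) (simp add: power2_eq_square algebra_simps)
  also have "\<dots> = (\<Sum>z\<in>\<Omega>. (f z - m)^2) + (2 * (m - c)) * (\<Sum>z\<in>\<Omega>. f z) + real (card \<Omega>) * ((m - c)^2 - 2 * (m - c) * m)"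
    by (simp add: sum.distrib sum_distrib_left)
  also have "\<dots> = (\<Sum>z\<in>\<Omega>. (f z - m)^2) + real (card \<Omega>) * (m - c)^2"
    unfolding s by (simp add: algebra_simps)
  finally show ?thesis unfolding m_def .
qed simp

text \<open>If \<open>z\<close> is uniform on the assignments with \<open>z r = q\<close> and \<open>j\<close> is uniform on \<open>A\<close>, then swapping
  \<open>r\<close> and \<open>j\<close> makes \<open>z\<close> uniform on all of \<open>\<Omega>\<close>; hence the conditional mean differs from the overall
  mean by the average of \<open>f z - f (z \<circ> tau r j)\<close>.\<close>

lemma between_variance_le_transpositions:
  fixes f :: "('i \<Rightarrow> 'a) \<Rightarrow> real"
  assumes finA: "finite A" and fin: "finite \<Omega>" and r: "r \<in> A"
    and closed: "\<And>z j. z \<in> \<Omega> \<Longrightarrow> j \<in> A \<Longrightarrow> z \<circ> tau r j \<in> \<Omega>"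
    and cnt: "\<And>z w q. z \<in> \<Omega> \<Longrightarrow> w \<in> \<Omega> \<Longrightarrow> card {i\<in>A. z i = q} = card {i\<in>A. w i = q}"
  defines "\<Omega>' \<equiv> \<lambda>q. {z\<in>\<Omega>. z r = q}"
  shows "real (card A) * (\<Sum>q\<in>(\<lambda>z. z r) ` \<Omega>. real (card (\<Omega>' q)) * (E_unif (\<Omega>' q) f - E_unif \<Omega> f)^2)
    \<le> (\<Sum>j\<in>A. \<Sum>z\<in>\<Omega>. (f z - f (z \<circ> tau r j))^2)"
proof -
  define m where "m = E_unif \<Omega> f"
  have fin': "finite (\<Omega>' q)" for q using fin unfolding \<Omega>'_def by simp
  have one: "real (card A) * (real (card (\<Omega>' q)) * (E_unif (\<Omega>' q) f - m)^2)
      \<le> (\<Sum>z\<in>\<Omega>' q. \<Sum>j\<in>A. (f z - f (z \<circ> tau r j))^2)" if q: "q \<in> (\<lambda>z. z r) ` \<Omega>" for q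
  proof -
    obtain w0 where w0: "w0 \<in> \<Omega>" "w0 r = q" using q by auto
    define c where "c = card {i\<in>A. w0 i = q}"
    have cc: "card {i\<in>A. w i = q} = c" if "w \<in> \<Omega>" for w unfolding c_def by (rule cnt[OF that w0(1)])
    \<comment> \<open>Double counting: an assignment \<open>w\<close> arises from exactly one pair
      for each \<open>j\<close> with \<open>w j = q\<close>, and there are \<open>c\<close> such
      \<open>j\<close>, whatever \<open>w\<close> is.\<close>
    have key: "(\<Sum>z\<in>\<Omega>' q. \<Sum>j\<in>A. g (z \<circ> tau r j)) = real c * (\<Sum>w\<in>\<Omega>. g w)" for g :: "('i \<Rightarrow> 'a) \<Rightarrow> real"
    proof -
      have "(\<Sum>z\<in>\<Omega>' q. \<Sum>j\<in>A. g (z \<circ> tau r j)) = (\<Sum>j\<in>A. \<Sum>z\<in>\<Omega>' q. g (z \<circ> tau r j))"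
        by (rule sum.swap)
      also have "\<dots> = (\<Sum>j\<in>A. \<Sum>w\<in>{w\<in>\<Omega>. w j = q}. g w)"
      proof (rule sum.cong[OF refl])
        fix j assume j: "j \<in> A"
        show "(\<Sum>z\<in>\<Omega>' q. g (z \<circ> tau r j)) = (\<Sum>w\<in>{w\<in>\<Omega>. w j = q}. g w)"
        proof -
          have "bij_betw (\<lambda>z. z \<circ> tau r j) {z \<in> \<Omega>. (z \<circ> tau r j) j = q} {w \<in> \<Omega>. w j = q}"
            using closed[OF _ j] by (intro bij_betw_comp_transpose)
          from sum.reindex_bij_betw[OF this, of g] show ?thesis by (simp add: \<Omega>'_def)
        qed
      qed
      also have "\<dots> = (\<Sum>j\<in>A. \<Sum>w\<in>\<Omega>. if w j = q then g w else 0)"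
        by (simp add: sum.inter_filter fin)
      also have "\<dots> = (\<Sum>w\<in>\<Omega>. \<Sum>j\<in>A. if w j = q then g w else 0)" by (rule sum.swap)
      also have "\<dots> = (\<Sum>w\<in>\<Omega>. real c * g w)"
      proof (rule sum.cong[OF refl])
        fix w assume w: "w \<in> \<Omega>"
        have "(\<Sum>j\<in>A. if w j = q then g w else 0) = (\<Sum>j\<in>{j\<in>A. w j = q}. g w)"
          by (rule sum.inter_filter[symmetric, OF finA])
        then show "(\<Sum>j\<in>A. if w j = q then g w else 0) = real c * g w" using cc[OF w] by simp
      qed
      finally show ?thesis by (simp add: sum_distrib_left)
    qed
    have cO: "real (card \<Omega>) > 0" using w0 fin by (auto simp: card_gt_0_iff)
    have cq: "real (card (\<Omega>' q)) > 0" using w0 fin' by (auto simp: card_gt_0_iff \<Omega>'_def)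
    have cA: "real (card A) > 0" using r finA by (auto simp: card_gt_0_iff)
    define K where "K = real (card A) * real (card (\<Omega>' q))"
    have K0: "K > 0" unfolding K_def using cA cq by simp
    \<comment> \<open>The case \<open>g = 1\<close> of the double counting computes the number
      \<open>K\<close> of pairs.\<close>
    have Kc: "K = real c * real (card \<Omega>)" using key[of "\<lambda>_. 1"] unfolding K_def by (simp add: mult.commute)
    have sm: "(\<Sum>w\<in>\<Omega>. f w) = real (card \<Omega>) * m" unfolding m_def E_unif_def using cO by simp
    have sq: "(\<Sum>w\<in>\<Omega>' q. f w) = real (card (\<Omega>' q)) * E_unif (\<Omega>' q) f" unfolding E_unif_def using cq by simp
    have "(\<Sum>z\<in>\<Omega>' q. \<Sum>j\<in>A. f z - f (z \<circ> tau r j)) = K * E_unif (\<Omega>' q) f - K * m"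
      unfolding sum_subtractf key sm Kc using Kc by (simp add: sum_distrib_left[symmetric] sq K_def)
    then have eq: "K * (E_unif (\<Omega>' q) f - m) = (\<Sum>z\<in>\<Omega>' q. \<Sum>j\<in>A. f z - f (z \<circ> tau r j))"
      by (simp add: algebra_simps)
    also have "\<dots> = (\<Sum>x\<in>\<Omega>' q \<times> A. 1 * (f (fst x) - f (fst x \<circ> tau r (snd x))))"
      by (simp add: sum.cartesian_product case_prod_beta)
    \<comment> \<open>Cauchy-Schwarz against the constant 1 on the \<open>K\<close> pairs; one of
      the two factors \<open>K\<close> on the left then cancels.\<close>
    finally have "(K * (E_unif (\<Omega>' q) f - m))^2
        \<le> (\<Sum>x\<in>\<Omega>' q \<times> A. 1^2) * (\<Sum>x\<in>\<Omega>' q \<times> A. (f (fst x) - f (fst x \<circ> tau r (snd x)))^2)"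
      using Cauchy_Schwarz_ineq_sum[of "\<lambda>_. 1" "\<lambda>x. f (fst x) - f (fst x \<circ> tau r (snd x))" "\<Omega>' q \<times> A"] by simp
    also have "\<dots> = K * (\<Sum>z\<in>\<Omega>' q. \<Sum>j\<in>A. (f z - f (z \<circ> tau r j))^2)"
      by (simp add: sum.cartesian_product case_prod_beta K_def card_cartesian_product mult.commute)
    finally have "K * (K * (E_unif (\<Omega>' q) f - m)^2) \<le> K * (\<Sum>z\<in>\<Omega>' q. \<Sum>j\<in>A. (f z - f (z \<circ> tau r j))^2)"
      by (simp add: power_mult_distrib power2_eq_square mult_ac)
    then have "K * (E_unif (\<Omega>' q) f - m)^2 \<le> (\<Sum>z\<in>\<Omega>' q. \<Sum>j\<in>A. (f z - f (z \<circ> tau r j))^2)"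
      using K0 by simp
    then show ?thesis unfolding K_def by (simp add: mult.assoc)
  qed
  have "real (card A) * (\<Sum>q\<in>(\<lambda>z. z r) ` \<Omega>. real (card (\<Omega>' q)) * (E_unif (\<Omega>' q) f - m)^2)
     \<le> (\<Sum>q\<in>(\<lambda>z. z r) ` \<Omega>. \<Sum>z\<in>\<Omega>' q. \<Sum>j\<in>A. (f z - f (z \<circ> tau r j))^2)"
    unfolding sum_distrib_left by (intro sum_mono one)
  also have "\<dots> = (\<Sum>z\<in>\<Omega>. \<Sum>j\<in>A. (f z - f (z \<circ> tau r j))^2)"
    unfolding \<Omega>'_def by (rule sum.image_gen[symmetric, OF fin])
  also have "\<dots> = (\<Sum>j\<in>A. \<Sum>z\<in>\<Omega>. (f z - f (z \<circ> tau r j))^2)" by (rule sum.swap)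
  finally show ?thesis unfolding m_def .
qed

text \<open>A pair \<open>i \<noteq> j\<close> survives the removal of \<open>r\<close> for exactly
  \<open>card A - 2\<close> choices of \<open>r\<close>, and diagonal pairs contribute
  nothing.\<close>

lemma sum_remove_diag_pairs:
  fixes d :: "'i \<Rightarrow> 'i \<Rightarrow> real"
  assumes fin: "finite A" and d0: "\<And>i. d i i = 0"
  shows "(\<Sum>r\<in>A. \<Sum>i\<in>A - {r}. \<Sum>j\<in>A - {r}. d i j) = (real (card A) - 2) * (\<Sum>i\<in>A. \<Sum>j\<in>A. d i j)"
proof -
  define D where "D = (\<Sum>i\<in>A. \<Sum>j\<in>A. d i j)"
  have "(\<Sum>i\<in>A - {r}. \<Sum>j\<in>A - {r}. d i j) = D - (\<Sum>i\<in>A. d i r) - (\<Sum>j\<in>A. d r j)" if r: "r \<in> A" for r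
  proof -
    have "(\<Sum>i\<in>A - {r}. \<Sum>j\<in>A - {r}. d i j) = (\<Sum>i\<in>A. \<Sum>j\<in>A - {r}. d i j) - (\<Sum>j\<in>A - {r}. d r j)"
      using r fin by (simp add: sum_diff1)
    also have "(\<Sum>i\<in>A. \<Sum>j\<in>A - {r}. d i j) = D - (\<Sum>i\<in>A. d i r)"
      using r fin by (simp add: sum_diff1 sum_subtractf D_def)
    also have "(\<Sum>j\<in>A - {r}. d r j) = (\<Sum>j\<in>A. d r j)" using r fin by (simp add: sum_diff1 d0)
    finally show ?thesis .
  qed
  then have "(\<Sum>r\<in>A. \<Sum>i\<in>A - {r}. \<Sum>j\<in>A - {r}. d i j) = (\<Sum>r\<in>A. D - (\<Sum>i\<in>A. d i r) - (\<Sum>j\<in>A. d r j))"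
    by (intro sum.cong refl)
  also have "\<dots> = real (card A) * D - (\<Sum>r\<in>A. \<Sum>i\<in>A. d i r) - D"
    by (simp add: sum_subtractf D_def)
  also have "(\<Sum>r\<in>A. \<Sum>i\<in>A. d i r) = D" unfolding D_def by (rule sum.swap)
  finally show ?thesis unfolding D_def[symmetric] by (simp add: algebra_simps)
qed

text \<open>Induction on \<open>card A\<close>: condition on the value at \<open>r\<close>, apply the induction hypothesis to the
  coordinates \<open>A - {r}\<close>, and average the resulting bounds over \<open>r\<close>.\<close>

lemma poincare_transpositions:
  fixes f :: "('i \<Rightarrow> 'a) \<Rightarrow> real"
  assumes "finite A" "finite \<Omega>"
    and "\<And>z i j. z \<in> \<Omega> \<Longrightarrow> i \<in> A \<Longrightarrow> j \<in> A \<Longrightarrow> z \<circ> tau i j \<in> \<Omega>"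
    and "\<And>z w i. z \<in> \<Omega> \<Longrightarrow> w \<in> \<Omega> \<Longrightarrow> i \<notin> A \<Longrightarrow> z i = w i"
    and "\<And>z w q. z \<in> \<Omega> \<Longrightarrow> w \<in> \<Omega> \<Longrightarrow> card {i\<in>A. z i = q} = card {i\<in>A. w i = q}"
  shows "real (card A) * (\<Sum>z\<in>\<Omega>. (f z - E_unif \<Omega> f)^2)
    \<le> (\<Sum>i\<in>A. \<Sum>j\<in>A. \<Sum>z\<in>\<Omega>. (f z - f (z \<circ> tau i j))^2)"
  using assms
proof (induction "card A" arbitrary: A \<Omega>)
  case 0
  then show ?case by simp
next
  case (Suc n)
  note finA = Suc.prems(1) and fin = Suc.prems(2) and closed = Suc.prems(3) and off = Suc.prems(4) and cnt = Suc.prems(5)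
  define D where "D = (\<Sum>i\<in>A. \<Sum>j\<in>A. \<Sum>z\<in>\<Omega>. (f z - f (z \<circ> tau i j))^2)"
  have D0: "D \<ge> 0" unfolding D_def by (simp add: sum_nonneg)
  define V where "V = (\<Sum>z\<in>\<Omega>. (f z - E_unif \<Omega> f)^2)"
  show ?case
  proof (cases "n = 0")
    case True
    then obtain r where A: "A = {r}" using Suc.hyps(2) by (metis One_nat_def card_1_singletonE)
    \<comment> \<open>On one coordinate the level counts determine the assignment, so there is no
      variance. The case stands apart because the general step divides by \<open>n\<close>.\<close>
    have "z = w" if "z \<in> \<Omega>" "w \<in> \<Omega>" for z w
    proof
      fix i
      have "card {i\<in>A. w i = z r} = card {i\<in>A. z i = z r}" by (rule cnt[OF that(2,1)])
      also have "{i\<in>A. z i = z r} = {r}" using A by auto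
      finally have "{i\<in>A. w i = z r} \<noteq> {}" by force
      then have "w r = z r" using A by auto
      then show "z i = w i" using off[OF that, of i] A by (cases "i = r") auto
    qed
    then have "\<Omega> = {} \<or> (\<exists>z. \<Omega> = {z})" by blast
    then have "V = 0" unfolding V_def by (auto simp: E_unif_def)
    then show ?thesis using D0 unfolding D_def V_def by simp
  next
    case False
    define \<Omega>' where "\<Omega>' = (\<lambda>r q. {z\<in>\<Omega>. z r = q})"
    define W where "W = (\<lambda>r. \<Sum>q\<in>(\<lambda>z. z r) ` \<Omega>. \<Sum>z\<in>\<Omega>' r q. (f z - E_unif (\<Omega>' r q) f)^2)"
    define B where "B = (\<lambda>r. \<Sum>q\<in>(\<lambda>z. z r) ` \<Omega>. real (card (\<Omega>' r q)) * (E_unif (\<Omega>' r q) f - E_unif \<Omega> f)^2)"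
    \<comment> \<open>The law of total variance, valid for every \<open>r\<close>; summing it over
      \<open>r \<in> A\<close> yields \<open>card A * V\<close>.\<close>
    have VWB: "V = W r + B r" for r
    proof -
      have "V = (\<Sum>q\<in>(\<lambda>z. z r) ` \<Omega>. \<Sum>z\<in>\<Omega>' r q. (f z - E_unif \<Omega> f)^2)"
        unfolding V_def \<Omega>'_def by (rule sum.image_gen[OF fin])
      also have "\<dots> = W r + B r" unfolding W_def B_def sum.distrib[symmetric]
        by (intro sum.cong refl sum_sq_dev_decomp) (simp add: \<Omega>'_def fin)
      finally show ?thesis .
    qed
    have Bb: "(real n + 1) * (\<Sum>r\<in>A. B r) \<le> D"
    proof -
      have "real (card A) * B r \<le> (\<Sum>j\<in>A. \<Sum>z\<in>\<Omega>. (f z - f (z \<circ> tau r j))^2)" if r: "r \<in> A" for r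
        unfolding B_def \<Omega>'_def
        by (rule between_variance_le_transpositions[OF finA fin r closed[OF _ r] cnt])
      then have "(\<Sum>r\<in>A. real (card A) * B r) \<le> D" unfolding D_def by (rule sum_mono)
      then show ?thesis using Suc.hyps(2)[symmetric] by (simp add: sum_distrib_left add.commute)
    qed
    have Wb: "real n * (\<Sum>r\<in>A. W r) \<le> (real n - 1) * D"
    proof -
      have "real n * W r \<le> (\<Sum>i\<in>A - {r}. \<Sum>j\<in>A - {r}. \<Sum>z\<in>\<Omega>. (f z - f (z \<circ> tau i j))^2)" if r: "r \<in> A" for r
      proof -
        have cn: "n = card (A - {r})" using Suc.hyps(2) r finA by simp
        have ih: "real n * (\<Sum>z\<in>\<Omega>' r q. (f z - E_unif (\<Omega>' r q) f)^2)
           \<le> (\<Sum>i\<in>A - {r}. \<Sum>j\<in>A - {r}. \<Sum>z\<in>\<Omega>' r q. (f z - f (z \<circ> tau i j))^2)" for q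
          unfolding cn
        proof (rule Suc.hyps(1)[OF cn])
          fix z w p assume zw: "z \<in> \<Omega>' r q" "w \<in> \<Omega>' r q"
          have eq: "{i\<in>A - {r}. z i = p} = {i\<in>A. z i = p} - {r}" for z :: "'i \<Rightarrow> 'a" by auto
          have "card {i\<in>A. z i = p} = card {i\<in>A. w i = p}" using zw by (intro cnt) (auto simp: \<Omega>'_def)
          moreover have "r \<in> {i\<in>A. z i = p} \<longleftrightarrow> r \<in> {i\<in>A. w i = p}" using zw by (auto simp: \<Omega>'_def)
          ultimately show "card {i\<in>A - {r}. z i = p} = card {i\<in>A - {r}. w i = p}"
            unfolding eq card_Diff_singleton_if by simp
        next
          fix z w i assume zw: "z \<in> \<Omega>' r q" "w \<in> \<Omega>' r q" "i \<notin> A - {r}"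
          then show "z i = w i" using off[of z w i] by (cases "i = r") (auto simp: \<Omega>'_def)
        qed (use finA fin closed in \<open>auto simp: \<Omega>'_def\<close>)
        have "real n * W r \<le> (\<Sum>q\<in>(\<lambda>z. z r) ` \<Omega>. \<Sum>i\<in>A - {r}. \<Sum>j\<in>A - {r}. \<Sum>z\<in>\<Omega>' r q. (f z - f (z \<circ> tau i j))^2)"
          unfolding W_def by (subst sum_distrib_left) (intro sum_mono ih)
        also have "\<dots> = (\<Sum>i\<in>A - {r}. \<Sum>q\<in>(\<lambda>z. z r) ` \<Omega>. \<Sum>j\<in>A - {r}. \<Sum>z\<in>\<Omega>' r q. (f z - f (z \<circ> tau i j))^2)"
          by (rule sum.swap)
        also have "\<dots> = (\<Sum>i\<in>A - {r}. \<Sum>j\<in>A - {r}. \<Sum>q\<in>(\<lambda>z. z r) ` \<Omega>. \<Sum>z\<in>\<Omega>' r q. (f z - f (z \<circ> tau i j))^2)"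
          by (intro sum.cong refl sum.swap)
        also have "\<dots> = (\<Sum>i\<in>A - {r}. \<Sum>j\<in>A - {r}. \<Sum>z\<in>\<Omega>. (f z - f (z \<circ> tau i j))^2)"
          unfolding \<Omega>'_def by (intro sum.cong refl sum.image_gen[symmetric] fin)
        finally show ?thesis .
      qed
      then have "(\<Sum>r\<in>A. real n * W r) \<le> (\<Sum>r\<in>A. \<Sum>i\<in>A - {r}. \<Sum>j\<in>A - {r}. \<Sum>z\<in>\<Omega>. (f z - f (z \<circ> tau i j))^2)"
        by (rule sum_mono)
      also have "\<dots> = (real (card A) - 2) * D" unfolding D_def by (rule sum_remove_diag_pairs[OF finA]) simp
      finally show ?thesis using Suc.hyps(2)[symmetric] by (simp add: sum_distrib_left)
    qed
    have n0: "real n \<ge> 1" using False by simp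
    have "(\<Sum>r\<in>A. W r) \<le> (real n - 1) * D / real n" using Wb n0 by (simp add: field_simps)
    \<comment> \<open>The available bound \<open>D / (n + 1)\<close> is relaxed to
      \<open>D / n\<close>, which together with the share \<open>(n - 1) / n\<close> of the within
      part gives exactly \<open>D\<close>.\<close>
    moreover have "(\<Sum>r\<in>A. B r) \<le> D / real n"
    proof -
      have "(\<Sum>r\<in>A. B r) \<ge> 0" unfolding B_def by (intro sum_nonneg) auto
      then have "real n * (\<Sum>r\<in>A. B r) \<le> (real n + 1) * (\<Sum>r\<in>A. B r)" by (intro mult_right_mono) auto
      then show ?thesis using Bb n0 by (simp add: field_simps)
    qed
    ultimately have "(\<Sum>r\<in>A. W r) + (\<Sum>r\<in>A. B r) \<le> (real n - 1) * D / real n + D / real n" by simp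
    also have "\<dots> = D" using n0 by (simp add: field_simps)
    finally have "(\<Sum>r\<in>A. W r + B r) \<le> D" by (simp add: sum.distrib)
    then have "real (card A) * V \<le> D" by (simp add: VWB[symmetric])
    then show ?thesis unfolding V_def D_def .
  qed
qed

section \<open>Rayleigh quotients\<close>

text \<open>The set under \<open>Max\<close> in \<open>rho\<close>, for an arbitrary matrix. Only
  coordinates in \<open>g\<close> count, so vectors are functions on the whole index type.\<close>

definition eigenvalues_on :: "'i set \<Rightarrow> ('i \<Rightarrow> 'i \<Rightarrow> real) \<Rightarrow> real set" where
  "eigenvalues_on g A = {l. \<exists>x :: 'i \<Rightarrow> real. (\<exists>q\<in>g. x q \<noteq> 0) \<and> (\<forall>q\<in>g. (\<Sum>q'\<in>g. A q q' * x q') = l * x q)}"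

text \<open>\<open>Max\<close> says nothing about an infinite set. Eigenvectors of a symmetric
  matrix for distinct eigenvalues are orthogonal, and \<open>card g\<close> coordinates leave no
  room for \<open>card g + 1\<close> orthonormal vectors.\<close>

lemma finite_eigenvalues_on:
  fixes A :: "'i \<Rightarrow> 'i \<Rightarrow> real"
  assumes fin: "finite g" and sym: "\<And>q q'. A q q' = A q' q"
  shows "finite (eigenvalues_on g A)"
proof (rule ccontr)
  assume "infinite (eigenvalues_on g A)"
  then obtain T where T: "finite T" "card T = card g + 1" "T \<subseteq> eigenvalues_on g A"
    by (meson infinite_arbitrarily_large)
  have "\<forall>l\<in>T. \<exists>x :: 'i \<Rightarrow> real. (\<exists>q\<in>g. x q \<noteq> 0) \<and> (\<forall>q\<in>g. (\<Sum>q'\<in>g. A q q' * x q') = l * x q)"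
    using T(3) unfolding eigenvalues_on_def by blast
  then obtain v where v: "\<And>l. l \<in> T \<Longrightarrow> \<exists>q\<in>g. v l q \<noteq> (0::real)"
    "\<And>l q. l \<in> T \<Longrightarrow> q \<in> g \<Longrightarrow> (\<Sum>q'\<in>g. A q q' * v l q') = l * v l q" by metis
  define n where "n = (\<lambda>l. \<Sum>q\<in>g. (v l q)^2)"
  have npos: "n l > 0" if "l \<in> T" for l
    using v(1)[OF that] fin unfolding n_def by (auto intro!: sum_pos2)
  define u where "u = (\<lambda>l q. v l q / sqrt (n l))"
  have orth: "(\<Sum>q\<in>g. u l q * u l' q) = (if l = l' then 1 else 0)" if l: "l \<in> T" "l' \<in> T" for l l'
  proof (cases "l = l'")
    case True
    have "(\<Sum>q\<in>g. u l q * u l q) = (\<Sum>q\<in>g. (v l q)^2 / n l)"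
      using npos[OF l(1)] by (intro sum.cong refl) (simp add: u_def power2_eq_square)
    also have "\<dots> = 1" using npos[OF l(1)] by (simp add: sum_divide_distrib[symmetric] n_def)
    finally show ?thesis using True by simp
  next
    case False
    have "l * (\<Sum>q\<in>g. v l q * v l' q) = (\<Sum>q\<in>g. (\<Sum>q'\<in>g. A q q' * v l q') * v l' q)"
      using v(2)[OF l(1)] by (simp add: sum_distrib_left mult_ac)
    also have "\<dots> = (\<Sum>q\<in>g. \<Sum>q'\<in>g. A q' q * v l q' * v l' q)" by (simp add: sum_distrib_right sym)
    also have "\<dots> = (\<Sum>q'\<in>g. \<Sum>q\<in>g. A q' q * v l q' * v l' q)" by (rule sum.swap)
    also have "\<dots> = (\<Sum>q'\<in>g. v l q' * (\<Sum>q\<in>g. A q' q * v l' q))" by (simp add: sum_distrib_left mult_ac)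
    also have "\<dots> = l' * (\<Sum>q\<in>g. v l q * v l' q)"
      using v(2)[OF l(2)] by (simp add: sum_distrib_left mult_ac)
    finally have "(\<Sum>q\<in>g. v l q * v l' q) = 0" using False by simp
    moreover have "(\<Sum>q\<in>g. u l q * u l' q) = (\<Sum>q\<in>g. v l q * v l' q) / (sqrt (n l) * sqrt (n l'))"
      unfolding u_def sum_divide_distrib by simp
    ultimately show ?thesis using False by simp
  qed
  \<comment> \<open>Bessel's inequality for the unit vector at \<open>q\<close>; summing over \<open>q\<close> bounds the size of the family.\<close>
  have bessel: "(\<Sum>l\<in>T. (u l q)^2) \<le> 1" if q: "q \<in> g" for q
  proof -
    define d where "d = (\<lambda>p. if p = q then 1 else 0 :: real)"
    define s where "s = (\<lambda>p. \<Sum>l\<in>T. u l q * u l p)"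
    have "(\<Sum>p\<in>g. d p * d p) = (\<Sum>p\<in>g. if p = q then 1 else 0)" by (intro sum.cong) (auto simp: d_def)
    then have dd: "(\<Sum>p\<in>g. d p * d p) = 1" using q fin by simp
    have "(\<Sum>p\<in>g. d p * s p) = (\<Sum>p\<in>g. if p = q then s p else 0)" by (intro sum.cong) (auto simp: d_def)
    then have ds: "(\<Sum>p\<in>g. d p * s p) = s q" using q fin by simp
    have "(\<Sum>p\<in>g. s p * s p) = (\<Sum>p\<in>g. \<Sum>l\<in>T. \<Sum>l'\<in>T. u l q * u l' q * (u l p * u l' p))"
      unfolding s_def by (simp add: sum_product mult_ac)
    also have "\<dots> = (\<Sum>l\<in>T. \<Sum>p\<in>g. \<Sum>l'\<in>T. u l q * u l' q * (u l p * u l' p))" by (rule sum.swap)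
    also have "\<dots> = (\<Sum>l\<in>T. \<Sum>l'\<in>T. \<Sum>p\<in>g. u l q * u l' q * (u l p * u l' p))"
      by (intro sum.cong refl sum.swap)
    also have "\<dots> = (\<Sum>l\<in>T. \<Sum>l'\<in>T. if l = l' then u l q * u l' q else 0)"
      by (intro sum.cong refl) (simp add: sum_distrib_left[symmetric] orth)
    also have "\<dots> = s q" using T(1) by (simp add: s_def)
    finally have ss: "(\<Sum>p\<in>g. s p * s p) = s q" .
    have "0 \<le> (\<Sum>p\<in>g. (d p - s p)^2)" by (intro sum_nonneg) auto
    also have "\<dots> = (\<Sum>p\<in>g. d p * d p) - 2 * (\<Sum>p\<in>g. d p * s p) + (\<Sum>p\<in>g. s p * s p)"
      by (simp add: power2_eq_square algebra_simps sum.distrib sum_subtractf sum_distrib_left)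
    also have "\<dots> = 1 - s q" using dd ds ss by simp
    finally show ?thesis by (simp add: s_def power2_eq_square)
  qed
  have "real (card T) = (\<Sum>l\<in>T. \<Sum>q\<in>g. u l q * u l q)" using orth by simp
  also have "\<dots> = (\<Sum>q\<in>g. \<Sum>l\<in>T. (u l q)^2)" by (subst sum.swap) (simp add: power2_eq_square)
  also have "\<dots> \<le> (\<Sum>q\<in>g. 1)" by (intro sum_mono bessel)
  finally show False using T(2) by simp
qed

text \<open>First-order optimality at \<open>t = 0\<close> without derivatives.\<close>

lemma linear_coeff_zero_if_quadratic_nonpos:
  fixes a b :: real
  assumes "\<And>t. a * t + b * t^2 \<le> 0"
  shows "a = 0"
proof (rule ccontr)
  assume a: "a \<noteq> 0"
  \<comment> \<open>Both \<open>c\<close> and \<open>c + b\<close> are positive, so at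
    \<open>t = a / c\<close> the value \<open>a^2 * (c + b) / c^2\<close> is positive.\<close>
  define c where "c = \<bar>b\<bar> + 1"
  have c: "c > 0" "c + b > 0" unfolding c_def by auto
  have "a * (a / c) + b * (a / c)^2 = a^2 * (c + b) / c^2"
    using c by (simp add: power2_eq_square field_simps)
  also have "\<dots> > 0" using a c by simp
  finally show False using assms[of "a / c"] by simp
qed

text \<open>A maximizer of the quadratic form on the unit sphere exists by compactness and is an
  eigenvector by first-order optimality; the maximum is its eigenvalue.\<close>

lemma rayleigh_quotient_attains_eigenvalue:
  fixes A :: "'i \<Rightarrow> 'i \<Rightarrow> real"
  assumes fin: "finite g" and ne: "g \<noteq> {}" and sym: "\<And>q q'. A q q' = A q' q"
  obtains l where "l \<in> eigenvalues_on g A"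
    "\<And>y. (\<Sum>q\<in>g. \<Sum>q'\<in>g. y q * A q q' * y q') \<le> l * (\<Sum>q\<in>g. (y q)^2)"
proof -
  define R where "R = (\<lambda>y :: 'i \<Rightarrow> real. \<Sum>q\<in>g. \<Sum>q'\<in>g. y q * A q q' * y q')"
  define n where "n = (\<lambda>y :: 'i \<Rightarrow> real. \<Sum>q\<in>g. (y q)^2)"
  \<comment> \<open>The sphere condition does not restrict coordinates outside \<open>g\<close>.
    Pinning them to 0 makes the box compact as a product of compact sets.\<close>
  define B where "B = (\<lambda>i. if i \<in> g then {-1..1::real} else {0})"
  define K where "K = PiE UNIV B \<inter> {x. n x = 1}"
  have cB: "compact (PiE UNIV B)"
  proof -
    have "compactin (product_topology (\<lambda>_. euclidean) UNIV) (PiE UNIV B)"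
      unfolding compactin_PiE by (auto simp: B_def)
    then show ?thesis by (simp add: euclidean_product_topology)
  qed
  have contn: "continuous_on UNIV n" unfolding n_def
    by (intro continuous_intros continuous_on_product_coordinates)
  have contR: "continuous_on UNIV R" unfolding R_def
    by (intro continuous_intros continuous_on_product_coordinates)
  have "closed {x. n x = 1}" using contn by (intro closed_Collect_eq) auto
  then have cK: "compact K" unfolding K_def using cB by (intro compact_Int_closed)
  obtain q0 where q0: "q0 \<in> g" using ne by auto
  define e where "e = (\<lambda>q p :: 'i. if p = q then 1 else 0 :: real)"
  have ne1: "n (e q) = 1" if "q \<in> g" for q
  proof -
    have "n (e q) = (\<Sum>p\<in>g. if p = q then 1 else 0)" unfolding n_def by (intro sum.cong) (auto simp: e_def)
    then show ?thesis using that fin by simp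
  qed
  have "e q0 \<in> K" unfolding K_def using ne1[OF q0] q0 by (auto simp: B_def e_def PiE_UNIV_domain)
  then have "K \<noteq> {}" by auto
  then obtain x where x: "x \<in> K" "\<And>y. y \<in> K \<Longrightarrow> R y \<le> R x"
    using continuous_attains_sup[OF cK, of R] contR continuous_on_subset by blast
  have nx: "n x = 1" using x(1) by (simp add: K_def)
  have bound: "R y \<le> R x * n y" for y
  proof (cases "n y = 0")
    case True
    then have "\<forall>q\<in>g. (y q)^2 = 0" unfolding n_def using fin by (subst (asm) sum_nonneg_eq_0_iff) auto
    then have "R y = 0" unfolding R_def by (intro sum.neutral ballI) auto
    then show ?thesis using True by simp
  next
    case False
    then have npos: "n y > 0" unfolding n_def by (simp add: sum_nonneg order_less_le)
    define w where "w = (\<lambda>q. if q \<in> g then y q / sqrt (n y) else 0)"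
    have "n w = (\<Sum>q\<in>g. (w q)^2)" unfolding n_def ..
    also have "\<dots> = (\<Sum>q\<in>g. (y q)^2 / n y)" using npos
      by (intro sum.cong) (auto simp: w_def power_divide)
    also have "\<dots> = n y / n y" by (simp add: sum_divide_distrib[symmetric] n_def)
    finally have nw: "n w = 1" using npos by simp
    have wout: "w q = 0" if "q \<notin> g" for q using that by (simp add: w_def)
    have "\<bar>w q\<bar> \<le> 1" if "q \<in> g" for q
    proof -
      have "(w q)^2 \<le> n w" unfolding n_def using that fin by (intro member_le_sum) auto
      then show ?thesis using nw by (simp add: abs_square_le_1)
    qed
    then have "w q \<in> B q" for q by (cases "q \<in> g") (auto simp: B_def abs_le_iff minus_le_iff wout)
    then have "w \<in> K" unfolding K_def using nw by (auto simp: PiE_UNIV_domain)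
    then have le: "R w \<le> R x" by (rule x(2))
    have "R w = (\<Sum>q\<in>g. \<Sum>q'\<in>g. y q * A q q' * y q' / n y)" unfolding R_def using npos
      by (intro sum.cong refl) (simp add: w_def)
    also have "\<dots> = R y / n y" by (simp add: R_def sum_divide_distrib)
    finally have "R y = R w * n y" using npos by simp
    then show ?thesis using le npos by simp
  qed
  have eig: "(\<Sum>q'\<in>g. A q q' * x q') = R x * x q" if q: "q \<in> g" for q
  proof -
    have se: "(\<Sum>p\<in>g. e q p * f p) = f q" for f :: "'i \<Rightarrow> real"
    proof -
      have "(\<Sum>p\<in>g. e q p * f p) = (\<Sum>p\<in>g. if p = q then f p else 0)"
        by (intro sum.cong) (auto simp: e_def)
      then show ?thesis using q fin by simp
    qed
    \<comment> \<open>Along \<open>x + t * e q\<close> the bound \<open>R y \<le> R x * n y\<close>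
      becomes \<open>a * t + b * t^2 \<le> 0\<close>, the constant term cancelling because
      \<open>n x = 1\<close>. Then \<open>a = 0\<close> is the eigenvalue equation in coordinate
      \<open>q\<close>.\<close>
    define a where "a = 2 * (\<Sum>q'\<in>g. A q q' * x q') - R x * (2 * x q)"
    define b where "b = R (e q) - R x"
    have "a * t + b * t^2 \<le> 0" for t
    proof -
      have "R (\<lambda>p. x p + t * e q p) = (\<Sum>p\<in>g. \<Sum>p'\<in>g. x p * A p p' * x p' + t * (x p * A p p' * e q p')
            + t * (e q p * A p p' * x p') + t^2 * (e q p * A p p' * e q p'))"
        unfolding R_def by (intro sum.cong refl) (simp add: power2_eq_square algebra_simps)
      also have "\<dots> = R x + t * (\<Sum>p\<in>g. \<Sum>p'\<in>g. x p * A p p' * e q p')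
            + t * (\<Sum>p\<in>g. \<Sum>p'\<in>g. e q p * A p p' * x p') + t^2 * R (e q)"
        by (simp add: sum.distrib sum_distrib_left R_def)
      also have "(\<Sum>p\<in>g. \<Sum>p'\<in>g. x p * A p p' * e q p') = (\<Sum>p\<in>g. \<Sum>p'\<in>g. e q p' * (A p' p * x p))"
        by (intro sum.cong refl) (metis sym mult.commute mult.left_commute)
      also have "\<dots> = (\<Sum>p\<in>g. A q p * x p)" by (simp add: se)
      also have "(\<Sum>p\<in>g. \<Sum>p'\<in>g. e q p * A p p' * x p') = (\<Sum>p\<in>g. e q p * (\<Sum>p'\<in>g. A p p' * x p'))"
        by (simp add: sum_distrib_left mult.assoc)
      also have "\<dots> = (\<Sum>p\<in>g. A q p * x p)" by (rule se)
      finally have R1: "R (\<lambda>p. x p + t * e q p) = R x + 2 * t * (\<Sum>p\<in>g. A q p * x p) + t^2 * R (e q)" by simp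
      have "n (\<lambda>p. x p + t * e q p) = (\<Sum>p\<in>g. (x p)^2 + (2 * t) * (e q p * x p) + t^2 * (e q p)^2)"
        unfolding n_def by (intro sum.cong refl) (simp add: power2_eq_square algebra_simps)
      also have "\<dots> = n x + (2 * t) * (\<Sum>p\<in>g. e q p * x p) + t^2 * n (e q)"
        by (simp add: sum.distrib sum_distrib_left n_def)
      finally have n1: "n (\<lambda>p. x p + t * e q p) = 1 + 2 * t * x q + t^2"
        using nx ne1[OF q] by (simp add: se)
      show ?thesis using bound[of "\<lambda>p. x p + t * e q p"] unfolding R1 n1 a_def b_def
        by (simp add: algebra_simps)
    qed
    then have "a = 0" by (rule linear_coeff_zero_if_quadratic_nonpos)
    then show ?thesis unfolding a_def by simp
  qed
  have "\<exists>q\<in>g. x q \<noteq> 0"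
  proof (rule ccontr)
    assume "\<not> (\<exists>q\<in>g. x q \<noteq> 0)"
    then have "n x = 0" unfolding n_def by (intro sum.neutral) auto
    then show False using nx by simp
  qed
  then have "R x \<in> eigenvalues_on g A" unfolding eigenvalues_on_def using eig by auto
  then show ?thesis 
  proof (rule that)
    show "(\<Sum>q\<in>g. \<Sum>q'\<in>g. y q * A q q' * y q') \<le> R x * (\<Sum>q\<in>g. (y q)^2)" for y
      using bound[of y] by (simp add: R_def n_def)
  qed
qed

lemma rayleigh_le_Max_eigenvalues_on:
  fixes A :: "'i \<Rightarrow> 'i \<Rightarrow> real"
  assumes "finite g" "g \<noteq> {}" "\<And>q q'. A q q' = A q' q"
  shows "(\<Sum>q\<in>g. \<Sum>q'\<in>g. y q * A q q' * y q') \<le> Max (eigenvalues_on g A) * (\<Sum>q\<in>g. (y q)^2)"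
proof -
  obtain l where l: "l \<in> eigenvalues_on g A"
    "(\<Sum>q\<in>g. \<Sum>q'\<in>g. y q * A q q' * y q') \<le> l * (\<Sum>q\<in>g. (y q)^2)"
    by (rule rayleigh_quotient_attains_eigenvalue[of g A, OF assms]) blast
  have "l \<le> Max (eigenvalues_on g A)" using l(1) finite_eigenvalues_on[of g A] assms by (intro Max_ge) auto
  then have "l * (\<Sum>q\<in>g. (y q)^2) \<le> Max (eigenvalues_on g A) * (\<Sum>q\<in>g. (y q)^2)"
    by (intro mult_right_mono sum_nonneg) auto
  then show ?thesis using l(2) by linarith
qed

lemma quad_form_Scor_le_rho:
  assumes "finite g" "g \<noteq> {}"
  shows "(\<Sum>q\<in>g. \<Sum>q'\<in>g. y q * Scor N Y q q' * y q') \<le> rho N Y g * (\<Sum>q\<in>g. (y q)^2)"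
proof -
  have "rho N Y g = Max (eigenvalues_on g (Scor N Y))" unfolding rho_def eigenvalues_on_def ..
  moreover have "Scor N Y q q' = Scor N Y q' q" for q q'
    by (simp add: Scor_def Scov_def mult.commute)
  ultimately show ?thesis using rayleigh_le_Max_eigenvalues_on[OF assms] by simp
qed

section \<open>Moments under complete randomization\<close>

text \<open>Guarantees a nonempty sample space; over an empty one \<open>E_unif\<close> is 0 and
  would not preserve constants. The induction sets aside the units of the last level.\<close>

lemma ex_assignment_with_counts:
  fixes Q :: nat
  assumes "finite U" "card U = (\<Sum>q<Q. n q)"
  shows "\<exists>z \<in> U \<rightarrow>\<^sub>E {..<Q}. \<forall>q<Q. card {i\<in>U. z i = q} = n q"
  using assms
proof (induction Q arbitrary: U)
  case 0
  then show ?case by (intro bexI[of _ "\<lambda>_. undefined"]) auto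
next
  case (Suc Q)
  have "n Q \<le> card U" using Suc.prems by simp
  then obtain V where V: "V \<subseteq> U" "card V = n Q" "finite V" by (rule obtain_subset_with_card_n)
  have "card (U - V) = (\<Sum>q<Q. n q)" using V Suc.prems by (simp add: card_Diff_subset)
  then obtain w where w: "w \<in> (U - V) \<rightarrow>\<^sub>E {..<Q}" "\<And>q. q < Q \<Longrightarrow> card {i\<in>U - V. w i = q} = n q"
    using Suc.IH[of "U - V"] Suc.prems by auto
  define z where "z = (\<lambda>i. if i \<in> V then Q else w i)"
  have wlt: "w i < Q" if "i \<in> U - V" for i using w(1) that by (auto simp: PiE_iff)
  have "z \<in> U \<rightarrow>\<^sub>E {..<Suc Q}"
    using w(1) V(1) by (auto simp: z_def PiE_iff extensional_def less_Suc_eq)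
  moreover have "card {i\<in>U. z i = q} = n q" if q: "q < Suc Q" for q
  proof (cases "q = Q")
    case True
    have "{i\<in>U. z i = q} = V" using V(1) True wlt by (auto simp: z_def dest: less_not_refl2)
    then show ?thesis using V True by simp
  next
    case False
    then have "{i\<in>U. z i = q} = {i\<in>U - V. w i = q}" by (auto simp: z_def)
    then show ?thesis using w(2)[of q] False q by simp
  qed
  ultimately show ?case by blast
qed

section \<open>Exchangeability of units and the assignment probabilities\<close>

locale complete_randomization =
  fixes N Q :: nat and Nq :: "nat \<Rightarrow> nat" and Y :: "nat \<Rightarrow> nat \<Rightarrow> real"
  assumes Nq_pos: "\<And>q. q < Q \<Longrightarrow> Nq q \<ge> 1"
    and Nq_sum: "(\<Sum>q<Q. Nq q) = N"
begin

abbreviation \<Omega> where "\<Omega> \<equiv> assignments N Q Nq"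
abbreviation EE where "EE \<equiv> E_unif \<Omega>"

lemma finite_Omega: "finite \<Omega>"
proof (rule finite_subset)
  show "\<Omega> \<subseteq> {..<N} \<rightarrow>\<^sub>E {..<Q}" by (auto simp: assignments_def)
qed (simp add: finite_PiE)

lemma Omega_nonempty: "\<Omega> \<noteq> {}"
proof -
  obtain z where "z \<in> {..<N} \<rightarrow>\<^sub>E {..<Q}" "\<forall>q<Q. card {i\<in>{..<N}. z i = q} = Nq q"
    using ex_assignment_with_counts[of "{..<N}" Nq Q] Nq_sum by auto
  then have "z \<in> \<Omega>" by (simp add: assignments_def)
  then show ?thesis by auto
qed

lemma EE_const: "EE (\<lambda>_. c) = c"
  by (rule E_unif_const[OF finite_Omega Omega_nonempty])

lemma level_less: "z \<in> \<Omega> \<Longrightarrow> i < N \<Longrightarrow> z i < Q"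
  by (auto simp: assignments_def PiE_iff)

lemma count_level:
  assumes "z \<in> \<Omega>" "q < Q"
  shows "(\<Sum>i<N. of_bool (z i = q) :: real) = real (Nq q)"
proof -
  have "(\<Sum>i<N. of_bool (z i = q) :: real) = real (card ({..<N} \<inter> {i. z i = q}))"
    by simp
  also have "{..<N} \<inter> {i. z i = q} = {i. i < N \<and> z i = q}" by auto
  finally show ?thesis using assms by (simp add: assignments_def)
qed

lemma swap_in_Omega:
  assumes z: "z \<in> \<Omega>" and i: "i < N" and j: "j < N"
  shows "z \<circ> tau i j \<in> \<Omega>"
proof -
  have t: "tau i j k < N \<longleftrightarrow> k < N" for k using i j by (auto simp: Transposition.transpose_def)
  have out: "tau i j k = k" if "\<not> k < N" for k using i j that by (auto simp: Transposition.transpose_def)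
  have "z \<circ> tau i j \<in> {..<N} \<rightarrow>\<^sub>E {..<Q}"
    using z t out by (auto simp: assignments_def PiE_iff extensional_def)
  moreover have "card {k. k < N \<and> (z \<circ> tau i j) k = q} = Nq q" if q: "q < Q" for q
  proof -
    have "{k. k < N \<and> (z \<circ> tau i j) k = q} = tau i j ` {k. k < N \<and> z k = q}"
    proof (intro equalityI subsetI)
      fix k assume "k \<in> {k. k < N \<and> (z \<circ> tau i j) k = q}"
      then show "k \<in> tau i j ` {k. k < N \<and> z k = q}"
        by (intro image_eqI[of _ _ "tau i j k"]) (auto simp: t)
    qed (auto simp: t)
    then show ?thesis using z q by (simp add: card_image assignments_def)
  qed
  ultimately show ?thesis by (simp add: assignments_def)
qed

text \<open>Exchangeability: a swap permutes the finite sample space.\<close>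

lemma EE_swap:
  assumes "i < N" "j < N"
  shows "EE (\<lambda>z. f (z \<circ> tau i j)) = EE f"
proof -
  have "bij_betw (\<lambda>z. z \<circ> tau i j) {z \<in> \<Omega>. True} {z \<in> \<Omega>. True}"
    using swap_in_Omega assms by (intro bij_betw_comp_transpose)
  from sum.reindex_bij_betw[OF this, of f] show ?thesis by (simp add: E_unif_def)
qed

lemma variance_le_transpositions:
  "real N * EE (\<lambda>z. (f z - EE f)^2) \<le> (\<Sum>i<N. \<Sum>j<N. EE (\<lambda>z. (f z - f (z \<circ> tau i j))^2))"
proof -
  have "real (card {..<N}) * (\<Sum>z\<in>\<Omega>. (f z - EE f)^2)
      \<le> (\<Sum>i<N. \<Sum>j<N. \<Sum>z\<in>\<Omega>. (f z - f (z \<circ> tau i j))^2)"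
  proof (rule poincare_transpositions)
    fix z w q assume zw: "z \<in> \<Omega>" "w \<in> \<Omega>"
    show "card {i\<in>{..<N}. z i = q} = card {i\<in>{..<N}. w i = q}"
    proof (cases "q < Q")
      case True
      then show ?thesis using zw by (simp add: assignments_def)
    next
      case False
      then have "{i\<in>{..<N}. z i = q} = {}" "{i\<in>{..<N}. w i = q} = {}" using zw level_less by fastforce+
      then show ?thesis by metis
    qed
  next
    fix z w i assume "z \<in> \<Omega>" "w \<in> \<Omega>" "i \<notin> {..<N}"
    then show "z i = w i" by (simp add: assignments_def PiE_iff extensional_def)
  qed (simp_all add: finite_Omega swap_in_Omega)
  then have "(real N * (\<Sum>z\<in>\<Omega>. (f z - EE f)^2)) / real (card \<Omega>)
      \<le> (\<Sum>i<N. \<Sum>j<N. \<Sum>z\<in>\<Omega>. (f z - f (z \<circ> tau i j))^2) / real (card \<Omega>)"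
    by (intro divide_right_mono) auto
  moreover define m where "m = EE f"
  ultimately have "real N * (\<Sum>z\<in>\<Omega>. (f z - m)^2) / real (card \<Omega>)
      \<le> (\<Sum>i<N. \<Sum>j<N. \<Sum>z\<in>\<Omega>. (f z - f (z \<circ> tau i j))^2) / real (card \<Omega>)" by simp
  then have "real N * EE (\<lambda>z. (f z - m)^2) \<le> (\<Sum>i<N. \<Sum>j<N. EE (\<lambda>z. (f z - f (z \<circ> tau i j))^2))"
    by (simp add: sum_divide_distrib[symmetric] E_unif_def)
  then show ?thesis unfolding m_def .
qed

text \<open>By exchangeability all \<open>N\<close> units have the same probability, and these add
  up to the deterministic count \<open>Nq q\<close>.\<close>

lemma EE_level:
  assumes i: "i < N" and q: "q < Q"
  shows "EE (\<lambda>z. of_bool (z i = q)) = real (Nq q) / real N"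
proof -
  have "EE (\<lambda>z. of_bool (z j = q)) = EE (\<lambda>z. of_bool (z i = q))" if "j < N" for j
    using EE_swap[OF i that, of "\<lambda>z. of_bool (z i = q)"] by simp
  then have "real N * EE (\<lambda>z. of_bool (z i = q)) = (\<Sum>j<N. EE (\<lambda>z. of_bool (z j = q)))" by simp
  also have "\<dots> = EE (\<lambda>z. \<Sum>j<N. of_bool (z j = q))" by (simp only: E_unif_sum)
  also have "\<dots> = EE (\<lambda>_. real (Nq q))" by (intro E_unif_cong count_level q)
  finally show ?thesis using i by (simp add: EE_const field_simps)
qed

text \<open>The same argument with unit \<open>i\<close> fixed: the \<open>N - 1\<close> joint
  probabilities are equal, and given \<open>z i = q\<close> there remain
  \<open>Nq q' - of_bool (q = q')\<close> units at \<open>q'\<close>.\<close>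

lemma EE_level2:
  assumes i: "i < N" and j: "j < N" and ij: "i \<noteq> j" and q: "q < Q" and q': "q' < Q"
  shows "EE (\<lambda>z. of_bool (z i = q) * of_bool (z j = q'))
     = real (Nq q) / real N * ((real (Nq q') - of_bool (q = q')) / (real N - 1))"
proof -
  define a where "a = EE (\<lambda>z. of_bool (z i = q) * of_bool (z j = q'))"
  have "EE (\<lambda>z. of_bool (z i = q) * of_bool (z k = q')) = a" if "k \<in> {..<N} - {i}" for k
    using EE_swap[of j k "\<lambda>z. of_bool (z i = q) * of_bool (z j = q')"] that j ij unfolding a_def by simp
  then have "(real N - 1) * a = (\<Sum>k\<in>{..<N} - {i}. EE (\<lambda>z. of_bool (z i = q) * of_bool (z k = q')))"
    using i by (simp add: of_nat_diff)
  also have "\<dots> = EE (\<lambda>z. \<Sum>k\<in>{..<N} - {i}. of_bool (z i = q) * of_bool (z k = q'))" by (simp only: E_unif_sum)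
  also have "\<dots> = EE (\<lambda>z. of_bool (z i = q) * (real (Nq q') - of_bool (q = q')))"
  proof (rule E_unif_cong)
    fix z assume z: "z \<in> \<Omega>"
    have "(\<Sum>k\<in>{..<N} - {i}. of_bool (z i = q) * of_bool (z k = q') :: real)
        = of_bool (z i = q) * ((\<Sum>k<N. of_bool (z k = q')) - of_bool (z i = q'))"
      unfolding sum_distrib_left[symmetric] by (subst sum_diff1) (use i in simp_all)
    also have "\<dots> = of_bool (z i = q) * (real (Nq q') - of_bool (q = q'))"
      unfolding count_level[OF z q'] by auto
    finally show "(\<Sum>k\<in>{..<N} - {i}. of_bool (z i = q) * of_bool (z k = q') :: real)
        = of_bool (z i = q) * (real (Nq q') - of_bool (q = q'))" .
  qed
  also have "\<dots> = real (Nq q) / real N * (real (Nq q') - of_bool (q = q'))"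
    by (simp only: E_unif_cmult_right EE_level[OF i q])
  finally have "(real N - 1) * a = real (Nq q) / real N * (real (Nq q') - of_bool (q = q'))" .
  moreover have "real N - 1 \<noteq> 0" using i j ij by auto
  ultimately have "a = real (Nq q) / real N * (real (Nq q') - of_bool (q = q')) / (real N - 1)"
    by (metis nonzero_mult_div_cancel_left)
  then show ?thesis unfolding a_def[symmetric] by simp
qed

section \<open>Centred level sums and their moments\<close>

definition yc :: "nat \<Rightarrow> nat \<Rightarrow> real" where "yc i q = Y i q - Ybar N Y q"

text \<open>Not divided by \<open>Nq q\<close>, so that a swap changes it by a plain difference of
  outcomes. \<open>Yhat\<close> is affine in \<open>M\<close>, and \<open>Shat\<close> is a
  combination of \<open>T 2\<close> and \<open>M^2\<close>; \<open>T 4\<close> serves as a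
  majorant.\<close>

definition M :: "(nat \<Rightarrow> nat) \<Rightarrow> nat \<Rightarrow> real" where "M z q = (\<Sum>i<N. of_bool (z i = q) * yc i q)"

definition T :: "nat \<Rightarrow> (nat \<Rightarrow> nat) \<Rightarrow> nat \<Rightarrow> real" where "T k z q = (\<Sum>i<N. of_bool (z i = q) * yc i q ^ k)"

lemma sum_yc: "(\<Sum>i<N. yc i q) = 0"
  by (cases "N = 0") (simp_all add: yc_def sum_subtractf Ybar_def)

lemma sum_yc_mult: "N \<ge> 2 \<Longrightarrow> (\<Sum>i<N. yc i q * yc i q') = (real N - 1) * Scov N Y q q'"
  by (simp add: Scov_def yc_def)

lemma EE_M: "q < Q \<Longrightarrow> EE (\<lambda>z. M z q) = 0"
  unfolding M_def E_unif_sum E_unif_cmult_right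
  by (simp add: EE_level sum_distrib_left[symmetric] sum_divide_distrib[symmetric] sum_yc)

lemma EE_T:
  assumes "q < Q"
  shows "EE (\<lambda>z. T k z q) = real (Nq q) / real N * (\<Sum>i<N. yc i q ^ k)"
proof -
  have "EE (\<lambda>z. T k z q) = (\<Sum>i<N. EE (\<lambda>z. of_bool (z i = q)) * yc i q ^ k)"
    unfolding T_def E_unif_sum E_unif_cmult_right ..
  also have "\<dots> = (\<Sum>i<N. real (Nq q) / real N * yc i q ^ k)"
    by (intro sum.cong refl) (simp add: EE_level assms)
  finally show ?thesis by (simp add: sum_distrib_left)
qed

text \<open>Joint probabilities are constant off the diagonal, and the deviations sum to zero. Only
  the excess of the diagonal over that constant survives.\<close>

lemma EE_M_mult:
  assumes N: "N \<ge> 2" and q: "q < Q" and q': "q' < Q"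
  shows "EE (\<lambda>z. M z q * M z q') = real (Nq q) * real (Nq q') * VY N Nq Y q q'"
proof -
  define S where "S = Scov N Y q q'"
  \<comment> \<open>\<open>b\<close> is the joint probability for two distinct units and
    \<open>c\<close> the one for a unit paired with itself; \<open>c - b\<close> is the
    excess.\<close>
  define b where "b = real (Nq q) / real N * ((real (Nq q') - of_bool (q = q')) / (real N - 1))"
  define c where "c = of_bool (q = q') * (real (Nq q) / real N)"
  have "EE (\<lambda>z. M z q * M z q')
     = (\<Sum>i<N. \<Sum>j<N. EE (\<lambda>z. of_bool (z i = q) * of_bool (z j = q')) * (yc i q * yc j q'))"
  proof -
    have "EE (\<lambda>z. M z q * M z q')
      = EE (\<lambda>z. \<Sum>i<N. \<Sum>j<N. (of_bool (z i = q) * of_bool (z j = q')) * (yc i q * yc j q'))"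
      unfolding M_def sum_product by (simp add: mult_ac)
    then show ?thesis by (simp only: E_unif_sum E_unif_cmult_right)
  qed
  also have "\<dots> = (\<Sum>i<N. \<Sum>j<N. b * (yc i q * yc j q') + (if i = j then (c - b) * (yc i q * yc j q') else 0))"
  proof (intro sum.cong refl)
    fix i j assume "i \<in> {..<N}" "j \<in> {..<N}"
    then have i: "i < N" and j: "j < N" by auto
    show "EE (\<lambda>z. of_bool (z i = q) * of_bool (z j = q')) * (yc i q * yc j q')
        = b * (yc i q * yc j q') + (if i = j then (c - b) * (yc i q * yc j q') else 0)"
    proof (cases "i = j")
      case True
      have "EE (\<lambda>z. of_bool (z i = q) * of_bool (z j = q')) = EE (\<lambda>z. of_bool (q = q') * of_bool (z i = q))"
        using True by (intro E_unif_cong) auto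
      also have "\<dots> = c" by (simp only: E_unif_cmult EE_level[OF i q] c_def)
      finally show ?thesis using True by (simp add: algebra_simps)
    next
      case False
      then show ?thesis unfolding b_def by (simp only: EE_level2[OF i j False q q'] if_False add_0_right)
    qed
  qed
  also have "\<dots> = (\<Sum>i<N. b * yc i q * (\<Sum>j<N. yc j q')) + (c - b) * (\<Sum>i<N. yc i q * yc i q')"
    by (simp add: sum.distrib sum_distrib_left mult.assoc)
  also have "\<dots> = (c - b) * ((real N - 1) * S)" by (simp add: sum_yc sum_yc_mult[OF N] S_def)
  also have "\<dots> = (c * (real N - 1) - b * (real N - 1)) * S" by (simp add: algebra_simps)
  also have "b * (real N - 1) = real (Nq q) / real N * (real (Nq q') - of_bool (q = q'))"
    unfolding b_def using N by simp
  also have "(c * (real N - 1) - real (Nq q) / real N * (real (Nq q') - of_bool (q = q'))) * S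
     = real (Nq q) * real (Nq q') * VY N Nq Y q q'"
    using N Nq_pos[OF q] unfolding VY_def c_def S_def
    by (cases "q = q'") (auto simp: field_simps)
  finally show ?thesis .
qed

lemma sum_over_level: "(\<Sum>i\<in>{i. i < N \<and> z i = q}. f i) = (\<Sum>i<N. of_bool (z i = q) * (f i :: real))"
proof -
  have "(\<Sum>i<N. of_bool (z i = q) * (f i :: real)) = (\<Sum>i<N. if z i = q then f i else 0)"
    by (intro sum.cong) auto
  also have "\<dots> = (\<Sum>i\<in>{i\<in>{..<N}. z i = q}. f i)" by (rule sum.inter_filter[symmetric]) simp
  finally show ?thesis by simp
qed

lemma Yhat_eq:
  assumes z: "z \<in> \<Omega>" and q: "q < Q"
  shows "Yhat N Nq Y z q = Ybar N Y q + M z q / real (Nq q)"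
proof -
  have "(\<Sum>i\<in>{i. i < N \<and> z i = q}. Y i q) = (\<Sum>i<N. of_bool (z i = q) * yc i q + of_bool (z i = q) * Ybar N Y q)"
    unfolding sum_over_level by (simp add: yc_def algebra_simps)
  also have "\<dots> = M z q + real (Nq q) * Ybar N Y q"
    by (simp only: sum.distrib sum_distrib_right[symmetric] count_level[OF z q] M_def)
  finally show ?thesis using Nq_pos[OF q] by (simp add: Yhat_def field_simps)
qed

lemma Shat_eq:
  assumes z: "z \<in> \<Omega>" and q: "q < Q"
  shows "Shat N Nq Y z q = (T 2 z q - (M z q)^2 / real (Nq q)) / (real (Nq q) - 1)"
proof -
  define n where "n = real (Nq q)"
  have n: "n > 0" using Nq_pos[OF q] by (simp add: n_def)
  have "(\<Sum>i\<in>{i. i < N \<and> z i = q}. (Y i q - Yhat N Nq Y z q)^2)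
     = (\<Sum>i<N. of_bool (z i = q) * yc i q ^ 2 - (2 * M z q / n) * (of_bool (z i = q) * yc i q) + of_bool (z i = q) * (M z q / n)^2)"
    unfolding sum_over_level Yhat_eq[OF z q]
    by (intro sum.cong refl) (simp add: yc_def n_def power2_eq_square algebra_simps)
  also have "\<dots> = T 2 z q - (2 * M z q / n) * M z q + n * (M z q / n)^2"
    unfolding sum.distrib sum_subtractf sum_distrib_left[symmetric] sum_distrib_right[symmetric] count_level[OF z q]
    by (simp add: T_def M_def n_def)
  also have "\<dots> = T 2 z q - (M z q)^2 / n" using n by (simp add: field_simps power2_eq_square)
  finally show ?thesis by (simp add: Shat_def n_def)
qed

lemma EE_Shat:
  assumes N: "N \<ge> 2" and q: "q < Q" and n2: "Nq q \<ge> 2"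
  shows "EE (\<lambda>z. Shat N Nq Y z q) = Scov N Y q q"
proof -
  define n where "n = real (Nq q)"
  define S where "S = Scov N Y q q"
  have n: "n \<ge> 2" using n2 by (simp add: n_def)
  have "EE (\<lambda>z. Shat N Nq Y z q) = EE (\<lambda>z. (T 2 z q - M z q * M z q / n) / (n - 1))"
    by (intro E_unif_cong) (simp add: Shat_eq q n_def power2_eq_square)
  also have "\<dots> = (n / real N * (\<Sum>i<N. yc i q ^ 2) - n * n * VY N Nq Y q q / n) / (n - 1)"
    by (simp only: E_unif_divide E_unif_diff EE_M_mult[OF N q q] EE_T[OF q] n_def)
  also have "(\<Sum>i<N. yc i q ^ 2) = (real N - 1) * S" using sum_yc_mult[OF N, of q q] by (simp add: S_def power2_eq_square)
  also have "VY N Nq Y q q = S / n - S / real N" by (simp add: VY_def S_def n_def)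
  \<comment> \<open>The numerator is \<open>n * S - n * S / N - S + n * S / N = (n - 1) * S\<close>:
    the finite-population corrections cancel.\<close>
  also have "(n / real N * ((real N - 1) * S) - n * n * (S / n - S / real N) / n) / (n - 1) = S"
    using n N by (simp add: field_simps)
  finally show ?thesis unfolding S_def .
qed

text \<open>Writing the form as a sum of squares over units shows positive semidefiniteness for
  \<open>N \<ge> 2\<close> and allows inequalities to be applied unit by unit.\<close>

lemma Scov_quad_form:
  "(\<Sum>q\<in>A. \<Sum>q'\<in>A. a q * a q' * Scov N Y q q') = (\<Sum>i<N. (\<Sum>q\<in>A. a q * yc i q)^2) / (real N - 1)"
proof -
  have "(\<Sum>q\<in>A. \<Sum>q'\<in>A. a q * a q' * Scov N Y q q')
      = (\<Sum>q\<in>A. \<Sum>q'\<in>A. \<Sum>i<N. (a q * yc i q) * (a q' * yc i q')) / (real N - 1)"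
    by (simp add: Scov_def yc_def sum_divide_distrib sum_distrib_left mult_ac)
  also have "(\<Sum>q\<in>A. \<Sum>q'\<in>A. \<Sum>i<N. (a q * yc i q) * (a q' * yc i q'))
      = (\<Sum>q\<in>A. \<Sum>i<N. \<Sum>q'\<in>A. (a q * yc i q) * (a q' * yc i q'))"
    by (intro sum.cong refl sum.swap)
  also have "\<dots> = (\<Sum>i<N. \<Sum>q\<in>A. \<Sum>q'\<in>A. (a q * yc i q) * (a q' * yc i q'))" by (rule sum.swap)
  also have "\<dots> = (\<Sum>i<N. (\<Sum>q\<in>A. a q * yc i q)^2)" by (simp add: power2_eq_square sum_product)
  finally show ?thesis .
qed

end

section \<open>Conservativeness\<close>

context complete_randomization
begin

text \<open>For \<open>N = 1\<close> the divisor in \<open>Scov\<close> is zero, hence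
  \<open>Scov\<close> is 0 by the convention for division.\<close>

lemma N_ge_2:
  assumes "q < Q" "Scov N Y q q > 0"
  shows "N \<ge> 2"
proof (rule ccontr)
  assume "\<not> N \<ge> 2"
  moreover have "N > 0" using assms(1) Nq_pos[OF assms(1)] Nq_sum
    by (metis lessThan_iff member_le_sum finite_lessThan le0 less_le_trans zero_less_one)
  ultimately have "N = 1" by simp
  then show False using assms(2) by (simp add: Scov_def)
qed

text \<open>For \<open>N = 2\<close> the factor \<open>mu\<close> is the junk value 0. This case is excluded by Condition 5, because
  all correlations are then \<open>1\<close> or \<open>-1\<close>.\<close>

lemma N_ge_3:
  assumes g: "g \<subseteq> {..<Q}" "card g \<ge> 2"
    and S: "\<And>q. q \<in> g \<Longrightarrow> Scov N Y q q > 0"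
    and c5: "real N - rho N Y g - (real (card g) - 1) \<ge> 0"
  shows "N \<ge> 3"
proof (rule ccontr)
  assume n3: "\<not> N \<ge> 3"
  have fin: "finite g" using g(1) finite_subset by blast
  obtain p q where pq: "p \<in> g" "q \<in> g" "p \<noteq> q"
    using g(2) fin by (metis One_nat_def card_le_Suc0_iff_eq not_less_eq_eq numeral_2_eq_2)
  have "N \<ge> 2" using N_ge_2[of p] g(1) S[OF pq(1)] pq(1) by auto
  then have N2: "N = 2" using n3 by simp
  have rho1: "rho N Y g \<le> 1" using c5 N2 g(2) by simp
  have cor1: "Scor N Y r r = 1" if "r \<in> g" for r using S[OF that] by (simp add: Scor_def)
  \<comment> \<open>Rayleigh bound for the test vector with entries 1 at \<open>p\<close> and
    \<open>s\<close> at \<open>q\<close>. The signs \<open>s = 1\<close> and \<open>s = -1\<close>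
    together force zero correlation.\<close>
  have "2 + 2 * s * Scor N Y p q \<le> 2" if s: "s^2 = 1" for s
  proof -
    define y where "y = (\<lambda>r. if r = p then 1 else if r = q then s else 0)"
    have out: "y r = 0" if "r \<in> g - {p,q}" for r using that by (auto simp: y_def)
    have sub: "{p,q} \<subseteq> g" using pq by auto
    have red: "(\<Sum>r\<in>g. f r) = f p + f q" if "\<And>r. r \<in> g - {p,q} \<Longrightarrow> f r = 0" for f :: "nat \<Rightarrow> real"
    proof -
      have "(\<Sum>r\<in>g. f r) = (\<Sum>r\<in>{p,q}. f r)" using that by (intro sum.mono_neutral_right fin sub) auto
      then show ?thesis using pq by simp
    qed
    have yy: "y p = 1" "y q = s" using pq by (auto simp: y_def)
    have sym: "Scor N Y q p = Scor N Y p q" by (simp add: Scor_def Scov_def mult.commute)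
    have "(\<Sum>r\<in>g. \<Sum>r'\<in>g. y r * Scor N Y r r' * y r') = 2 + 2 * s * Scor N Y p q"
    proof -
      have "(\<Sum>r'\<in>g. y r * Scor N Y r r' * y r') = y r * Scor N Y r p + y r * Scor N Y r q * s" for r
        by (subst red) (simp_all add: out yy)
      then have "(\<Sum>r\<in>g. \<Sum>r'\<in>g. y r * Scor N Y r r' * y r') = (\<Sum>r\<in>g. y r * Scor N Y r p + y r * Scor N Y r q * s)" by simp
      also have "\<dots> = 2 + 2 * s * Scor N Y p q"
        using s pq by (subst red) (simp_all add: out yy cor1 sym power2_eq_square algebra_simps)
      finally show ?thesis .
    qed
    moreover have "(\<Sum>r\<in>g. (y r)^2) = 2" by (subst red) (simp_all add: out yy s)
    ultimately have "2 + 2 * s * Scor N Y p q \<le> rho N Y g * 2"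
      using quad_form_Scor_le_rho[of g y N Y] fin pq(1) by auto
    then show ?thesis using rho1 by simp
  qed
  from this[of 1] this[of "-1"] have "Scor N Y p q = 0" by simp
  then have cov0: "Scov N Y p q = 0" using S[OF pq(1)] S[OF pq(2)] by (auto simp: Scor_def)
  have s2: "(\<Sum>i<N. f i) = f 0 + f 1" for f :: "nat \<Rightarrow> real" using N2 by (simp add: numeral_2_eq_2)
  \<comment> \<open>The two deviations are opposite, so the covariance is
    \<open>2 * yc 0 p * yc 0 q\<close>, nonzero as soon as both variances are positive.\<close>
  have neg: "yc 1 r = - yc 0 r" for r using sum_yc[of r] unfolding s2 by simp
  have cov: "Scov N Y r r' = 2 * yc 0 r * yc 0 r'" for r r'
    using sum_yc_mult[of r r'] N2 unfolding s2 neg by (simp add: mult_ac)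
  have "yc 0 p \<noteq> 0" "yc 0 q \<noteq> 0" using S[OF pq(1)] S[OF pq(2)] unfolding cov by auto
  then show False using cov0 unfolding cov by simp
qed

lemma sum_Scov_le:
  assumes g: "g \<subseteq> {..<Q}" and q: "q \<in> g"
    and S: "\<And>q. q \<in> g \<Longrightarrow> Scov N Y q q > 0" and N: "N \<ge> 2"
    and c5: "real N - rho N Y g - (real (card g) - 1) \<ge> 0"
  shows "2 * (\<Sum>p\<in>g - {q}. \<Sum>p'\<in>g - {q}. Scov N Y p p') \<le> real N * (\<Sum>p\<in>g - {q}. Scov N Y p p)"
proof -
  have fin: "finite g" using g finite_subset by blast
  define B where "B = (\<Sum>p\<in>g - {q}. \<Sum>p'\<in>g - {q}. Scov N Y p p')"
  define D where "D = (\<Sum>p\<in>g - {q}. Scov N Y p p)"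
  have D0: "D \<ge> 0" unfolding D_def using S by (intro sum_nonneg) (auto intro: less_imp_le)
  have le1: "B \<le> (real (card g) - 1) * D"
  proof -
    have "B = (\<Sum>i<N. (\<Sum>p\<in>g - {q}. yc i p)^2) / (real N - 1)"
      using Scov_quad_form[of "\<lambda>_. 1" "g - {q}"] by (simp add: B_def)
    also have "\<dots> \<le> (\<Sum>i<N. real (card (g - {q})) * (\<Sum>p\<in>g - {q}. (yc i p)^2)) / (real N - 1)"
    proof (intro divide_right_mono sum_mono)
      fix i
      show "(\<Sum>p\<in>g - {q}. yc i p)^2 \<le> real (card (g - {q})) * (\<Sum>p\<in>g - {q}. (yc i p)^2)"
        using Cauchy_Schwarz_ineq_sum[of "\<lambda>_. 1" "\<lambda>p. yc i p" "g - {q}"] by simp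
    qed (use N in simp)
    also have "\<dots> = (real (card g) - 1) * ((\<Sum>p\<in>g - {q}. \<Sum>i<N. (yc i p)^2) / (real N - 1))"
    proof -
      have "card g \<ge> 1" using fin q by (auto simp: Suc_le_eq card_gt_0_iff)
      then have "real (card (g - {q})) = real (card g) - 1" using fin q by (simp add: of_nat_diff)
      then show ?thesis by (subst sum.swap[of _ _ "g - {q}"]) (simp add: sum_distrib_left[symmetric])
    qed
    also have "(\<Sum>p\<in>g - {q}. \<Sum>i<N. (yc i p)^2) / (real N - 1) = D"
      unfolding D_def Scov_def yc_def by (simp add: sum_divide_distrib power2_eq_square)
    finally show ?thesis .
  qed
  have le2: "B \<le> rho N Y g * D"
  proof -
    \<comment> \<open>Scaling by standard deviations turns correlations into covariances; the zero
      at \<open>q\<close> lets the eigenvalue of the full group bound the sum over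
      \<open>g - {q}\<close>.\<close>
    define y where "y = (\<lambda>p. if p = q then 0 else sqrt (Scov N Y p p))"
    have yS: "y p * Scor N Y p p' * y p' = Scov N Y p p'" if "p \<in> g - {q}" "p' \<in> g - {q}" for p p'
      using S[of p] S[of p'] that by (simp add: y_def Scor_def real_sqrt_mult field_simps)
    have inner: "(\<Sum>p'\<in>g. y p * Scor N Y p p' * y p') = (\<Sum>p'\<in>g - {q}. y p * Scor N Y p p' * y p')" for p
      by (intro sum.mono_neutral_right fin) (auto simp: y_def)
    have "(\<Sum>p\<in>g. \<Sum>p'\<in>g. y p * Scor N Y p p' * y p') = (\<Sum>p\<in>g - {q}. \<Sum>p'\<in>g - {q}. y p * Scor N Y p p' * y p')"
      unfolding inner by (intro sum.mono_neutral_right fin) (auto simp: y_def)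
    also have "\<dots> = B" unfolding B_def by (intro sum.cong refl yS)
    finally have 1: "(\<Sum>p\<in>g. \<Sum>p'\<in>g. y p * Scor N Y p p' * y p') = B" .
    have "(\<Sum>p\<in>g. (y p)^2) = (\<Sum>p\<in>g - {q}. (y p)^2)"
      by (intro sum.mono_neutral_right fin) (auto simp: y_def)
    also have "\<dots> = D" unfolding D_def using S by (intro sum.cong refl) (auto simp: y_def less_imp_le)
    finally show ?thesis using quad_form_Scor_le_rho[of g y N Y] fin q 1 by auto
  qed
  \<comment> \<open>The two bounds are added, which produces the factor 2 and the combination found
    in Condition 5.\<close>
  have "2 * B \<le> (rho N Y g + (real (card g) - 1)) * D" using le1 le2 by (simp add: algebra_simps)
  also have "\<dots> \<le> real N * D" using c5 D0 by (intro mult_right_mono) auto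
  finally show ?thesis unfolding B_def D_def .
qed

text \<open>With \<open>m = card g\<close>, level \<open>q\<close> itself leaves at least
  \<open>(1 - 2 / N) * (1 - 1 / m)^2 * Scov N Y q q\<close> in the mean squared deviation, and
  \<open>mu\<close> is the inverse of the two factors. The squared bias \<open>b^2\<close> only adds
  to it.\<close>

lemma EE_group_deviation_ge:
  assumes g: "g \<subseteq> QU Q Nq" "card g \<ge> 2" and q: "q \<in> g"
    and S: "\<And>q. q \<in> g \<Longrightarrow> Scov N Y q q > 0"
    and c5: "real N - rho N Y g - (real (card g) - 1) \<ge> 0"
  shows "EE (\<lambda>z. mu N g * (Yhat N Nq Y z q - Yhat_grp N Nq Y z g)^2) \<ge> Scov N Y q q"
proof -
  have gQ: "g \<subseteq> {..<Q}" and n1: "\<And>p. p \<in> g \<Longrightarrow> Nq p = 1" using g(1) by (auto simp: QU_def)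
  have fin: "finite g" using gQ finite_subset by blast
  have N3: "N \<ge> 3" by (rule N_ge_3[OF gQ g(2) S c5])
  then have N2: "N \<ge> 2" by simp
  define m where "m = real (card g)"
  have m2: "m \<ge> 2" using g(2) by (simp add: m_def)
  define a where "a = (\<lambda>p. of_bool (p = q) - 1 / m)"
  define b where "b = (\<Sum>p\<in>g. a p * Ybar N Y p)"
  define X where "X = (\<Sum>p\<in>g. \<Sum>p'\<in>g. a p * a p' * VY N Nq Y p p')"
  have sa: "(\<Sum>p\<in>g. a p * f p) = f q - (\<Sum>p\<in>g. f p) / m" for f :: "nat \<Rightarrow> real"
  proof -
    have "(\<Sum>p\<in>g. a p * f p) = (\<Sum>p\<in>g. (if p = q then f p else 0) - f p / m)"
      by (intro sum.cong) (auto simp: a_def algebra_simps)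
    then show ?thesis using fin q by (simp add: sum_subtractf sum_divide_distrib)
  qed
  have dev: "Yhat N Nq Y z q - Yhat_grp N Nq Y z g = (\<Sum>p\<in>g. a p * M z p) + b" if z: "z \<in> \<Omega>" for z
  proof -
    have "Yhat N Nq Y z q - Yhat_grp N Nq Y z g = (\<Sum>p\<in>g. a p * Yhat N Nq Y z p)"
      by (simp add: sa Yhat_grp_def m_def)
    also have "\<dots> = (\<Sum>p\<in>g. a p * M z p + a p * Ybar N Y p)"
      using gQ by (intro sum.cong refl) (auto simp: Yhat_eq[OF z] n1 algebra_simps)
    finally show ?thesis by (simp add: sum.distrib b_def)
  qed
  have EX: "EE (\<lambda>z. (Yhat N Nq Y z q - Yhat_grp N Nq Y z g)^2) = X + b^2"
  proof -
    have "EE (\<lambda>z. (Yhat N Nq Y z q - Yhat_grp N Nq Y z g)^2)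
       = EE (\<lambda>z. (\<Sum>p\<in>g. \<Sum>p'\<in>g. (a p * a p') * (M z p * M z p')) + (\<Sum>p\<in>g. (2 * b * a p) * M z p) + b^2)"
    proof (rule E_unif_cong)
      fix z assume z: "z \<in> \<Omega>"
      have "(\<Sum>p\<in>g. \<Sum>p'\<in>g. (a p * a p') * (M z p * M z p')) = (\<Sum>p\<in>g. a p * M z p)^2"
        by (simp add: power2_eq_square sum_product mult_ac)
      moreover have "(\<Sum>p\<in>g. (2 * b * a p) * M z p) = 2 * b * (\<Sum>p\<in>g. a p * M z p)"
        by (simp add: sum_distrib_left mult_ac)
      ultimately show "(Yhat N Nq Y z q - Yhat_grp N Nq Y z g)^2
         = (\<Sum>p\<in>g. \<Sum>p'\<in>g. (a p * a p') * (M z p * M z p')) + (\<Sum>p\<in>g. (2 * b * a p) * M z p) + b^2"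
        unfolding dev[OF z] by (simp add: power2_eq_square algebra_simps)
    qed
    also have "\<dots> = (\<Sum>p\<in>g. \<Sum>p'\<in>g. (a p * a p') * EE (\<lambda>z. M z p * M z p')) + (\<Sum>p\<in>g. (2 * b * a p) * EE (\<lambda>z. M z p)) + b^2"
      by (simp only: E_unif_add E_unif_sum E_unif_cmult EE_const)
    also have "(\<Sum>p\<in>g. (2 * b * a p) * EE (\<lambda>z. M z p)) = 0"
      using gQ by (intro sum.neutral) (auto simp: EE_M)
    also have "(\<Sum>p\<in>g. \<Sum>p'\<in>g. (a p * a p') * EE (\<lambda>z. M z p * M z p')) = X"
      unfolding X_def using gQ by (intro sum.cong refl) (auto simp: EE_M_mult[OF N2] n1 subset_iff)
    finally show ?thesis by simp
  qed
  define A where "A = (1 - 1 / m)^2 * Scov N Y q q"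
  define D where "D = (\<Sum>p\<in>g - {q}. Scov N Y p p)"
  define B where "B = (\<Sum>p\<in>g - {q}. \<Sum>p'\<in>g - {q}. Scov N Y p p')"
  have BD: "2 * B \<le> real N * D" unfolding B_def D_def by (rule sum_Scov_le[OF gQ q S N2 c5])
  \<comment> \<open>The combination is split into the part of \<open>q\<close> and the rest, and the
    cross term is removed by \<open>(x - w)^2 \<le> 2 * x^2 + 2 * w^2\<close>. This is the source of
    the 2 in \<open>1 - 2 / N\<close>.\<close>
  have quad: "(\<Sum>p\<in>g. \<Sum>p'\<in>g. a p * a p' * Scov N Y p p') \<le> 2 * A + 2 * B / m^2"
  proof -
    have "(\<Sum>p\<in>g. \<Sum>p'\<in>g. a p * a p' * Scov N Y p p') = (\<Sum>i<N. (\<Sum>p\<in>g. a p * yc i p)^2) / (real N - 1)"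
      by (rule Scov_quad_form)
    also have "\<dots> \<le> (\<Sum>i<N. 2 * ((1 - 1 / m)^2 * (yc i q)^2) + 2 * ((\<Sum>p\<in>g - {q}. yc i p)^2 / m^2)) / (real N - 1)"
    proof (intro divide_right_mono sum_mono)
      fix i
      have "(\<Sum>p\<in>g. a p * yc i p) = (1 - 1 / m) * yc i q - (\<Sum>p\<in>g - {q}. yc i p) / m"
        unfolding sa using fin q by (simp add: sum.remove[of g q] algebra_simps add_divide_distrib)
      moreover have "(x - w)^2 \<le> 2 * x^2 + 2 * w^2" for x w :: real
        using zero_le_power2[of "x + w"] by (simp add: power2_eq_square algebra_simps)
      ultimately have "(\<Sum>p\<in>g. a p * yc i p)^2 \<le> 2 * ((1 - 1 / m) * yc i q)^2 + 2 * ((\<Sum>p\<in>g - {q}. yc i p) / m)^2" by simp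
      then show "(\<Sum>p\<in>g. a p * yc i p)^2 \<le> 2 * ((1 - 1 / m)^2 * (yc i q)^2) + 2 * ((\<Sum>p\<in>g - {q}. yc i p)^2 / m^2)"
        by (simp only: power_mult_distrib power_divide)
    qed (use N2 in simp)
    also have "\<dots> = 2 * ((1 - 1 / m)^2 * ((\<Sum>i<N. (yc i q)^2) / (real N - 1)))
        + 2 * ((\<Sum>i<N. (\<Sum>p\<in>g - {q}. yc i p)^2) / (real N - 1)) / m^2"
      by (simp add: sum.distrib add_divide_distrib sum_distrib_left[symmetric] sum_divide_distrib[symmetric])
    also have "(\<Sum>i<N. (yc i q)^2) / (real N - 1) = Scov N Y q q" by (simp add: Scov_def yc_def power2_eq_square)
    also have "(\<Sum>i<N. (\<Sum>p\<in>g - {q}. yc i p)^2) / (real N - 1) = B"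
      using Scov_quad_form[of "\<lambda>_. 1" "g - {q}"] by (simp add: B_def)
    finally show ?thesis by (simp add: A_def)
  qed
  \<comment> \<open>The variances of the other levels contribute \<open>D / m^2\<close>, exactly
    enough to absorb their covariances, since \<open>2 * B \<le> N * D\<close>.\<close>
  have XA: "X \<ge> (1 - 2 / real N) * A"
  proof -
    have "X = (\<Sum>p\<in>g. \<Sum>p'\<in>g. (if p = p' then (a p)^2 * Scov N Y p p else 0) - (a p * a p' * Scov N Y p p') / real N)"
      unfolding X_def VY_def by (intro sum.cong refl) (auto simp: n1 power2_eq_square algebra_simps)
    also have "\<dots> = (\<Sum>p\<in>g. (a p)^2 * Scov N Y p p) - (\<Sum>p\<in>g. \<Sum>p'\<in>g. a p * a p' * Scov N Y p p') / real N"
      using fin by (simp add: sum_subtractf sum_divide_distrib)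
    also have "(\<Sum>p\<in>g. (a p)^2 * Scov N Y p p) = A + D / m^2"
    proof -
      have "(\<Sum>p\<in>g. (a p)^2 * Scov N Y p p) = (a q)^2 * Scov N Y q q + (\<Sum>p\<in>g - {q}. (a p)^2 * Scov N Y p p)"
        using fin q by (simp add: sum.remove)
      also have "(\<Sum>p\<in>g - {q}. (a p)^2 * Scov N Y p p) = (\<Sum>p\<in>g - {q}. Scov N Y p p / m^2)"
        by (intro sum.cong refl) (simp add: a_def power_divide)
      finally show ?thesis by (simp add: a_def A_def D_def sum_divide_distrib)
    qed
    finally have "X = A + D / m^2 - (\<Sum>p\<in>g. \<Sum>p'\<in>g. a p * a p' * Scov N Y p p') / real N" .
    moreover have "(\<Sum>p\<in>g. \<Sum>p'\<in>g. a p * a p' * Scov N Y p p') / real N \<le> (2 * A + real N * D / m^2) / real N"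
    proof (intro divide_right_mono)
      have "2 * B / m^2 \<le> real N * D / m^2" using BD by (intro divide_right_mono) auto
      then show "(\<Sum>p\<in>g. \<Sum>p'\<in>g. a p * a p' * Scov N Y p p') \<le> 2 * A + real N * D / m^2" using quad by linarith
    qed simp
    moreover have "(2 * A + real N * D / m^2) / real N = 2 / real N * A + D / m^2"
      using N2 by (simp add: add_divide_distrib)
    ultimately show ?thesis by (simp add: algebra_simps)
  qed
  have mu0: "mu N g \<ge> 0" unfolding mu_def using N3 by (intro mult_nonneg_nonneg) auto
  have pos: "1 - 2 / real N > 0" "(1 - 1 / m)^2 > 0" using N3 m2 by (auto simp: field_simps)
  have "Scov N Y q q = mu N g * ((1 - 2 / real N) * A)"
  proof -
    have "s = inverse x * inverse y * (x * (y * s))" if "x > 0" "y > 0" for x y s :: real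
      using that by (simp add: field_simps)
    from this[OF pos, of "Scov N Y q q"] show ?thesis unfolding mu_def m_def[symmetric] A_def .
  qed
  also have "\<dots> \<le> mu N g * (X + b^2)" using XA mu0 by (intro mult_left_mono) (auto intro: order_trans)
  finally show ?thesis by (simp only: E_unif_cmult EX)
qed

end

locale grouped_design = complete_randomization +
  fixes G :: "nat set set"
  assumes G_union: "\<Union>G = QU Q Nq"
    and G_disj: "\<And>g g'. g \<in> G \<Longrightarrow> g' \<in> G \<Longrightarrow> g \<noteq> g' \<Longrightarrow> g \<inter> g' = {}"
    and G_card: "\<And>g. g \<in> G \<Longrightarrow> card g \<ge> 2"
    and S_pos: "\<And>q. q < Q \<Longrightarrow> Scov N Y q q > 0"
begin

lemma grp_eq: "g \<in> G \<Longrightarrow> q \<in> g \<Longrightarrow> grp G q = g"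
  unfolding grp_def using G_disj by (intro the_equality) blast+

lemma grp_in: "q < Q \<Longrightarrow> Nq q = 1 \<Longrightarrow> grp G q \<in> G \<and> q \<in> grp G q"
proof -
  assume "q < Q" "Nq q = 1"
  then have "q \<in> \<Union>G" using G_union by (simp add: QU_def)
  then obtain g where "g \<in> G" "q \<in> g" by auto
  then show ?thesis using grp_eq by simp
qed

lemma EE_VYhat_ge:
  assumes c5: "\<And>g. g \<in> G \<Longrightarrow> real N - rho N Y g - (real (card g) - 1) \<ge> 0" and q: "q < Q"
  shows "EE (\<lambda>z. VYhat N Nq Y G z q) \<ge> Scov N Y q q / real (Nq q)"
proof (cases "Nq q = 1")
  case True
  note gi = grp_in[OF q True]
  have sub: "grp G q \<subseteq> QU Q Nq" using gi G_union by auto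
  show ?thesis unfolding VYhat_def using True EE_group_deviation_ge[OF sub, of q] gi G_card c5 S_pos sub
    by (auto simp: QU_def)
next
  case False
  then have n2: "Nq q \<ge> 2" using Nq_pos[OF q] by simp
  show ?thesis unfolding VYhat_def using False EE_Shat[OF N_ge_2[OF q S_pos[OF q]] q n2]
    by (simp add: E_unif_divide)
qed

lemma EE_Vgammahat_ge:
  assumes c5: "\<And>g. g \<in> G \<Longrightarrow> real N - rho N Y g - (real (card g) - 1) \<ge> 0"
  shows "(\<Sum>h<H. \<Sum>h'<H. x h * x h' *
    (EE (\<lambda>z. Vgammahat N Q Nq Y G F z h h') - Vgamma N Q Nq Y F h h')) \<ge> 0"
proof -
  \<comment> \<open>With \<open>u = F x\<close> both quadratic forms live on the levels, where the
    estimator is diagonal and the levelwise bounds apply.\<close>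
  define u where "u = (\<lambda>q. \<Sum>h<H. x h * F q h)"
  define e where "e = (\<lambda>q. EE (\<lambda>z. VYhat N Nq Y G z q))"
  have A: "(\<Sum>h<H. \<Sum>h'<H. x h * x h' * EE (\<lambda>z. Vgammahat N Q Nq Y G F z h h')) = (\<Sum>q<Q. (u q)^2 * e q)"
  proof -
    have "EE (\<lambda>z. Vgammahat N Q Nq Y G F z h h') = (\<Sum>q<Q. F q h * e q * F q h')" for h h'
      unfolding Vgammahat_def e_def by (simp only: E_unif_sum E_unif_cmult E_unif_cmult_right)
    then have "(\<Sum>h<H. \<Sum>h'<H. x h * x h' * EE (\<lambda>z. Vgammahat N Q Nq Y G F z h h'))
      = (\<Sum>h<H. \<Sum>h'<H. \<Sum>q<Q. (x h * F q h) * (x h' * F q h') * e q)"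
      by (simp add: sum_distrib_left mult_ac)
    also have "\<dots> = (\<Sum>h<H. \<Sum>q<Q. \<Sum>h'<H. (x h * F q h) * (x h' * F q h') * e q)"
      by (intro sum.cong refl sum.swap)
    also have "\<dots> = (\<Sum>q<Q. \<Sum>h<H. \<Sum>h'<H. (x h * F q h) * (x h' * F q h') * e q)" by (rule sum.swap)
    also have "\<dots> = (\<Sum>q<Q. (u q)^2 * e q)"
      unfolding u_def power2_eq_square sum_product unfolding sum_distrib_right ..
    finally show ?thesis .
  qed
  have B: "(\<Sum>h<H. \<Sum>h'<H. x h * x h' * Vgamma N Q Nq Y F h h') = (\<Sum>q<Q. \<Sum>q'<Q. u q * u q' * VY N Nq Y q q')"
  proof -
    have "(\<Sum>h<H. \<Sum>h'<H. x h * x h' * Vgamma N Q Nq Y F h h')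
      = (\<Sum>h<H. \<Sum>h'<H. \<Sum>q<Q. \<Sum>q'<Q. (x h * F q h) * (x h' * F q' h') * VY N Nq Y q q')"
      unfolding Vgamma_def by (simp add: sum_distrib_left mult_ac)
    also have "\<dots> = (\<Sum>h<H. \<Sum>q<Q. \<Sum>h'<H. \<Sum>q'<Q. (x h * F q h) * (x h' * F q' h') * VY N Nq Y q q')"
      by (intro sum.cong refl sum.swap)
    also have "\<dots> = (\<Sum>h<H. \<Sum>q<Q. \<Sum>q'<Q. \<Sum>h'<H. (x h * F q h) * (x h' * F q' h') * VY N Nq Y q q')"
      by (intro sum.cong refl sum.swap)
    also have "\<dots> = (\<Sum>q<Q. \<Sum>h<H. \<Sum>q'<Q. \<Sum>h'<H. (x h * F q h) * (x h' * F q' h') * VY N Nq Y q q')"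
      by (rule sum.swap)
    also have "\<dots> = (\<Sum>q<Q. \<Sum>q'<Q. \<Sum>h<H. \<Sum>h'<H. (x h * F q h) * (x h' * F q' h') * VY N Nq Y q q')"
      by (intro sum.cong refl sum.swap)
    also have "\<dots> = (\<Sum>q<Q. \<Sum>q'<Q. u q * u q' * VY N Nq Y q q')"
      unfolding u_def sum_product unfolding sum_distrib_right ..
    finally show ?thesis .
  qed
  have C: "(\<Sum>q<Q. \<Sum>q'<Q. u q * u q' * VY N Nq Y q q')
     = (\<Sum>q<Q. (u q)^2 * (Scov N Y q q / real (Nq q))) - (\<Sum>q<Q. \<Sum>q'<Q. u q * u q' * Scov N Y q q') / real N"
  proof -
    have "(\<Sum>q<Q. \<Sum>q'<Q. u q * u q' * VY N Nq Y q q')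
      = (\<Sum>q<Q. \<Sum>q'<Q. (if q = q' then (u q)^2 * (Scov N Y q q / real (Nq q)) else 0) - u q * u q' * Scov N Y q q' / real N)"
      unfolding VY_def by (intro sum.cong refl) (auto simp: power2_eq_square algebra_simps)
    then show ?thesis by (simp add: sum_subtractf sum_divide_distrib)
  qed
  have "(\<Sum>q<Q. \<Sum>q'<Q. u q * u q' * Scov N Y q q') / real N \<ge> 0"
  proof (cases "Q = 0")
    case False
    then have "N \<ge> 2" using N_ge_2[of 0] S_pos[of 0] by simp
    then show ?thesis unfolding Scov_quad_form by (intro divide_nonneg_nonneg sum_nonneg) auto
  qed simp
  moreover have "(\<Sum>q<Q. (u q)^2 * (Scov N Y q q / real (Nq q))) \<le> (\<Sum>q<Q. (u q)^2 * e q)"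
    unfolding e_def using EE_VYhat_ge[OF c5] by (intro sum_mono mult_left_mono) auto
  ultimately have "(\<Sum>h<H. \<Sum>h'<H. x h * x h' * EE (\<lambda>z. Vgammahat N Q Nq Y G F z h h'))
     - (\<Sum>h<H. \<Sum>h'<H. x h * x h' * Vgamma N Q Nq Y F h h') \<ge> 0" unfolding A B C by linarith
  then show ?thesis by (simp add: right_diff_distrib sum_subtractf)
qed

end

section \<open>Variance bounds for replicated levels\<close>

text \<open>Cauchy-Schwarz with at most two nonzero terms, to be used with \<open>a\<close> and
  \<open>b\<close> the levels of the two swapped units.\<close>

lemma sum_sq_le_two_support:
  fixes D :: "'a \<Rightarrow> real"
  assumes fin: "finite B" and supp: "\<And>q. q \<in> B \<Longrightarrow> q \<noteq> a \<Longrightarrow> q \<noteq> b \<Longrightarrow> D q = 0"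
  shows "(\<Sum>q\<in>B. D q)^2 \<le> 2 * (\<Sum>q\<in>B. (D q)^2)"
proof -
  define C where "C = B \<inter> {a, b}"
  have C: "finite C" "C \<subseteq> B" "card C \<le> 2"
    using fin card_mono[of "{a,b}" C] card_insert_le_m1[of 2 "{b}" a] unfolding C_def by auto
  have "(\<Sum>q\<in>B. D q) = (\<Sum>q\<in>C. D q)"
    using supp by (intro sum.mono_neutral_right fin C) (auto simp: C_def)
  moreover have "(\<Sum>q\<in>B. (D q)^2) = (\<Sum>q\<in>C. (D q)^2)"
    using supp by (intro sum.mono_neutral_right fin C) (auto simp: C_def)
  moreover have "(\<Sum>q\<in>C. D q)^2 \<le> real (card C) * (\<Sum>q\<in>C. (D q)^2)"
    using Cauchy_Schwarz_ineq_sum[of "\<lambda>_. 1" D C] by simp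
  moreover have "real (card C) * (\<Sum>q\<in>C. (D q)^2) \<le> 2 * (\<Sum>q\<in>C. (D q)^2)"
    using C(3) by (intro mult_right_mono sum_nonneg) auto
  ultimately show ?thesis by simp
qed

lemma mean_sq_le:
  fixes x :: "'a \<Rightarrow> real"
  shows "((\<Sum>p\<in>g. x p) / real (card g))^2 \<le> (\<Sum>p\<in>g. (x p)^2) / real (card g)"
proof (cases "card g = 0")
  case False
  have "(\<Sum>p\<in>g. x p)^2 \<le> real (card g) * (\<Sum>p\<in>g. (x p)^2)"
    using Cauchy_Schwarz_ineq_sum[of "\<lambda>_. 1" x g] by simp
  then have "(\<Sum>p\<in>g. x p)^2 / (real (card g))^2 \<le> real (card g) * (\<Sum>p\<in>g. (x p)^2) / (real (card g))^2"
    by (intro divide_right_mono) auto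
  then show ?thesis using False by (simp add: power2_eq_square)
qed simp

lemma power4_eq: "(x::real)^4 = (x^2)^2"
  by simp

lemma mean_power4_le:
  fixes x :: "'a \<Rightarrow> real"
  shows "((\<Sum>p\<in>g. x p) / real (card g))^4 \<le> (\<Sum>p\<in>g. (x p)^4) / real (card g)"
proof -
  have "((\<Sum>p\<in>g. x p) / real (card g))^4 \<le> ((\<Sum>p\<in>g. (x p)^2) / real (card g))^2"
    unfolding power4_eq by (intro power_mono mean_sq_le) auto
  also have "\<dots> \<le> (\<Sum>p\<in>g. ((x p)^2)^2) / real (card g)" by (rule mean_sq_le)
  finally show ?thesis by simp
qed

lemma sq_add_le: "(a + b)^2 \<le> 2 * a^2 + 2 * (b::real)^2"
  using zero_le_power2[of "a - b"] by (simp add: power2_eq_square algebra_simps)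

lemma sq_diff_le: "(a - b)^2 \<le> 2 * a^2 + 2 * (b::real)^2"
  using sq_add_le[of a "- b"] by simp

lemma power4_add_le: "(a + b)^4 \<le> 8 * a^4 + 8 * (b::real)^4"
proof -
  have "(a + b)^4 \<le> (2 * a^2 + 2 * b^2)^2" unfolding power4_eq by (intro power_mono sq_add_le) auto
  also have "\<dots> \<le> 2 * (2 * a^2)^2 + 2 * (2 * b^2)^2" by (rule sq_add_le)
  finally show ?thesis by (simp add: power_mult_distrib)
qed

lemma sq_add3_le: "(a + b + c)^2 \<le> 3 * (a^2 + b^2 + (c::real)^2)"
  using zero_le_power2[of "a - b"] zero_le_power2[of "a - c"] zero_le_power2[of "b - c"]
  by (simp add: power2_eq_square algebra_simps)

lemma power4_add3_le: "(a + b + c)^4 \<le> 27 * (a^4 + b^4 + (c::real)^4)"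
proof -
  have "(a + b + c)^4 \<le> (3 * (a^2 + b^2 + c^2))^2" unfolding power4_eq by (intro power_mono sq_add3_le) auto
  also have "\<dots> = 9 * (a^2 + b^2 + c^2)^2" unfolding power_mult_distrib by simp
  also have "\<dots> \<le> 9 * (3 * ((a^2)^2 + (b^2)^2 + (c^2)^2))" by (intro mult_left_mono sq_add3_le) auto
  finally show ?thesis by simp
qed

section \<open>Effect of a swap on level statistics\<close>

context complete_randomization
begin

text \<open>Only the summands of \<open>i\<close> and \<open>j\<close> change. The bracket is
  nonzero only when exactly one of the two units sits in level \<open>q\<close>.\<close>

lemma level_sum_swap:
  fixes c :: "nat \<Rightarrow> real"
  assumes i: "i < N" and j: "j < N"
  shows "(\<Sum>k<N. of_bool ((z \<circ> tau i j) k = q) * c k)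
    = (\<Sum>k<N. of_bool (z k = q) * c k) + (of_bool (z j = q) - of_bool (z i = q)) * (c i - c j)"
proof (cases "i = j")
  case False
  have split: "(\<Sum>k<N. f k) = f i + f j + (\<Sum>k\<in>{..<N} - {i} - {j}. f k)" for f :: "nat \<Rightarrow> real"
    using i j False sum.remove[of "{..<N}" i f] sum.remove[of "{..<N} - {i}" j f] by simp
  have "(\<Sum>k\<in>{..<N} - {i} - {j}. of_bool ((z \<circ> tau i j) k = q) * c k)
      = (\<Sum>k\<in>{..<N} - {i} - {j}. of_bool (z k = q) * c k)"
    by (intro sum.cong refl) simp
  then show ?thesis unfolding split by (simp add: algebra_simps)
qed simp

lemma M_swap: "i < N \<Longrightarrow> j < N \<Longrightarrow>
  M (z \<circ> tau i j) q = M z q + (of_bool (z j = q) - of_bool (z i = q)) * (yc i q - yc j q)"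
  unfolding M_def by (rule level_sum_swap)

lemma T_swap: "i < N \<Longrightarrow> j < N \<Longrightarrow>
  T k (z \<circ> tau i j) q = T k z q + (of_bool (z j = q) - of_bool (z i = q)) * (yc i q ^ k - yc j q ^ k)"
  unfolding T_def by (rule level_sum_swap)

text \<open>Jensen's inequality over the units of the level. The right side is linear in the
  indicators, so its expectation needs only one-unit probabilities.\<close>

lemma M_power4_le:
  assumes z: "z \<in> \<Omega>" and q: "q < Q"
  shows "(M z q / real (Nq q))^4 \<le> T 4 z q / real (Nq q)"
proof -
  define A where "A = {i. i < N \<and> z i = q}"
  have c: "card A = Nq q" using z q by (simp add: A_def assignments_def)
  show ?thesis using mean_power4_le[of "\<lambda>i. yc i q" A] unfolding c
    unfolding A_def sum_over_level M_def T_def .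
qed

text \<open>Turns a levelwise bound on squared changes into a variance bound.
  \<open>\<theta>\<close> collects random fourth-power terms, which may depend on the whole
  assignment.\<close>

lemma variance_le_local:
  assumes B: "B \<subseteq> {..<Q}" and N: "N > 0"
    and K: "\<And>q. q \<in> B \<Longrightarrow> K q \<ge> 0"
    and c3: "\<And>q. q < Q \<Longrightarrow> (\<Sum>i<N. yc i q ^ 4) / real N \<le> D4"
    and \<theta>: "\<And>q. q \<in> B \<Longrightarrow> EE (\<theta> q) \<le> b"
    and f: "\<And>z i j. z \<in> \<Omega> \<Longrightarrow> i < N \<Longrightarrow> j < N \<Longrightarrow> (f z - f (z \<circ> tau i j))^2
      \<le> (\<Sum>q\<in>B. (of_bool (z i = q) + of_bool (z j = q)) *
           (K q * (yc i q ^ 4 + yc j q ^ 4 + \<theta> q z + \<theta> q (z \<circ> tau i j))))"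
  shows "EE (\<lambda>z. (f z - EE f)^2) \<le> (\<Sum>q\<in>B. K q * real (Nq q) * (4 * D4 + 4 * b))"
proof -
  define R where "R = (\<lambda>q i j z. (of_bool (z i = q) + of_bool (z j = q)) *
           (yc i q ^ 4 + yc j q ^ 4 + \<theta> q z + \<theta> q (z \<circ> tau i j)))"
  have ER: "(\<Sum>i<N. \<Sum>j<N. EE (R q i j)) \<le> real N * real (Nq q) * (4 * D4 + 4 * b)" if qB: "q \<in> B" for q
  proof -
    have q: "q < Q" using qB B by auto
    define n where "n = real (Nq q)"
    define Y4 where "Y4 = (\<Sum>i<N. yc i q ^ 4)"
    \<comment> \<open>No independence of \<open>\<theta>\<close> and the indicator is needed: summed
      over units, the indicators give the constant \<open>n\<close>.\<close>
    define t where "t = (\<lambda>i. EE (\<lambda>z. of_bool (z i = q) * \<theta> q z))"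
    have st: "(\<Sum>i<N. t i) = n * EE (\<theta> q)"
    proof -
      have "(\<Sum>i<N. t i) = EE (\<lambda>z. \<Sum>i<N. of_bool (z i = q) * \<theta> q z)" unfolding t_def by (simp only: E_unif_sum)
      also have "\<dots> = EE (\<lambda>z. n * \<theta> q z)"
        unfolding n_def by (intro E_unif_cong) (simp only: sum_distrib_right[symmetric] count_level[OF _ q])
      finally show ?thesis by (simp only: E_unif_cmult)
    qed
    have "EE (R q i j) = 2 * (n / real N) * yc i q ^ 4 + 2 * (n / real N) * yc j q ^ 4 + 2 * t i + 2 * t j"
      if i: "i < N" and j: "j < N" for i j
    proof -
      \<comment> \<open>In the last two terms \<open>z i\<close> is read as the swapped assignment
        at \<open>j\<close>, and \<open>z j\<close> as the one at \<open>i\<close>, so that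
        exchangeability reduces them to \<open>t j\<close> and \<open>t i\<close>.\<close>
      have "EE (R q i j) = EE (\<lambda>z. of_bool (z i = q) * (yc i q ^ 4 + yc j q ^ 4) + of_bool (z j = q) * (yc i q ^ 4 + yc j q ^ 4)
          + of_bool (z i = q) * \<theta> q z + of_bool (z j = q) * \<theta> q z
          + of_bool ((z \<circ> tau i j) j = q) * \<theta> q (z \<circ> tau i j) + of_bool ((z \<circ> tau i j) i = q) * \<theta> q (z \<circ> tau i j))"
        unfolding R_def by (intro E_unif_cong) (simp add: algebra_simps)
      also have "\<dots> = 2 * (n / real N) * (yc i q ^ 4 + yc j q ^ 4) + t i + t j
          + EE (\<lambda>z. of_bool ((z \<circ> tau i j) j = q) * \<theta> q (z \<circ> tau i j)) + EE (\<lambda>z. of_bool ((z \<circ> tau i j) i = q) * \<theta> q (z \<circ> tau i j))"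
        unfolding E_unif_add E_unif_cmult_right EE_level[OF i q] EE_level[OF j q] t_def n_def by simp
      also have "EE (\<lambda>z. of_bool ((z \<circ> tau i j) j = q) * \<theta> q (z \<circ> tau i j)) = t j"
        unfolding t_def by (rule EE_swap[OF i j, of "\<lambda>z. of_bool (z j = q) * \<theta> q z"])
      also have "EE (\<lambda>z. of_bool ((z \<circ> tau i j) i = q) * \<theta> q (z \<circ> tau i j)) = t i"
        unfolding t_def by (rule EE_swap[OF i j, of "\<lambda>z. of_bool (z i = q) * \<theta> q z"])
      finally show ?thesis by (simp add: algebra_simps)
    qed
    moreover define r where "r = 2 * (n / real N)"
    ultimately have "(\<Sum>i<N. \<Sum>j<N. EE (R q i j)) = (\<Sum>i<N. \<Sum>j<N. r * yc i q ^ 4 + r * yc j q ^ 4 + 2 * t i + 2 * t j)"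
      by (intro sum.cong refl) simp
    also have "\<dots> = real N * (r * Y4) + real N * (r * Y4) + real N * (2 * (\<Sum>i<N. t i)) + real N * (2 * (\<Sum>j<N. t j))"
      by (simp add: sum.distrib sum_distrib_left[symmetric] Y4_def)
    also have "\<dots> = real N * n * (4 * (Y4 / real N) + 4 * EE (\<theta> q))"
      unfolding st r_def by (simp add: algebra_simps)
    also have "\<dots> \<le> real N * n * (4 * D4 + 4 * b)"
      using c3[OF q] \<theta>[OF qB] by (intro mult_left_mono add_mono) (auto simp: Y4_def n_def)
    finally show ?thesis unfolding n_def .
  qed
  have "real N * EE (\<lambda>z. (f z - EE f)^2) \<le> (\<Sum>i<N. \<Sum>j<N. EE (\<lambda>z. (f z - f (z \<circ> tau i j))^2))"
    by (rule variance_le_transpositions)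
  also have "\<dots> \<le> (\<Sum>i<N. \<Sum>j<N. EE (\<lambda>z. \<Sum>q\<in>B. K q * R q i j z))"
  proof (intro sum_mono E_unif_mono)
    fix i j z assume "i \<in> {..<N}" "j \<in> {..<N}" "z \<in> \<Omega>"
    then show "(f z - f (z \<circ> tau i j))^2 \<le> (\<Sum>q\<in>B. K q * R q i j z)"
      using f[of z i j] unfolding R_def by (simp add: mult.left_commute)
  qed
  also have "\<dots> = (\<Sum>i<N. \<Sum>j<N. \<Sum>q\<in>B. K q * EE (R q i j))" by (simp only: E_unif_sum E_unif_cmult)
  also have "\<dots> = (\<Sum>i<N. \<Sum>q\<in>B. \<Sum>j<N. K q * EE (R q i j))" by (intro sum.cong refl sum.swap)
  also have "\<dots> = (\<Sum>q\<in>B. \<Sum>i<N. \<Sum>j<N. K q * EE (R q i j))" by (rule sum.swap)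
  also have "\<dots> = (\<Sum>q\<in>B. K q * (\<Sum>i<N. \<Sum>j<N. EE (R q i j)))" by (simp only: sum_distrib_left)
  also have "\<dots> \<le> (\<Sum>q\<in>B. K q * (real N * real (Nq q) * (4 * D4 + 4 * b)))"
    by (intro sum_mono mult_left_mono ER K)
  also have "\<dots> = real N * (\<Sum>q\<in>B. K q * real (Nq q) * (4 * D4 + 4 * b))" by (simp add: sum_distrib_left mult_ac)
  finally show ?thesis using N by simp
qed

lemma Shat_swap_sq_le:
  assumes z: "z \<in> \<Omega>" and q: "q < Q" and n2: "Nq q \<ge> 2" and i: "i < N" and j: "j < N"
  defines "n \<equiv> real (Nq q)"
  shows "(Shat N Nq Y z q / n - Shat N Nq Y (z \<circ> tau i j) q / n)^2
    \<le> (of_bool (z i = q) + of_bool (z j = q)) * (128 / n^4 *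
        (yc i q ^ 4 + yc j q ^ 4 + (M z q / n)^4 + (M (z \<circ> tau i j) q / n)^4))"
proof -
  define s where "s = (of_bool (z j = q) - of_bool (z i = q) :: real)"
  define y where "y = yc i q" define w where "w = yc j q"
  define m where "m = M z q" define m' where "m' = M (z \<circ> tau i j) q"
  have n: "n \<ge> 2" using n2 by (simp add: n_def)
  have m': "m' = m + s * (y - w)" unfolding m'_def m_def s_def y_def w_def by (rule M_swap[OF i j])
  \<comment> \<open>The changes of \<open>T 2\<close> and of \<open>M^2 / n\<close> share the factor
    \<open>s * (y - w)\<close>; \<open>e\<close> is the remaining factor.\<close>
  define e where "e = m / n + m' / n - (y + w)"
  have "Shat N Nq Y z q / n - Shat N Nq Y (z \<circ> tau i j) q / n
      = (T 2 z q - T 2 (z \<circ> tau i j) q - (m^2 - m'^2) / n) / (n * (n - 1))"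
  proof -
    have "a / (n - 1) / n - b / (n - 1) / n = (a - b) / (n * (n - 1))" for a b
      by (simp add: diff_divide_distrib mult.commute)
    moreover have "(a - m^2 / n) - (b - m'^2 / n) = a - b - (m^2 - m'^2) / n" for a b
      by (simp add: diff_divide_distrib)
    ultimately show ?thesis
      unfolding Shat_eq[OF z q] Shat_eq[OF swap_in_Omega[OF z i j] q] n_def[symmetric] m_def[symmetric] m'_def[symmetric] by simp
  qed
  also have "T 2 z q - T 2 (z \<circ> tau i j) q - (m^2 - m'^2) / n = s * (y - w) * e"
  proof -
    have "T 2 z q - T 2 (z \<circ> tau i j) q = - s * (y^2 - w^2)"
      unfolding T_swap[OF i j] s_def y_def w_def by simp
    moreover have "(m^2 - m'^2) / n = - (s * (y - w)) * (m / n + m' / n)"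
    proof -
      have "m^2 - m'^2 = - (s * (y - w)) * (m + m')" unfolding m' by (simp add: power2_eq_square algebra_simps)
      then show ?thesis by (simp only: times_divide_eq_right add_divide_distrib[symmetric])
    qed
    ultimately show ?thesis unfolding e_def by (simp add: power2_eq_square algebra_simps)
  qed
  finally have eq: "Shat N Nq Y z q / n - Shat N Nq Y (z \<circ> tau i j) q / n = s * (y - w) * e / (n * (n - 1))" .
  have "(Shat N Nq Y z q / n - Shat N Nq Y (z \<circ> tau i j) q / n)^2 = s^2 * ((y - w)^2 * e^2 / (n * (n - 1))^2)"
    unfolding eq by (simp add: power_divide power_mult_distrib)
  also have "\<dots> \<le> (of_bool (z i = q) + of_bool (z j = q)) * ((y - w)^2 * e^2 / (n * (n - 1))^2)"
    by (intro mult_right_mono) (auto simp: s_def)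
  \<comment> \<open>For \<open>n \<ge> 2\<close> one has \<open>n - 1 \<ge> n / 2\<close>, hence the
    denominator is at least \<open>n^4 / 4\<close>; then \<open>32 * 4 = 128\<close>.\<close>
  also have "\<dots> \<le> (of_bool (z i = q) + of_bool (z j = q)) * (32 * (y^4 + w^4 + (m/n)^4 + (m'/n)^4) / (n^4 / 4))"
  proof (intro mult_left_mono frac_le)
    define a where "a = y^2" define b where "b = w^2" define c where "c = (m/n)^2" define d where "d = (m'/n)^2"
    have nn: "a \<ge> 0" "b \<ge> 0" "c \<ge> 0" "d \<ge> 0" by (auto simp: a_def b_def c_def d_def)
    have 1: "(y - w)^2 \<le> 2 * (a + b)" using sq_diff_le[of y w] by (simp add: a_def b_def)
    have 2: "e^2 \<le> 4 * (a + b + c + d)"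
    proof -
      have "e^2 \<le> 2 * (m/n + m'/n)^2 + 2 * (y + w)^2" unfolding e_def by (rule sq_diff_le)
      also have "\<dots> \<le> 2 * (2 * c + 2 * d) + 2 * (2 * a + 2 * b)"
        unfolding a_def b_def c_def d_def by (intro add_mono mult_left_mono sq_add_le) auto
      finally show ?thesis by simp
    qed
    have "(y - w)^2 * e^2 \<le> (2 * (a + b)) * (4 * (a + b + c + d))" using nn by (intro mult_mono 1 2) auto
    also have "\<dots> \<le> (2 * (a + b + c + d)) * (4 * (a + b + c + d))" using nn by (intro mult_right_mono) auto
    also have "\<dots> = 8 * ((a + b) + (c + d))^2" by (simp add: power2_eq_square algebra_simps)
    also have "\<dots> \<le> 8 * (2 * (a + b)^2 + 2 * (c + d)^2)" by (intro mult_left_mono sq_add_le) simp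
    also have "\<dots> \<le> 8 * (2 * (2 * a^2 + 2 * b^2) + 2 * (2 * c^2 + 2 * d^2))"
      by (intro mult_left_mono add_mono sq_add_le) simp_all
    also have "\<dots> = 32 * (y^4 + w^4 + (m/n)^4 + (m'/n)^4)"
      unfolding a_def b_def c_def d_def power4_eq by simp
    finally show "(y - w)^2 * e^2 \<le> 32 * (y^4 + w^4 + (m/n)^4 + (m'/n)^4)" .
    have "n^4 / 4 = (n * (n / 2))^2" unfolding power4_eq by (simp add: power2_eq_square)
    also have "\<dots> \<le> (n * (n - 1))^2" using n by (intro power_mono mult_left_mono) auto
    finally show "n^4 / 4 \<le> (n * (n - 1))^2" .
    show "n^4 / 4 > 0" using n by simp
  qed (auto simp: add_nonneg_nonneg)
  also have "32 * (y^4 + w^4 + (m/n)^4 + (m'/n)^4) / (n^4 / 4) = 128 / n^4 * (y^4 + w^4 + (m/n)^4 + (m'/n)^4)"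
    by simp
  finally show ?thesis unfolding y_def w_def m_def m'_def .
qed

lemma EE_T4_le:
  assumes q: "q < Q" and c3: "(\<Sum>i<N. yc i q ^ 4) / real N \<le> D4"
  shows "EE (\<lambda>z. T 4 z q) \<le> real (Nq q) * D4"
proof -
  have "EE (\<lambda>z. T 4 z q) = real (Nq q) * ((\<Sum>i<N. yc i q ^ 4) / real N)" unfolding EE_T[OF q] by simp
  also have "\<dots> \<le> real (Nq q) * D4" by (intro mult_left_mono c3) simp
  finally show ?thesis .
qed

lemma EE_M4_le:
  assumes q: "q < Q" and c3: "(\<Sum>i<N. yc i q ^ 4) / real N \<le> D4"
  shows "EE (\<lambda>z. (M z q / real (Nq q))^4) \<le> D4"
proof -
  have "EE (\<lambda>z. (M z q / real (Nq q))^4) \<le> EE (\<lambda>z. T 4 z q / real (Nq q))"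
    by (intro E_unif_mono M_power4_le q)
  also have "\<dots> = EE (\<lambda>z. T 4 z q) / real (Nq q)" by (simp only: E_unif_divide)
  also have "\<dots> \<le> (real (Nq q) * D4) / real (Nq q)" by (intro divide_right_mono EE_T4_le q c3) simp
  finally show ?thesis using Nq_pos[OF q] by simp
qed

text \<open>The change bound is of order \<open>Nq q^-4\<close>, and
  \<open>variance_le_local\<close> returns one factor \<open>Nq q\<close>. The constant is
  \<open>2 * 128 * 8\<close>: two swapped levels, the change bound, and
  \<open>4 * D4 + 4 * D4\<close>.\<close>

lemma variance_replicated_le:
  assumes B: "B \<subseteq> {..<Q}" and n2: "\<And>q. q \<in> B \<Longrightarrow> Nq q \<ge> 2"
    and w: "\<And>q. q \<in> B \<Longrightarrow> \<bar>w q\<bar> \<le> W"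
    and c3: "\<And>q. q < Q \<Longrightarrow> (\<Sum>i<N. yc i q ^ 4) / real N \<le> D4"
  defines "f \<equiv> \<lambda>z. \<Sum>q\<in>B. w q * (Shat N Nq Y z q / real (Nq q))"
  shows "EE (\<lambda>z. (f z - EE f)^2) \<le> 2048 * D4 * W^2 * (\<Sum>q\<in>B. 1 / real (Nq q)^3)"
proof (cases "B = {}")
  case True
  then show ?thesis by (simp add: f_def EE_const)
next
  case False
  then obtain q0 where q0: "q0 \<in> B" by auto
  have finB: "finite B" using B finite_subset by blast
  have "Nq q0 \<le> (\<Sum>q<Q. Nq q)" using q0 B by (intro member_le_sum) auto
  then have N: "N > 0" using Nq_sum n2[OF q0] by simp
  have "EE (\<lambda>z. (f z - EE f)^2) \<le> (\<Sum>q\<in>B. (256 * W^2 / real (Nq q)^4) * real (Nq q) * (4 * D4 + 4 * D4))"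
  proof (rule variance_le_local[OF B N _ c3])
    fix q assume "q \<in> B"
    then show "EE (\<lambda>z. (M z q / real (Nq q))^4) \<le> D4" using B by (intro EE_M4_le c3) auto
  next
    fix z i j assume z: "z \<in> \<Omega>" and i: "i < N" and j: "j < N"
    define X where "X = (\<lambda>q. Shat N Nq Y z q / real (Nq q) - Shat N Nq Y (z \<circ> tau i j) q / real (Nq q))"
    define b where "b = (\<lambda>q. (of_bool (z i = q) + of_bool (z j = q)) * (128 / real (Nq q)^4 *
        (yc i q ^ 4 + yc j q ^ 4 + (M z q / real (Nq q))^4 + (M (z \<circ> tau i j) q / real (Nq q))^4)))"
    have X: "(X q)^2 \<le> b q" if "q \<in> B" for q
      unfolding X_def b_def using that B by (intro Shat_swap_sq_le z n2 i j) auto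
    have "f z - f (z \<circ> tau i j) = (\<Sum>q\<in>B. w q * X q)"
      unfolding f_def X_def by (simp add: right_diff_distrib sum_subtractf)
    then have "(f z - f (z \<circ> tau i j))^2 = (\<Sum>q\<in>B. w q * X q)^2" by simp
    also have "\<dots> \<le> 2 * (\<Sum>q\<in>B. (w q * X q)^2)"
    proof (rule sum_sq_le_two_support[OF finB, of "z i" "z j"])
      fix q assume "q \<in> B" "q \<noteq> z i" "q \<noteq> z j"
      then have "(X q)^2 \<le> 0" using X[of q] by (simp add: b_def)
      then show "w q * X q = 0" by simp
    qed
    also have "\<dots> \<le> 2 * (\<Sum>q\<in>B. W^2 * b q)"
    proof (intro mult_left_mono sum_mono)
      fix q assume q: "q \<in> B"
      have "(w q)^2 \<le> W^2" using w[OF q] by (metis abs_ge_zero power2_abs power_mono)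
      then show "(w q * X q)^2 \<le> W^2 * b q" unfolding power_mult_distrib by (intro mult_mono X q) auto
    qed simp
    also have "\<dots> = (\<Sum>q\<in>B. (of_bool (z i = q) + of_bool (z j = q)) * (256 * W^2 / real (Nq q)^4 *
        (yc i q ^ 4 + yc j q ^ 4 + (M z q / real (Nq q))^4 + (M (z \<circ> tau i j) q / real (Nq q))^4)))"
      unfolding b_def sum_distrib_left by (intro sum.cong refl) (simp add: mult_ac)
    finally show "(f z - f (z \<circ> tau i j))^2 \<le> (\<Sum>q\<in>B. (of_bool (z i = q) + of_bool (z j = q)) * (256 * W^2 / real (Nq q)^4 *
        (yc i q ^ 4 + yc j q ^ 4 + (M z q / real (Nq q))^4 + (M (z \<circ> tau i j) q / real (Nq q))^4)))" .
  qed auto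
  also have "\<dots> = (\<Sum>q\<in>B. 2048 * D4 * W^2 * (1 / real (Nq q)^3))"
  proof (intro sum.cong refl)
    fix q assume "q \<in> B"
    then have "real (Nq q) > 0" using n2[of q] by simp
    then show "(256 * W^2 / real (Nq q)^4) * real (Nq q) * (4 * D4 + 4 * D4) = 2048 * D4 * W^2 * (1 / real (Nq q)^3)"
      using power_Suc[of "real (Nq q)" 3] by (simp add: field_simps)
  qed
  finally show ?thesis by (simp only: sum_distrib_left)
qed

end

section \<open>Variance bounds for unreplicated levels\<close>

context grouped_design
begin

definition dev :: "(nat \<Rightarrow> nat) \<Rightarrow> nat \<Rightarrow> real" where
  "dev z q = Yhat N Nq Y z q - Yhat_grp N Nq Y z (grp G q)"

lemma finite_QU: "finite (QU Q Nq)"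
  by (simp add: QU_def)

lemma finite_group: "g \<in> G \<Longrightarrow> finite g"
  using G_union finite_QU by (metis Union_upper finite_subset)

lemma sum_QU_groups: "(\<Sum>q\<in>QU Q Nq. f q) = (\<Sum>g\<in>G. \<Sum>q\<in>g. (f q :: real))"
proof -
  have "(\<Sum>q\<in>\<Union>G. f q) = (\<Sum>g\<in>G. \<Sum>q\<in>g. f q)"
    using sum.Union_disjoint[of G f] finite_group G_disj by auto
  then show ?thesis using G_union by simp
qed

text \<open>Centring within groups is self-adjoint; moving it off \<open>d\<close> matters because \<open>d\<close> will be supported
  on the two swapped levels.\<close>

lemma group_swap_diff:
  fixes d E w :: "nat \<Rightarrow> real"
  shows "(\<Sum>q\<in>QU Q Nq. w q * mu N (grp G q) * (d q - (\<Sum>p\<in>grp G q. d p) / real (card (grp G q))) * E q)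
    = (\<Sum>q\<in>QU Q Nq. d q * (mu N (grp G q) * (w q * E q - (\<Sum>p\<in>grp G q. w p * E p) / real (card (grp G q)))))"
  unfolding sum_QU_groups
proof (rule sum.cong[OF refl])
  fix g assume g: "g \<in> G"
  define m where "m = real (card g)"
  define A where "A = (\<Sum>q\<in>g. w q * E q)"
  define B where "B = (\<Sum>q\<in>g. d q)"
  have "(\<Sum>q\<in>g. w q * mu N (grp G q) * (d q - (\<Sum>p\<in>grp G q. d p) / real (card (grp G q))) * E q)
     = (\<Sum>q\<in>g. mu N g * (d q * (w q * E q)) - mu N g * (B / m) * (w q * E q))"
    using g by (intro sum.cong refl) (simp add: grp_eq m_def B_def algebra_simps)
  also have "\<dots> = (\<Sum>q\<in>g. mu N g * (d q * (w q * E q))) - mu N g * (B / m) * A"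
    by (simp add: sum_subtractf A_def sum_distrib_left)
  also have "mu N g * (B / m) * A = mu N g * (A / m) * B" by simp
  also have "(\<Sum>q\<in>g. mu N g * (d q * (w q * E q))) - mu N g * (A / m) * B
     = (\<Sum>q\<in>g. mu N g * (d q * (w q * E q)) - mu N g * (A / m) * d q)"
    by (simp add: sum_subtractf B_def sum_distrib_left)
  also have "\<dots> = (\<Sum>q\<in>g. d q * (mu N (grp G q) * (w q * E q - (\<Sum>p\<in>grp G q. w p * E p) / real (card (grp G q)))))"
    using g by (intro sum.cong refl) (simp add: grp_eq m_def A_def algebra_simps)
  finally show "(\<Sum>q\<in>g. w q * mu N (grp G q) * (d q - (\<Sum>p\<in>grp G q. d p) / real (card (grp G q))) * E q)
     = (\<Sum>q\<in>g. d q * (mu N (grp G q) * (w q * E q - (\<Sum>p\<in>grp G q. w p * E p) / real (card (grp G q)))))" .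
qed

text \<open>The deviation is own noise, minus the mean noise of the group, plus a bias controlled by
  Condition 6. The constant 27 is \<open>3^3\<close> for three summands.\<close>

lemma EE_dev4_le:
  assumes q: "q \<in> QU Q Nq"
    and c3: "\<And>q. q < Q \<Longrightarrow> (\<Sum>i<N. yc i q ^ 4) / real N \<le> D4"
    and c6: "\<And>g q. g \<in> G \<Longrightarrow> q \<in> g \<Longrightarrow> \<bar>Ybar N Y q - Ybar_grp N Y g\<bar> \<le> zeta"
  shows "EE (\<lambda>z. dev z q ^ 4) \<le> 27 * (2 * D4 + zeta^4)"
proof -
  have qQ: "q < Q" and n1: "Nq q = 1" using q by (auto simp: QU_def)
  define g where "g = grp G q"
  have g: "g \<in> G" "q \<in> g" using grp_in[OF qQ n1] by (auto simp: g_def)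
  have gQ: "p < Q" "Nq p = 1" if "p \<in> g" for p using that g(1) G_union by (auto simp: QU_def)
  have m: "real (card g) > 0" using G_card[OF g(1)] by simp
  have EM: "EE (\<lambda>z. M z p ^ 4) \<le> D4" if "p \<in> g" for p
    using EE_M4_le[OF gQ(1)[OF that] c3[OF gQ(1)[OF that]]] gQ(2)[OF that] by simp
  define b where "b = Ybar N Y q - Ybar_grp N Y g"
  have "b^4 \<le> zeta^4" using c6[OF g] unfolding b_def[symmetric] by (metis abs_ge_zero power_even_abs_numeral power_mono even_numeral)
  have deveq: "dev z q = M z q + (- ((\<Sum>p\<in>g. M z p) / real (card g))) + b" if z: "z \<in> \<Omega>" for z
  proof -
    have "(\<Sum>p\<in>g. Yhat N Nq Y z p) = (\<Sum>p\<in>g. Ybar N Y p + M z p)"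
      by (intro sum.cong refl) (simp add: Yhat_eq[OF z] gQ)
    then show ?thesis unfolding dev_def g_def[symmetric] Yhat_grp_def b_def Ybar_grp_def
      by (simp add: Yhat_eq[OF z qQ] n1 sum.distrib add_divide_distrib)
  qed
  have "EE (\<lambda>z. dev z q ^ 4) \<le> EE (\<lambda>z. 27 * (M z q ^ 4 + (\<Sum>p\<in>g. M z p ^ 4) / real (card g) + zeta^4))"
  proof (intro E_unif_mono)
    fix z assume z: "z \<in> \<Omega>"
    have "dev z q ^ 4 \<le> 27 * (M z q ^ 4 + (- ((\<Sum>p\<in>g. M z p) / real (card g)))^4 + b^4)"
      unfolding deveq[OF z] by (rule power4_add3_le)
    also have "(- ((\<Sum>p\<in>g. M z p) / real (card g)))^4 = ((\<Sum>p\<in>g. M z p) / real (card g))^4" by simp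
    also have "27 * (M z q ^ 4 + ((\<Sum>p\<in>g. M z p) / real (card g))^4 + b^4)
       \<le> 27 * (M z q ^ 4 + (\<Sum>p\<in>g. M z p ^ 4) / real (card g) + zeta^4)"
      by (intro mult_left_mono add_mono mean_power4_le \<open>b^4 \<le> zeta^4\<close>) auto
    finally show "dev z q ^ 4 \<le> 27 * (M z q ^ 4 + (\<Sum>p\<in>g. M z p ^ 4) / real (card g) + zeta^4)" .
  qed
  also have "\<dots> = 27 * (EE (\<lambda>z. M z q ^ 4) + (\<Sum>p\<in>g. EE (\<lambda>z. M z p ^ 4)) / real (card g) + zeta^4)"
    by (simp only: E_unif_cmult E_unif_add E_unif_divide E_unif_sum EE_const)
  also have "\<dots> \<le> 27 * (D4 + (\<Sum>p\<in>g. D4) / real (card g) + zeta^4)"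
    by (intro mult_left_mono add_mono divide_right_mono sum_mono EM g) auto
  also have "\<dots> = 27 * (2 * D4 + zeta^4)" using m by simp
  finally show ?thesis .
qed

definition grpmean :: "nat \<Rightarrow> (nat \<Rightarrow> real) \<Rightarrow> real" where
  "grpmean q x = (\<Sum>p\<in>grp G q. x p) / real (card (grp G q))"

text \<open>Controls the coefficient left by \<open>group_swap_diff\<close>. Jensen's inequality
  moves the square inside the group mean, where the weights can be replaced by
  \<open>W\<close>.\<close>

lemma weighted_group_dev_sq_le:
  assumes w: "\<And>p. p \<in> QU Q Nq \<Longrightarrow> \<bar>w p\<bar> \<le> W" and q: "q \<in> QU Q Nq"
  shows "(w q * E q - grpmean q (\<lambda>p. w p * E p))^2 \<le> W^2 * (2 * (E q)^2 + 2 * grpmean q (\<lambda>p. (E p)^2))"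
proof -
  have gQ: "p \<in> QU Q Nq" if "p \<in> grp G q" for p using that grp_in[of q] q G_union by (auto simp: QU_def)
  have w2: "(w p * E p)^2 \<le> W^2 * (E p)^2" if "p \<in> QU Q Nq" for p
    unfolding power_mult_distrib using w[OF that] by (intro mult_right_mono) (auto simp: abs_le_square_iff[symmetric])
  have "(w q * E q - grpmean q (\<lambda>p. w p * E p))^2 \<le> 2 * (w q * E q)^2 + 2 * (grpmean q (\<lambda>p. w p * E p))^2"
    by (rule sq_diff_le)
  also have "\<dots> \<le> 2 * (W^2 * (E q)^2) + 2 * grpmean q (\<lambda>p. (w p * E p)^2)"
    unfolding grpmean_def by (intro add_mono mult_left_mono w2 q mean_sq_le) auto
  also have "\<dots> \<le> 2 * (W^2 * (E q)^2) + 2 * grpmean q (\<lambda>p. W^2 * (E p)^2)"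
    unfolding grpmean_def by (intro add_left_mono mult_left_mono divide_right_mono sum_mono w2 gQ) auto
  also have "\<dots> = W^2 * (2 * (E q)^2 + 2 * grpmean q (\<lambda>p. (E p)^2))"
    unfolding grpmean_def by (simp add: sum_distrib_left[symmetric] algebra_simps)
  finally show ?thesis .
qed

text \<open>The arithmetic-geometric mean inequality separates the outcomes of the swapped units
  from the deviations, so that expectations can be taken term by term. It is applied with
  \<open>a\<close> and \<open>b\<close> the deviations before and after a swap.\<close>

lemma unreplicated_term_le:
  fixes x y :: real and E :: "nat \<Rightarrow> real"
  assumes E: "\<And>p. E p = a p + b p"
  shows "(x - y)^2 * (2 * (E q)^2 + 2 * grpmean q (\<lambda>p. (E p)^2))
    \<le> 32 * (x^4 + y^4 + (a q ^ 4 + grpmean q (\<lambda>p. a p ^ 4)) + (b q ^ 4 + grpmean q (\<lambda>p. b p ^ 4)))"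
proof -
  define c where "c = 2 * (E q)^2 + 2 * grpmean q (\<lambda>p. (E p)^2)"
  have mono: "grpmean q f \<le> grpmean q h" if "\<And>p. f p \<le> h p" for f h
    unfolding grpmean_def using that by (intro divide_right_mono sum_mono) auto
  have nn: "grpmean q f \<ge> 0" if "\<And>p. f p \<ge> 0" for f
    unfolding grpmean_def using that by (intro divide_nonneg_nonneg sum_nonneg) auto
  have E4: "(E p)^4 \<le> 8 * a p ^ 4 + 8 * b p ^ 4" for p unfolding E by (rule power4_add_le)
  have "c^2 \<le> 2 * (2 * (E q)^2)^2 + 2 * (2 * grpmean q (\<lambda>p. (E p)^2))^2" unfolding c_def by (rule sq_add_le)
  also have "\<dots> = 8 * (E q)^4 + 8 * (grpmean q (\<lambda>p. (E p)^2))^2" by (simp add: power_mult_distrib)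
  also have "(grpmean q (\<lambda>p. (E p)^2))^2 \<le> grpmean q (\<lambda>p. ((E p)^2)^2)" unfolding grpmean_def by (rule mean_sq_le)
  also have "(\<lambda>p. ((E p)^2)^2) = (\<lambda>p. (E p)^4)" by simp
  finally have "c^2 \<le> 8 * (E q)^4 + 8 * grpmean q (\<lambda>p. (E p)^4)" by simp
  also have "\<dots> \<le> 8 * (8 * a q ^ 4 + 8 * b q ^ 4) + 8 * grpmean q (\<lambda>p. 8 * a p ^ 4 + 8 * b p ^ 4)"
    by (intro add_mono mult_left_mono E4 mono) auto
  also have "grpmean q (\<lambda>p. 8 * a p ^ 4 + 8 * b p ^ 4) = 8 * grpmean q (\<lambda>p. a p ^ 4) + 8 * grpmean q (\<lambda>p. b p ^ 4)"
    unfolding grpmean_def by (simp add: sum.distrib sum_distrib_left[symmetric] add_divide_distrib)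
  finally have c2: "c^2 \<le> 64 * ((a q ^ 4 + grpmean q (\<lambda>p. a p ^ 4)) + (b q ^ 4 + grpmean q (\<lambda>p. b p ^ 4)))" by simp
  have "(x - y)^4 \<le> 8 * x^4 + 8 * y^4" using power4_add_le[of x "- y"] by simp
  then have d2: "((x - y)^2)^2 \<le> 8 * (x^4 + y^4)" by simp
  have amgm: "u * v \<le> (u^2 + v^2) / 2" for u v :: real
    using zero_le_power2[of "u - v"] by (simp add: power2_eq_square algebra_simps)
  have "(x - y)^2 * c \<le> (((x - y)^2)^2 + c^2) / 2" by (rule amgm)
  also have "\<dots> \<le> (8 * (x^4 + y^4) + 64 * ((a q ^ 4 + grpmean q (\<lambda>p. a p ^ 4)) + (b q ^ 4 + grpmean q (\<lambda>p. b p ^ 4)))) / 2"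
    by (intro divide_right_mono add_mono d2 c2) simp
  also have "\<dots> \<le> 32 * (x^4 + y^4 + (a q ^ 4 + grpmean q (\<lambda>p. a p ^ 4)) + (b q ^ 4 + grpmean q (\<lambda>p. b p ^ 4)))"
  proof -
    have "x^4 \<ge> 0" "y^4 \<ge> 0" by auto
    then show ?thesis by simp
  qed
  finally show ?thesis unfolding c_def .
qed

text \<open>The 64 is 32 from \<open>unreplicated_term_le\<close> times 2 for the two swapped
  levels; \<open>216 = 4 * 54\<close>, where 54 is twice the 27 of
  \<open>EE_dev4_le\<close>.\<close>

lemma variance_unreplicated_le:
  assumes c3: "\<And>q. q < Q \<Longrightarrow> (\<Sum>i<N. yc i q ^ 4) / real N \<le> D4"
    and c6: "\<And>g q. g \<in> G \<Longrightarrow> q \<in> g \<Longrightarrow> \<bar>Ybar N Y q - Ybar_grp N Y g\<bar> \<le> zeta"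
    and mu: "\<And>g. g \<in> G \<Longrightarrow> mu N g \<le> Cmu"
    and w: "\<And>q. q \<in> QU Q Nq \<Longrightarrow> \<bar>w q\<bar> \<le> W"
  defines "f \<equiv> \<lambda>z. \<Sum>q\<in>QU Q Nq. w q * (mu N (grp G q) * dev z q ^ 2)"
  shows "EE (\<lambda>z. (f z - EE f)^2)
    \<le> 64 * Cmu^2 * (4 * D4 + 216 * (2 * D4 + zeta^4)) * W^2 * real (card (QU Q Nq))"
proof (cases "QU Q Nq = {}")
  case True
  then show ?thesis by (simp add: f_def EE_const)
next
  case False
  then obtain q0 where q0: "q0 < Q" "Nq q0 = 1" by (auto simp: QU_def)
  have N2: "N \<ge> 2" using N_ge_2[OF q0(1) S_pos[OF q0(1)]] .
  have U: "QU Q Nq \<subseteq> {..<Q}" by (auto simp: QU_def)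
  \<comment> \<open>Squaring the upper bound requires \<open>mu\<close> to be nonnegative. This
    follows from \<open>N \<ge> 2\<close>, with \<open>inverse 0 = 0\<close> at
    \<open>N = 2\<close>.\<close>
  have mu2: "(mu N (grp G q))^2 \<le> Cmu^2" if "q \<in> QU Q Nq" for q
  proof (intro power_mono)
    show "mu N (grp G q) \<le> Cmu" using that grp_in[of q] by (intro mu) (auto simp: QU_def)
    show "0 \<le> mu N (grp G q)" unfolding mu_def using N2 by (intro mult_nonneg_nonneg) auto
  qed
  define \<theta> where "\<theta> = (\<lambda>q z. dev z q ^ 4 + grpmean q (\<lambda>p. dev z p ^ 4))"
  have "EE (\<lambda>z. (f z - EE f)^2) \<le> (\<Sum>q\<in>QU Q Nq. (64 * Cmu^2 * W^2) * real (Nq q) * (4 * D4 + 4 * (54 * (2 * D4 + zeta^4))))"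
  proof (rule variance_le_local[OF U _ _ c3, where \<theta> = \<theta>])
    show "N > 0" using N2 by simp
    show "64 * Cmu^2 * W^2 \<ge> 0" by simp
  next
    fix q assume q: "q \<in> QU Q Nq"
    have gi: "grp G q \<in> G" "q \<in> grp G q" using grp_in[of q] q by (auto simp: QU_def)
    have gQ: "p \<in> QU Q Nq" if "p \<in> grp G q" for p using that gi G_union by auto
    have m: "real (card (grp G q)) > 0" using G_card[OF gi(1)] by simp
    have "EE (\<theta> q) = EE (\<lambda>z. dev z q ^ 4) + (\<Sum>p\<in>grp G q. EE (\<lambda>z. dev z p ^ 4)) / real (card (grp G q))"
      unfolding \<theta>_def grpmean_def by (simp only: E_unif_add E_unif_divide E_unif_sum)
    also have "\<dots> \<le> 27 * (2 * D4 + zeta^4) + (\<Sum>p\<in>grp G q. 27 * (2 * D4 + zeta^4)) / real (card (grp G q))"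
      by (intro add_mono divide_right_mono sum_mono EE_dev4_le[OF _ c3 c6] q gQ) auto
    also have "\<dots> = 54 * (2 * D4 + zeta^4)" using m by simp
    finally show "EE (\<theta> q) \<le> 54 * (2 * D4 + zeta^4)" .
  next
    fix z i j assume z: "z \<in> \<Omega>" and i: "i < N" and j: "j < N"
    define z' where "z' = z \<circ> tau i j"
    have z': "z' \<in> \<Omega>" unfolding z'_def by (rule swap_in_Omega[OF z i j])
    define s where "s = (\<lambda>q. of_bool (z j = q) - of_bool (z i = q) :: real)"
    define d where "d = (\<lambda>q. Yhat N Nq Y z q - Yhat N Nq Y z' q)"
    define E where "E = (\<lambda>q. dev z q + dev z' q)"
    define c where "c = (\<lambda>q. mu N (grp G q) * (w q * E q - grpmean q (\<lambda>p. w p * E p)))"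
    have d: "(d q)^2 = (s q)^2 * (yc i q - yc j q)^2" if "q \<in> QU Q Nq" for q
    proof -
      have "q < Q" "Nq q = 1" using that by (auto simp: QU_def)
      then have "d q = - (s q * (yc i q - yc j q))" unfolding d_def s_def
        by (simp add: Yhat_eq[OF z] Yhat_eq[OF z', unfolded z'_def] z'_def M_swap[OF i j])
      then show ?thesis by (simp add: power_mult_distrib)
    qed
    \<comment> \<open>A difference of squares: the change \<open>dev z q - dev z' q\<close> times
      the sum \<open>E q\<close>. The change is the group-centred \<open>d\<close>, nonzero across
      whole groups, until the centring is moved off it.\<close>
    have "f z - f z' = (\<Sum>q\<in>QU Q Nq. w q * mu N (grp G q) * (d q - (\<Sum>p\<in>grp G q. d p) / real (card (grp G q))) * E q)"
    proof -
      have "dev z q - dev z' q = d q - (\<Sum>p\<in>grp G q. d p) / real (card (grp G q))" for q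
        unfolding dev_def d_def Yhat_grp_def by (simp add: sum_subtractf diff_divide_distrib)
      moreover have "f z - f z' = (\<Sum>q\<in>QU Q Nq. w q * mu N (grp G q) * (dev z q - dev z' q) * E q)"
        unfolding f_def E_def sum_subtractf[symmetric]
        by (intro sum.cong refl) (simp add: power2_eq_square algebra_simps)
      ultimately show ?thesis by simp
    qed
    also have "\<dots> = (\<Sum>q\<in>QU Q Nq. d q * c q)" unfolding group_swap_diff c_def grpmean_def ..
    finally have "(f z - f z')^2 = (\<Sum>q\<in>QU Q Nq. d q * c q)^2" by simp
    also have "\<dots> \<le> 2 * (\<Sum>q\<in>QU Q Nq. (d q * c q)^2)"
    proof (rule sum_sq_le_two_support[OF finite_QU, of "z i" "z j"])
      fix q assume "q \<in> QU Q Nq" "q \<noteq> z i" "q \<noteq> z j"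
      then have "(d q)^2 = 0" using d[of q] by (simp add: s_def)
      then show "d q * c q = 0" by simp
    qed
    also have "\<dots> \<le> 2 * (\<Sum>q\<in>QU Q Nq. (of_bool (z i = q) + of_bool (z j = q)) *
           ((32 * Cmu^2 * W^2) * (yc i q ^ 4 + yc j q ^ 4 + \<theta> q z + \<theta> q z')))"
    proof (intro mult_left_mono sum_mono)
      fix q assume q: "q \<in> QU Q Nq"
      define t where "t = 2 * (E q)^2 + 2 * grpmean q (\<lambda>p. (E p)^2)"
      have "(c q)^2 \<le> Cmu^2 * (W^2 * t)" unfolding c_def t_def power_mult_distrib[of "mu N (grp G q)"]
        by (intro mult_mono mu2 weighted_group_dev_sq_le q) (use w in auto)
      then have "(d q * c q)^2 \<le> ((s q)^2 * (yc i q - yc j q)^2) * (Cmu^2 * (W^2 * t))"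
        unfolding power_mult_distrib[of "d q"] d[OF q] by (intro mult_left_mono) auto
      also have "\<dots> = (s q)^2 * (Cmu^2 * W^2 * ((yc i q - yc j q)^2 * t))" by (simp add: mult_ac)
      also have "\<dots> \<le> (of_bool (z i = q) + of_bool (z j = q)) * (Cmu^2 * W^2 * (32 * (yc i q ^ 4 + yc j q ^ 4 + \<theta> q z + \<theta> q z')))"
      proof (rule mult_mono)
        have "(yc i q - yc j q)^2 * t \<le> 32 * (yc i q ^ 4 + yc j q ^ 4 + \<theta> q z + \<theta> q z')"
          unfolding t_def \<theta>_def by (rule unreplicated_term_le) (simp add: E_def)
        then show "Cmu^2 * W^2 * ((yc i q - yc j q)^2 * t) \<le> Cmu^2 * W^2 * (32 * (yc i q ^ 4 + yc j q ^ 4 + \<theta> q z + \<theta> q z'))"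
          by (intro mult_left_mono) auto
        have "t \<ge> 0" unfolding t_def grpmean_def by (intro add_nonneg_nonneg mult_nonneg_nonneg divide_nonneg_nonneg sum_nonneg) auto
        then show "0 \<le> Cmu^2 * W^2 * ((yc i q - yc j q)^2 * t)" by simp
      qed (auto simp: s_def)
      finally show "(d q * c q)^2 \<le> (of_bool (z i = q) + of_bool (z j = q)) *
           ((32 * Cmu^2 * W^2) * (yc i q ^ 4 + yc j q ^ 4 + \<theta> q z + \<theta> q z'))" by (simp add: mult_ac)
    qed simp
    also have "\<dots> = (\<Sum>q\<in>QU Q Nq. (of_bool (z i = q) + of_bool (z j = q)) *
           ((64 * Cmu^2 * W^2) * (yc i q ^ 4 + yc j q ^ 4 + \<theta> q z + \<theta> q z')))"
      unfolding sum_distrib_left by (intro sum.cong refl) simp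
    finally show "(f z - f (z \<circ> tau i j))^2 \<le> (\<Sum>q\<in>QU Q Nq. (of_bool (z i = q) + of_bool (z j = q)) *
           ((64 * Cmu^2 * W^2) * (yc i q ^ 4 + yc j q ^ 4 + \<theta> q z + \<theta> q (z \<circ> tau i j))))"
      unfolding z'_def .
  qed
  also have "\<dots> = (\<Sum>q\<in>QU Q Nq. 64 * Cmu^2 * (4 * D4 + 216 * (2 * D4 + zeta^4)) * W^2)"
    by (intro sum.cong refl) (simp add: QU_def)
  finally show ?thesis by (simp add: mult.commute)
qed

end

section \<open>Rates\<close>

lemma abs_le_rowmax:
  assumes "finite B" "q \<in> B" "h < H"
  shows "\<bar>F q h\<bar> \<le> rowmax B H F"
proof -
  have "{\<bar>F q h\<bar> | q h. q \<in> B \<and> h < H} = (\<lambda>(q, h). \<bar>F q h\<bar>) ` (B \<times> {..<H})" by auto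
  then have "finite {\<bar>F q h\<bar> | q h. q \<in> B \<and> h < H}" using assms(1) by simp
  then show ?thesis unfolding rowmax_def using assms by (intro Max_ge) auto
qed

lemma rowmax_nonneg: "finite B \<Longrightarrow> rowmax B H F \<ge> 0"
proof -
  assume "finite B"
  moreover have "{\<bar>F q h\<bar> | q h. q \<in> B \<and> h < H} = (\<lambda>(q, h). \<bar>F q h\<bar>) ` (B \<times> {..<H})" by auto
  ultimately have "finite {\<bar>F q h\<bar> | q h. q \<in> B \<and> h < H}" by simp
  then show ?thesis unfolding rowmax_def by (intro Max_ge) auto
qed

lemma abs_mult_le_rowmax_sq:
  assumes "finite B" "q \<in> B" "h < H" "h' < H"
  shows "\<bar>F q h * F q h'\<bar> \<le> (rowmax B H F)^2"
  unfolding abs_mult power2_eq_square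
  by (intro mult_mono abs_le_rowmax assms rowmax_nonneg) auto

text \<open>From \<open>NL Nq L \<le> card L * chi * N0\<close> one gets
  \<open>1 / (clo * N0) \<le> (chi / clo) * card L / NL Nq L\<close>; its cube is summed over at
  most \<open>card L\<close> levels. For empty \<open>L\<close> both sides are 0, which realizes the
  convention on empty sets.\<close>

lemma sum_inverse_cube_le:
  fixes Nq :: "nat \<Rightarrow> nat" and N0 :: nat and clo chi :: real
  assumes fin: "finite L" and N0: "N0 \<ge> 1" and clo: "0 < clo"
    and size: "\<And>q. q \<in> L \<Longrightarrow> clo \<le> real (Nq q) / real N0 \<and> real (Nq q) / real N0 \<le> chi"
    and B: "B \<subseteq> L"
  shows "(\<Sum>q\<in>B. 1 / real (Nq q)^3) \<le> (chi / clo)^3 * (real (card L)^4 / real (NL Nq L)^3)"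
proof (cases "L = {}")
  case True
  then show ?thesis using B by simp
next
  case False
  define n0 where "n0 = real N0"
  have n0: "n0 > 0" using N0 by (simp add: n0_def)
  have lo: "clo * n0 \<le> real (Nq q)" and hi: "real (Nq q) \<le> chi * n0" if "q \<in> L" for q
    using size[OF that] n0 by (auto simp: n0_def field_simps)
  have pos: "clo * n0 > 0" using clo n0 by simp
  obtain q0 where q0: "q0 \<in> L" using False by auto
  have NLe: "real (NL Nq L) = (\<Sum>q\<in>L. real (Nq q))" by (simp add: NL_def)
  have "real (Nq q0) \<le> real (NL Nq L)" unfolding NLe using fin q0 by (intro member_le_sum) auto
  then have NLpos: "real (NL Nq L) > 0" using lo[OF q0] pos by linarith
  have "real (NL Nq L) \<le> (\<Sum>q\<in>L. chi * n0)" unfolding NLe by (intro sum_mono hi)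
  then have NLle: "real (NL Nq L) \<le> real (card L) * (chi * n0)" by simp
  have "(\<Sum>q\<in>B. 1 / real (Nq q)^3) \<le> (\<Sum>q\<in>B. 1 / (clo * n0)^3)"
  proof (intro sum_mono)
    fix q assume "q \<in> B"
    then have "clo * n0 \<le> real (Nq q)" using B lo by auto
    then have "(clo * n0)^3 \<le> real (Nq q)^3" using pos by (intro power_mono) auto
    then show "1 / real (Nq q)^3 \<le> 1 / (clo * n0)^3" using pos by (intro frac_le) auto
  qed
  also have "\<dots> = real (card B) * (1 / (clo * n0)^3)" by simp
  also have "\<dots> \<le> real (card L) * (1 / (clo * n0)^3)"
    using card_mono[OF fin B] pos by (intro mult_right_mono) auto
  also have "1 / (clo * n0)^3 \<le> (chi / clo)^3 * (real (card L)^3 / real (NL Nq L)^3)"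
  proof -
    have "real (NL Nq L)^3 \<le> (real (card L) * (chi * n0))^3" using NLle by (intro power_mono) auto
    then have "real (NL Nq L)^3 * (1 / (clo * n0)^3) \<le> (real (card L) * (chi * n0))^3 * (1 / (clo * n0)^3)"
      using pos by (intro mult_right_mono) auto
    also have "\<dots> = (chi / clo)^3 * real (card L)^3"
      using n0 clo by (simp add: power_mult_distrib power_divide)
    finally have "1 / (clo * n0)^3 \<le> (chi / clo)^3 * real (card L)^3 / real (NL Nq L)^3"
      using NLpos by (subst pos_le_divide_eq) (simp_all add: mult.commute)
    then show ?thesis by simp
  qed
  also have "real (card L) * ((chi / clo)^3 * (real (card L)^3 / real (NL Nq L)^3))
      = (chi / clo)^3 * (real (card L)^4 / real (NL Nq L)^3)"
    by (simp add: power_Suc[of _ 3, simplified])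
  finally show ?thesis by (simp add: mult_left_mono)
qed

context grouped_design
begin

text \<open>In a single entry, level \<open>q\<close> has weight \<open>F q h * F q h'\<close>, at
  most the squared row maximum, hence the fourth powers. The three parts are dependent; separating
  them costs the factor 3.\<close>

lemma variance_Vgammahat_le:
  fixes F :: "nat \<Rightarrow> nat \<Rightarrow> real" and h h' :: nat
  assumes QL: "QL \<subseteq> {..<Q}" and N0: "N0 \<ge> (1::nat)" and clo: "0 < clo"
    and size: "\<And>q. q \<in> QL \<Longrightarrow> clo \<le> real (Nq q) / real N0 \<and> real (Nq q) / real N0 \<le> chi"
    and c3: "\<And>q. q < Q \<Longrightarrow> (\<Sum>i<N. (Y i q - Ybar N Y q)^4) / real N \<le> Delta^4"
    and c6: "\<And>g q. g \<in> G \<Longrightarrow> q \<in> g \<Longrightarrow> \<bar>Ybar N Y q - Ybar_grp N Y g\<bar> \<le> zeta"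
    and mu: "\<And>g. g \<in> G \<Longrightarrow> mu N g \<le> Cmu"
    and h: "h < H" and h': "h' < H"
  defines "V \<equiv> \<lambda>z. Vgammahat N Q Nq Y G F z h h'"
  shows "EE (\<lambda>z. (V z - EE V)^2) \<le> 3 * (
      64 * Cmu^2 * (4 * Delta^4 + 216 * (2 * Delta^4 + zeta^4)) * (rowmax (QU Q Nq) H F ^ 4 * real (card (QU Q Nq)))
    + 2048 * Delta^4 * (rowmax (QR Q Nq QL) H F ^ 4 * real (card (QR Q Nq QL)))
    + 2048 * Delta^4 * (chi / clo)^3 * (rowmax QL H F ^ 4 * real (card QL)^4 / real (NL Nq QL)^3))"
proof -
  define w where "w = (\<lambda>q. F q h * F q h')"
  \<comment> \<open>A level of \<open>QL\<close> with a single unit is estimated through its group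
    and belongs to \<open>QU\<close>. Leaving it out makes the three index sets disjoint.\<close>
  define L where "L = {q \<in> QL. Nq q \<ge> 2}"
  define fU where "fU = (\<lambda>z. \<Sum>q\<in>QU Q Nq. w q * (mu N (grp G q) * dev z q ^ 2))"
  define fB where "fB = (\<lambda>B z. \<Sum>q\<in>B. w q * (Shat N Nq Y z q / real (Nq q)))"
  have c3': "(\<Sum>i<N. yc i q ^ 4) / real N \<le> Delta^4" if "q < Q" for q using c3[OF that] by (simp add: yc_def)
  have finL: "finite QL" using QL finite_subset by blast
  have finR: "finite (QR Q Nq QL)" by (simp add: QR_def)
  have split: "{..<Q} = QU Q Nq \<union> (QR Q Nq QL \<union> L)"
  proof (intro equalityI subsetI)
    fix q assume "q \<in> {..<Q}"
    moreover from this have "Nq q = 1 \<or> Nq q \<ge> 2" using Nq_pos[of q] by auto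
    ultimately show "q \<in> QU Q Nq \<union> (QR Q Nq QL \<union> L)" by (auto simp: QU_def QR_def L_def)
  qed (use QL in \<open>auto simp: QU_def QR_def L_def\<close>)
  have V: "V z = fU z + fB (QR Q Nq QL) z + fB L z" for z
  proof -
    have "V z = (\<Sum>q\<in>{..<Q}. w q * VYhat N Nq Y G z q)"
      unfolding V_def Vgammahat_def w_def by (intro sum.cong refl) simp
    also have "\<dots> = (\<Sum>q\<in>QU Q Nq. w q * VYhat N Nq Y G z q)
        + ((\<Sum>q\<in>QR Q Nq QL. w q * VYhat N Nq Y G z q) + (\<Sum>q\<in>L. w q * VYhat N Nq Y G z q))"
      unfolding split using finL finR finite_QU
      by (subst sum.union_disjoint, (auto simp: QU_def QR_def L_def)[3], subst sum.union_disjoint)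
        (auto simp: QU_def QR_def L_def)
    also have "(\<Sum>q\<in>QU Q Nq. w q * VYhat N Nq Y G z q) = fU z"
      unfolding fU_def by (intro sum.cong refl) (simp add: VYhat_def QU_def dev_def)
    also have "(\<Sum>q\<in>QR Q Nq QL. w q * VYhat N Nq Y G z q) = fB (QR Q Nq QL) z"
      unfolding fB_def by (intro sum.cong refl) (auto simp: VYhat_def QR_def)
    also have "(\<Sum>q\<in>L. w q * VYhat N Nq Y G z q) = fB L z"
      unfolding fB_def by (intro sum.cong refl) (auto simp: VYhat_def L_def)
    finally show ?thesis by simp
  qed
  have EV: "EE V = EE fU + EE (fB (QR Q Nq QL)) + EE (fB L)"
  proof -
    have "V = (\<lambda>z. fU z + fB (QR Q Nq QL) z + fB L z)" using V by auto
    then show ?thesis by (simp only: E_unif_add)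
  qed
  have vU: "EE (\<lambda>z. (fU z - EE fU)^2) \<le> 64 * Cmu^2 * (4 * Delta^4 + 216 * (2 * Delta^4 + zeta^4))
      * (rowmax (QU Q Nq) H F ^ 2)^2 * real (card (QU Q Nq))"
    unfolding fU_def by (rule variance_unreplicated_le[OF c3' c6 mu])
      (auto simp: w_def intro!: abs_mult_le_rowmax_sq finite_QU h h')
  have vR: "EE (\<lambda>z. (fB (QR Q Nq QL) z - EE (fB (QR Q Nq QL)))^2)
      \<le> 2048 * Delta^4 * (rowmax (QR Q Nq QL) H F ^ 2)^2 * real (card (QR Q Nq QL))"
  proof -
    have "EE (\<lambda>z. (fB (QR Q Nq QL) z - EE (fB (QR Q Nq QL)))^2)
      \<le> 2048 * Delta^4 * (rowmax (QR Q Nq QL) H F ^ 2)^2 * (\<Sum>q\<in>QR Q Nq QL. 1 / real (Nq q)^3)"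
      unfolding fB_def by (rule variance_replicated_le[OF _ _ _ c3'])
        (auto simp: w_def QR_def intro!: abs_mult_le_rowmax_sq h h')
    also have "(\<Sum>q\<in>QR Q Nq QL. 1 / real (Nq q)^3) \<le> (\<Sum>q\<in>QR Q Nq QL. 1)"
      by (intro sum_mono) (auto simp: QR_def divide_le_eq)
    finally show ?thesis by (simp add: mult_left_mono)
  qed
  have vL: "EE (\<lambda>z. (fB L z - EE (fB L))^2)
      \<le> 2048 * Delta^4 * (rowmax QL H F ^ 2)^2 * ((chi / clo)^3 * (real (card QL)^4 / real (NL Nq QL)^3))"
  proof -
    have "EE (\<lambda>z. (fB L z - EE (fB L))^2)
      \<le> 2048 * Delta^4 * (rowmax QL H F ^ 2)^2 * (\<Sum>q\<in>L. 1 / real (Nq q)^3)"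
      unfolding fB_def using QL finL by (intro variance_replicated_le[OF _ _ _ c3'])
        (auto simp: w_def L_def intro!: abs_mult_le_rowmax_sq h h')
    also have "\<dots> \<le> 2048 * Delta^4 * (rowmax QL H F ^ 2)^2 * ((chi / clo)^3 * (real (card QL)^4 / real (NL Nq QL)^3))"
      by (intro mult_left_mono sum_inverse_cube_le[OF finL N0 clo size]) (auto simp: L_def)
    finally show ?thesis .
  qed
  have "EE (\<lambda>z. (V z - EE V)^2) \<le> EE (\<lambda>z. 3 * ((fU z - EE fU)^2
      + (fB (QR Q Nq QL) z - EE (fB (QR Q Nq QL)))^2 + (fB L z - EE (fB L))^2))"
  proof (rule E_unif_mono)
    fix z
    have "V z - EE V = (fU z - EE fU) + (fB (QR Q Nq QL) z - EE (fB (QR Q Nq QL))) + (fB L z - EE (fB L))"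
      unfolding V EV by simp
    then show "(V z - EE V)^2 \<le> 3 * ((fU z - EE fU)^2
      + (fB (QR Q Nq QL) z - EE (fB (QR Q Nq QL)))^2 + (fB L z - EE (fB L))^2)"
      by (simp only: sq_add3_le)
  qed
  also have "\<dots> = 3 * (EE (\<lambda>z. (fU z - EE fU)^2)
      + EE (\<lambda>z. (fB (QR Q Nq QL) z - EE (fB (QR Q Nq QL)))^2) + EE (\<lambda>z. (fB L z - EE (fB L))^2))"
    by (simp only: E_unif_cmult E_unif_add)
  also have "\<dots> \<le> 3 * (64 * Cmu^2 * (4 * Delta^4 + 216 * (2 * Delta^4 + zeta^4))
      * (rowmax (QU Q Nq) H F ^ 2)^2 * real (card (QU Q Nq))
      + 2048 * Delta^4 * (rowmax (QR Q Nq QL) H F ^ 2)^2 * real (card (QR Q Nq QL))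
      + 2048 * Delta^4 * (rowmax QL H F ^ 2)^2 * ((chi / clo)^3 * (real (card QL)^4 / real (NL Nq QL)^3)))"
    by (intro mult_left_mono add_mono vU vR vL) simp
  finally show ?thesis by (simp add: mult_ac)
qed

end

text \<open>Adds up \<open>H^2\<close> entries and merges the three constants into one, as the
  definition of \<open>bigO_P\<close> calls for a single multiple of the rate.\<close>

lemma frobenius_to_rate:
  assumes "\<And>h h'. h < H \<Longrightarrow> h' < H \<Longrightarrow> D h h' \<le> 3 * (c1 * a1 + c2 * a2 + c3 * a3)"
    and "c1 \<ge> 0" "c2 \<ge> 0" "c3 \<ge> 0" "a1 \<ge> 0" "a2 \<ge> 0" "a3 \<ge> (0::real)"
  shows "(\<Sum>h<H. \<Sum>h'<H. D h h') \<le> 3 * (c1 + c2 + c3) * (a1 * real H^2 + a2 * real H^2 + a3 * real H^2)"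
proof -
  have "3 * (c1 * a1 + c2 * a2 + c3 * a3) \<le> 3 * ((c1 + c2 + c3) * a1 + (c1 + c2 + c3) * a2 + (c1 + c2 + c3) * a3)"
    using assms by (intro mult_left_mono add_mono mult_right_mono) auto
  then have le: "D h h' \<le> 3 * (c1 + c2 + c3) * (a1 + a2 + a3)" if "h < H" "h' < H" for h h'
    using assms(1)[OF that] by (simp add: algebra_simps)
  have "(\<Sum>h<H. \<Sum>h'<H. D h h') \<le> (\<Sum>h<H. \<Sum>h'<H. 3 * (c1 + c2 + c3) * (a1 + a2 + a3))"
    using le by (intro sum_mono) auto
  also have "\<dots> = real H^2 * (3 * (c1 + c2 + c3) * (a1 + a2 + a3))" by (simp add: power2_eq_square)
  finally show ?thesis by (simp add: algebra_simps)
qed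

theorem theorem9:
  fixes N Q H N0 :: "nat \<Rightarrow> nat"
    and Nq :: "nat \<Rightarrow> nat \<Rightarrow> nat"
    and Y :: "nat \<Rightarrow> nat \<Rightarrow> nat \<Rightarrow> real"
    and QL :: "nat \<Rightarrow> nat set"
    and G :: "nat \<Rightarrow> nat set set"
    and F :: "nat \<Rightarrow> nat \<Rightarrow> nat \<Rightarrow> real"
    and nbar :: nat
    and clo chi Cmu Delta zeta :: real
  assumes N_lim: "filterlim N at_top sequentially"
    and Nq_pos: "\<And>k q. q < Q k \<Longrightarrow> Nq k q \<ge> 1"
    and Nq_sum: "\<And>k. (\<Sum>q<Q k. Nq k q) = N k"
    and QL_sub: "\<And>k. QL k \<subseteq> {..<Q k}"
    and N0_pos: "\<And>k. N0 k \<ge> 1"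
    and c_pos: "0 < clo" and c_le: "clo \<le> chi"
    and QL_size: "\<And>k q. q \<in> QL k \<Longrightarrow> clo \<le> real (Nq k q) / real (N0 k) \<and> real (Nq k q) / real (N0 k) \<le> chi"
    and QS_size: "\<And>k q. q < Q k \<Longrightarrow> q \<notin> QL k \<Longrightarrow> Nq k q \<le> nbar"
    and G_union: "\<And>k. \<Union>(G k) = QU (Q k) (Nq k)"
    and G_disj: "\<And>k g g'. g \<in> G k \<Longrightarrow> g' \<in> G k \<Longrightarrow> g \<noteq> g' \<Longrightarrow> g \<inter> g' = {}"
    and G_card: "\<And>k g. g \<in> G k \<Longrightarrow> card g \<ge> 2"
    and S_pos: "\<And>k q. q < Q k \<Longrightarrow> Scov (N k) (Y k) q q > 0"
    and cond3: "\<And>k q. q < Q k \<Longrightarrow>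
       (\<Sum>i<N k. (Y k i q - Ybar (N k) (Y k) q)^4) / real (N k) \<le> Delta^4"
    and cond5: "\<And>k g. g \<in> G k \<Longrightarrow> real (N k) - rho (N k) (Y k) g - (real (card g) - 1) \<ge> 0"
    and cond6: "\<And>k g q. g \<in> G k \<Longrightarrow> q \<in> g \<Longrightarrow> \<bar>Ybar (N k) (Y k) q - Ybar_grp (N k) (Y k) g\<bar> \<le> zeta"
    and mu_bd: "\<And>k g. g \<in> G k \<Longrightarrow> mu (N k) g \<le> Cmu"
  shows
    "(\<forall>k. \<forall>x :: nat \<Rightarrow> real.
        (\<Sum>h<H k. \<Sum>h'<H k. x h * x h' *
           (E_unif (assignments (N k) (Q k) (Nq k))
               (\<lambda>z. Vgammahat (N k) (Q k) (Nq k) (Y k) (G k) (F k) z h h')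
            - Vgamma (N k) (Q k) (Nq k) (Y k) (F k) h h')) \<ge> 0)
     \<and> bigO_P (\<lambda>k. assignments (N k) (Q k) (Nq k))
         (\<lambda>k z. (maxnorm (H k) (\<lambda>h h'. Vgammahat (N k) (Q k) (Nq k) (Y k) (G k) (F k) z h h'
              - E_unif (assignments (N k) (Q k) (Nq k))
                  (\<lambda>w. Vgammahat (N k) (Q k) (Nq k) (Y k) (G k) (F k) w h h')))^2)
         (\<lambda>k. rowmax (QU (Q k) (Nq k)) (H k) (F k) ^ 4 * real (card (QU (Q k) (Nq k))) * real (H k)^2
            + rowmax (QR (Q k) (Nq k) (QL k)) (H k) (F k) ^ 4 * real (card (QR (Q k) (Nq k) (QL k))) * real (H k)^2
            + rowmax (QL k) (H k) (F k) ^ 4 * real (card (QL k))^4 / real (NL (Nq k) (QL k))^3 * real (H k)^2)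
     \<and> bigO_P (\<lambda>k. assignments (N k) (Q k) (Nq k))
         (\<lambda>k z. (opnorm (H k) (\<lambda>h h'. Vgammahat (N k) (Q k) (Nq k) (Y k) (G k) (F k) z h h'
              - E_unif (assignments (N k) (Q k) (Nq k))
                  (\<lambda>w. Vgammahat (N k) (Q k) (Nq k) (Y k) (G k) (F k) w h h')))^2)
         (\<lambda>k. rowmax (QU (Q k) (Nq k)) (H k) (F k) ^ 4 * real (card (QU (Q k) (Nq k))) * real (H k)^4
            + rowmax (QR (Q k) (Nq k) (QL k)) (H k) (F k) ^ 4 * real (card (QR (Q k) (Nq k) (QL k))) * real (H k)^4
            + rowmax (QL k) (H k) (F k) ^ 4 * real (card (QL k))^4 / real (NL (Nq k) (QL k))^3 * real (H k)^4)"
proof -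
  define \<Omega> where "\<Omega> = (\<lambda>k. assignments (N k) (Q k) (Nq k))"
  define D where "D = (\<lambda>k z h h'. Vgammahat (N k) (Q k) (Nq k) (Y k) (G k) (F k) z h h'
              - E_unif (\<Omega> k) (\<lambda>w. Vgammahat (N k) (Q k) (Nq k) (Y k) (G k) (F k) w h h'))"
  define aU where "aU = (\<lambda>k. rowmax (QU (Q k) (Nq k)) (H k) (F k) ^ 4 * real (card (QU (Q k) (Nq k))))"
  define aR where "aR = (\<lambda>k. rowmax (QR (Q k) (Nq k) (QL k)) (H k) (F k) ^ 4 * real (card (QR (Q k) (Nq k) (QL k))))"
  define aL where "aL = (\<lambda>k. rowmax (QL k) (H k) (F k) ^ 4 * real (card (QL k))^4 / real (NL (Nq k) (QL k))^3)"
  define cU where "cU = 64 * Cmu^2 * (4 * Delta^4 + 216 * (2 * Delta^4 + zeta^4))"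
  define cR where "cR = 2048 * Delta^4"
  define cL where "cL = 2048 * Delta^4 * (chi / clo)^3"
  have nn: "cU \<ge> 0" "cR \<ge> 0" "cL \<ge> 0" "aU k \<ge> 0" "aR k \<ge> 0" "aL k \<ge> 0" for k
    using c_pos c_le by (auto simp: cU_def cR_def cL_def aU_def aR_def aL_def)
  \<comment> \<open>Every index satisfies the locale assumptions, and the resulting constants do not
    depend on \<open>k\<close>.\<close>
  have loc: "grouped_design (N k) (Q k) (Nq k) (Y k) (G k)" for k
    by unfold_locales (use Nq_pos Nq_sum G_union G_disj G_card S_pos in auto)
  have fin: "finite (\<Omega> k)" for k
  proof -
    interpret grouped_design "N k" "Q k" "Nq k" "Y k" "G k" by (rule loc)
    show ?thesis unfolding \<Omega>_def by (rule finite_Omega)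
  qed
  have i: "(\<Sum>h<H k. \<Sum>h'<H k. x h * x h' * (E_unif (\<Omega> k) (\<lambda>z. Vgammahat (N k) (Q k) (Nq k) (Y k) (G k) (F k) z h h')
            - Vgamma (N k) (Q k) (Nq k) (Y k) (F k) h h')) \<ge> 0" for k and x :: "nat \<Rightarrow> real"
  proof -
    interpret grouped_design "N k" "Q k" "Nq k" "Y k" "G k" by (rule loc)
    show ?thesis unfolding \<Omega>_def by (rule EE_Vgammahat_ge) (rule cond5)
  qed
  have frob: "E_unif (\<Omega> k) (\<lambda>z. \<Sum>h<H k. \<Sum>h'<H k. (D k z h h')^2)
      \<le> 3 * (cU + cR + cL) * (aU k * real (H k)^2 + aR k * real (H k)^2 + aL k * real (H k)^2)" for k
  proof -
    interpret grouped_design "N k" "Q k" "Nq k" "Y k" "G k" by (rule loc)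
    have "E_unif (\<Omega> k) (\<lambda>z. (D k z h h')^2) \<le> 3 * (cU * aU k + cR * aR k + cL * aL k)" if "h < H k" "h' < H k" for h h'
      unfolding D_def \<Omega>_def cU_def cR_def cL_def aU_def aR_def aL_def
      by (rule variance_Vgammahat_le[OF QL_sub N0_pos c_pos QL_size cond3 cond6 mu_bd that])
    then have "(\<Sum>h<H k. \<Sum>h'<H k. E_unif (\<Omega> k) (\<lambda>z. (D k z h h')^2))
        \<le> 3 * (cU + cR + cL) * (aU k * real (H k)^2 + aR k * real (H k)^2 + aL k * real (H k)^2)"
      by (intro frobenius_to_rate nn)
    then show ?thesis by (simp only: E_unif_sum)
  qed
  have ii: "bigO_P \<Omega> (\<lambda>k z. (maxnorm (H k) (D k z))^2)
      (\<lambda>k. aU k * real (H k)^2 + aR k * real (H k)^2 + aL k * real (H k)^2)"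
  proof (rule bigO_P_of_E_unif_le[OF fin])
    show "E_unif (\<Omega> k) (\<lambda>z. (maxnorm (H k) (D k z))^2)
      \<le> 3 * (cU + cR + cL) * (aU k * real (H k)^2 + aR k * real (H k)^2 + aL k * real (H k)^2)" for k
      by (rule order_trans[OF E_unif_mono frob]) (rule maxnorm_sq_le)
  qed (auto intro!: add_nonneg_nonneg mult_nonneg_nonneg nn)
  have iii: "bigO_P \<Omega> (\<lambda>k z. (opnorm (H k) (D k z))^2)
      (\<lambda>k. aU k * real (H k)^4 + aR k * real (H k)^4 + aL k * real (H k)^4)"
  proof (rule bigO_P_of_E_unif_le[OF fin])
    fix k
    \<comment> \<open>The Frobenius bound yields \<open>H^2\<close> for the operator norm as well;
      the stated power 4 is weaker, including at \<open>H k = 0\<close>.\<close>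
    have H: "real (H k)^2 \<le> real (H k)^4"
      by (cases "H k = 0") (auto intro: power_increasing)
    have "E_unif (\<Omega> k) (\<lambda>z. (opnorm (H k) (D k z))^2)
      \<le> 3 * (cU + cR + cL) * (aU k * real (H k)^2 + aR k * real (H k)^2 + aL k * real (H k)^2)"
      by (rule order_trans[OF E_unif_mono frob]) (rule opnorm_sq_le)
    also have "\<dots> \<le> 3 * (cU + cR + cL) * (aU k * real (H k)^4 + aR k * real (H k)^4 + aL k * real (H k)^4)"
      by (intro mult_left_mono add_mono H nn mult_nonneg_nonneg add_nonneg_nonneg) simp
    finally show "E_unif (\<Omega> k) (\<lambda>z. (opnorm (H k) (D k z))^2)
      \<le> 3 * (cU + cR + cL) * (aU k * real (H k)^4 + aR k * real (H k)^4 + aL k * real (H k)^4)" .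
  qed (auto intro!: add_nonneg_nonneg mult_nonneg_nonneg nn)
  show ?thesis using i ii iii unfolding \<Omega>_def D_def aU_def aR_def aL_def by blast
qed

end
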